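(* Let $0<q\le1$, let $\Omega$ be any domain of $\mathbb{R}^N$, $T\in(0,\infty]$, and let $u$ be any nonnegative weak solution of (E) in $Q_{\Omega,T}$. Then $u$ admits a trace $u_0\in\mathcal{M}^+(\Omega)$, i.e. $\lim_{t\to0}\int_\Omega u(\cdot,t)\psi\,dx=\int_\Omega\psi\,du_0$ for every $\psi\in C_c(\Omega)$.
   Context: Equation (E) is $u_t-\Delta u+|\nabla u|^q=0$, $Q_{\Omega,T}=\Omega\times(0,T)$. A weak solution of (E) in $Q_{\Omega,T}$ is a function $u\in C((0,T);L^1_{loc}(\Omega))\cap L^1_{loc}((0,T);W^{1,1}_{loc}(\Omega))$ with $|\nabla u|^q\in L^1_{loc}(Q_{\Omega,T})$ satisfying (E) in the distribution sense. $\mathcal{M}^+(\Omega)$ is the set of nonnegative Radon measures on $\Omega$. *)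

theory Defs
  imports "HOL-Analysis.Analysis"
begin

definition dirderiv :: "'a::euclidean_space \<Rightarrow> ('a \<Rightarrow> real) \<Rightarrow> 'a \<Rightarrow> real" where
  "dirderiv v f p = deriv (\<lambda>s. f (p + s *\<^sub>R v)) 0"

fun dirderiv_iter :: "'a::euclidean_space list \<Rightarrow> ('a \<Rightarrow> real) \<Rightarrow> 'a \<Rightarrow> real" where
  "dirderiv_iter [] f = f"
| "dirderiv_iter (v # vs) f = dirderiv v (dirderiv_iter vs f)"

definition smooth_fun :: "('a::euclidean_space \<Rightarrow> real) \<Rightarrow> bool" where
  "smooth_fun f \<longleftrightarrow> (\<forall>vs p. dirderiv_iter vs f differentiable (at p))"

definition tsupport :: "('a::topological_space \<Rightarrow> real) \<Rightarrow> 'a set" where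
  "tsupport f = closure {x. f x \<noteq> 0}"

definition test_fun :: "'a::euclidean_space set \<Rightarrow> ('a \<Rightarrow> real) \<Rightarrow> bool" where
  "test_fun U \<phi> \<longleftrightarrow> smooth_fun \<phi> \<and> compact (tsupport \<phi>) \<and> tsupport \<phi> \<subseteq> U"

definition Cc_fun :: "'a::euclidean_space set \<Rightarrow> ('a \<Rightarrow> real) \<Rightarrow> bool" where
  "Cc_fun U \<psi> \<longleftrightarrow> continuous_on UNIV \<psi> \<and> compact (tsupport \<psi>) \<and> tsupport \<psi> \<subseteq> U"

definition tint :: "ereal \<Rightarrow> real set" where
  "tint T = {t. 0 < t \<and> ereal t < T}"

definition cyl :: "'a set \<Rightarrow> ereal \<Rightarrow> ('a \<times> real) set" where
  "cyl \<Omega> T = \<Omega> \<times> tint T"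

definition dt :: "('a::euclidean_space \<times> real \<Rightarrow> real) \<Rightarrow> 'a \<times> real \<Rightarrow> real" where
  "dt \<phi> = dirderiv (0, 1) \<phi>"

definition dxi :: "'a::euclidean_space \<Rightarrow> ('a \<times> real \<Rightarrow> real) \<Rightarrow> 'a \<times> real \<Rightarrow> real" where
  "dxi b \<phi> = dirderiv (b, 0) \<phi>"

definition lapx :: "('a::euclidean_space \<times> real \<Rightarrow> real) \<Rightarrow> 'a \<times> real \<Rightarrow> real" where
  "lapx \<phi> p = (\<Sum>b\<in>Basis. dxi b (dxi b \<phi>) p)"

text \<open>Weak solution of u_t - Lap u + |grad u|^q = 0 in Q = Omega x (0,T).
  u in C((0,T); L^1_loc(Omega)); u in L^1_loc((0,T); W^{1,1}_loc(Omega)) with weak spatial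
  gradient g; |g|^q in L^1_loc(Q); equation in the sense of distributions.\<close>
definition weak_solution :: "real \<Rightarrow> 'a::euclidean_space set \<Rightarrow> ereal \<Rightarrow> ('a \<Rightarrow> real \<Rightarrow> real) \<Rightarrow> bool" where
  "weak_solution q \<Omega> T u \<longleftrightarrow>
     (\<forall>K. compact K \<and> K \<subseteq> \<Omega> \<longrightarrow>
        (\<forall>t\<in>tint T. set_integrable lebesgue K (\<lambda>x. u x t)) \<and>
        (\<forall>t\<in>tint T. ((\<lambda>s. LINT x:K|lebesgue. \<bar>u x s - u x t\<bar>) \<longlongrightarrow> 0) (at t within tint T)))
   \<and> (\<exists>g :: 'a \<Rightarrow> real \<Rightarrow> 'a.
        (\<forall>C. compact C \<and> C \<subseteq> cyl \<Omega> T \<longrightarrow>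
            set_integrable lebesgue C (\<lambda>(x,t). u x t)
          \<and> set_integrable lebesgue C (\<lambda>(x,t). g x t)
          \<and> set_integrable lebesgue C (\<lambda>(x,t). norm (g x t) powr q))
      \<and> (\<forall>\<phi>. test_fun (cyl \<Omega> T) \<phi> \<longrightarrow>
            (\<forall>b\<in>Basis. (LINT p:cyl \<Omega> T|lebesgue. u (fst p) (snd p) * dxi b \<phi> p)
                       = - (LINT p:cyl \<Omega> T|lebesgue. (g (fst p) (snd p) \<bullet> b) * \<phi> p))
          \<and> (LINT p:cyl \<Omega> T|lebesgue.
                 - u (fst p) (snd p) * dt \<phi> p - u (fst p) (snd p) * lapx \<phi> p
                 + norm (g (fst p) (snd p)) powr q * \<phi> p) = 0))"

text \<open>Nonnegative Radon measure on Omega, represented as a Borel measure on the whole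
  space that vanishes outside Omega and is finite on compact subsets of Omega.\<close>
definition radon_on :: "'a::euclidean_space set \<Rightarrow> 'a measure \<Rightarrow> bool" where
  "radon_on \<Omega> \<mu> \<longleftrightarrow> sets \<mu> = sets borel \<and> emeasure \<mu> (UNIV - \<Omega>) = 0
     \<and> (\<forall>K. compact K \<and> K \<subseteq> \<Omega> \<longrightarrow> emeasure \<mu> K < \<infinity>)"

end

theory Submission
  imports Defs "HOL-Probability.Distributions"
begin

text \<open>
  Write f = |grad u|^q. For a test function phi on the domain, X(t) = int u(t) phi satisfies
  X(t1) - X(t2) = int int (f phi - u Lap phi) over the times between t1 and t2, so everything rests
  on bounding X near t = 0.

  Take phi = exp(-1/d) with d = R^2 - |x - a|^2. Its Laplacian is bounded below by a positive
  multiple of phi/d^4 minus a multiple of phi, so the term with Lap phi has a good sign up to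
  lower order. Since q is at most 1, f is at most 1 + |grad u|, and grad u is estimated in L^1
  linearly: testing with the time-averaged Gaussian means W of a derivative of a test function theta
  (a parametrix of the backward heat operator at scale rho) gives, for a cutoff zeta,
  int |grad u| zeta bounded by C/rho int u zeta + C rho (int f zeta + boundary terms). Applying this
  on the dyadic shells {phi >= 2^-k} at scale rho proportional to k^-2 and summing with weights 2^-k
  bounds int int |grad u| phi by a small multiple of itself and of X(t1), X(t2), plus terms
  int int u phi/d^2 that the Laplacian absorbs. A Gronwall-type argument then bounds X, hence the mass
  of u on compact sets. Consequently X(t) - C t is monotone for every nonnegative test function, so
  X has a limit; density extends this to continuous functions with compact support, and the
  Riesz representation theorem yields the trace.
\<close>

section \<open>Smooth functions\<close>

text \<open>Forward in time X grows at most linearly, because f is nonnegative; a bound as t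
  decreases to 0 has to control f from above. With one fixed cutoff the gradient estimate does not
  close: its error terms contain derivatives of the cutoff, which are not dominated by the cutoff
  itself. The weight exp(-1/d) repairs this. Where it has size 2^-k, 1/d is of order k, so a cutoff
  between the levels 2^-(k+1) and 2^-k has gradient of order k^2 and Laplacian of order k^4. At
  scale \<rho> = \<kappa>/(k+1)^2 the product of \<rho> and the gradient is a bounded multiple of
  \<kappa>, so gradient terms return with a small factor, while 1/\<rho> and \<rho> times the
  Laplacian are both of order k^2. Summing 2^-k k^2 over the levels that contain a point gives at
  most a multiple of \<phi> (1 + 1/d^2), which the Laplacian term \<phi>/d^4 beats. Absorbing terms
  into the left side is legitimate since all of them are finite for t1 > 0, and it leads to a bound
  because no constant depends on t1.\<close>

lemma dirderiv_eq:
  assumes "(f has_derivative D) (at p)"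
  shows "dirderiv v f p = D v"
proof -
  have "(f has_derivative D) (at (p + 0 *\<^sub>R v))" using assms by simp
  moreover have "((\<lambda>s::real. p + s *\<^sub>R v) has_derivative (\<lambda>s. s *\<^sub>R v)) (at 0)"
    by (auto intro!: derivative_eq_intros)
  ultimately have "((\<lambda>s. f (p + s *\<^sub>R v)) has_derivative (\<lambda>s. D (s *\<^sub>R v))) (at 0)"
    using has_derivative_compose[of "\<lambda>s::real. p + s *\<^sub>R v" _ 0 UNIV f D] by simp
  moreover have "D (s *\<^sub>R v) = D v * s" for s
    using assms by (simp add: has_derivative_def bounded_linear.linear linear_simps)
  ultimately have "((\<lambda>s. f (p + s *\<^sub>R v)) has_real_derivative D v) (at 0)"
    by (simp add: has_field_derivative_def)
  then show ?thesis unfolding dirderiv_def by (rule DERIV_imp_deriv)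
qed

lemma differentiable_has_derivative_dirderiv:
  assumes "f differentiable (at p)"
  shows "(f has_derivative (\<lambda>v. dirderiv v f p)) (at p)"
proof -
  obtain D where D: "(f has_derivative D) (at p)" using assms unfolding differentiable_def ..
  then have "(\<lambda>v. dirderiv v f p) = D" by (simp add: dirderiv_eq[OF D])
  then show ?thesis using D by simp
qed

lemma dirderiv_const: "dirderiv v (\<lambda>x. c) = (\<lambda>x. 0)"
  by (rule ext, rule dirderiv_eq[where D="\<lambda>_. 0"]) simp

lemma dirderiv_inner: "dirderiv v (\<lambda>x. x \<bullet> a) = (\<lambda>x. v \<bullet> a)"
  by (rule ext, rule dirderiv_eq[where D="\<lambda>v. v \<bullet> a"]) (auto intro!: derivative_eq_intros)

lemma dirderiv_add:
  assumes "\<And>p. f differentiable (at p)" "\<And>p. g differentiable (at p)"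
  shows "dirderiv v (\<lambda>x. f x + g x) = (\<lambda>x. dirderiv v f x + dirderiv v g x)"
  by (rule ext, rule dirderiv_eq[where D="\<lambda>v. dirderiv v f x + dirderiv v g x" for x])
    (auto intro!: derivative_eq_intros differentiable_has_derivative_dirderiv assms)

lemma dirderiv_mult:
  assumes "\<And>p. f differentiable (at p)" "\<And>p. g differentiable (at p)"
  shows "dirderiv v (\<lambda>x. f x * g x) = (\<lambda>x. f x * dirderiv v g x + dirderiv v f x * g x)"
  by (rule ext, rule dirderiv_eq[where D="\<lambda>v. f x * dirderiv v g x + dirderiv v f x * g x" for x])
    (auto intro!: derivative_eq_intros differentiable_has_derivative_dirderiv assms)

lemma has_derivative_compose_real:
  assumes "f differentiable (at p)" "(g has_real_derivative g') (at (f p))"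
  shows "((\<lambda>x. g (f x)) has_derivative (\<lambda>v. g' * dirderiv v f p)) (at p)"
  using has_derivative_compose[OF differentiable_has_derivative_dirderiv[OF assms(1)]
      assms(2)[unfolded has_field_derivative_def]] by simp

lemma dirderiv_compose_real:
  assumes "\<And>p. f differentiable (at p)" "\<And>p. (g has_real_derivative g' (f p)) (at (f p))"
  shows "dirderiv v (\<lambda>x. g (f x)) = (\<lambda>x. g' (f x) * dirderiv v f x)"
  by (rule ext, rule dirderiv_eq[where D="\<lambda>v. g' (f x) * dirderiv v f x" for x],
      rule has_derivative_compose_real) (use assms in auto)

section \<open>The flat functions exp(-1/x)/x^n\<close>

definition flat_exp :: "nat \<Rightarrow> real \<Rightarrow> real" where
  "flat_exp n x = (if x \<le> 0 then 0 else exp (- 1 / x) / x ^ n)"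

lemma flat_exp_nonneg: "0 \<le> flat_exp n x"
  by (simp add: flat_exp_def)

lemma flat_exp_pos_iff: "0 < flat_exp n x \<longleftrightarrow> 0 < x"
  by (auto simp: flat_exp_def)

lemma flat_exp_0_less_1: "flat_exp 0 x < 1"
  by (auto simp: flat_exp_def)

lemma flat_exp_0_mono: "x \<le> y \<Longrightarrow> flat_exp 0 x \<le> flat_exp 0 y"
  by (auto simp: flat_exp_def frac_le)

text \<open>A single term of the exponential series gives 1/x^(n+2) \<le> (n+2)! exp(1/x). The
  surplus factor x^2 makes the difference quotient at 0 tend to 0, which is the only delicate point
  of smoothness.\<close>

lemma flat_exp_le_power: "\<bar>flat_exp n x\<bar> \<le> fact (n + 2) * x\<^sup>2"
proof (cases "x \<le> 0")
  case True then show ?thesis by (simp add: flat_exp_def)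
next
  case False
  have "(\<Sum>k\<in>{n+2}. (1 / x) ^ k /\<^sub>R fact k) \<le> (\<Sum>k. (1 / x) ^ k /\<^sub>R fact k)"
    by (rule sum_le_suminf[OF summable_exp_generic]) (use False in auto)
  then have "(1 / x) ^ (n + 2) / fact (n + 2) \<le> exp (1 / x)"
    by (simp add: exp_def divide_inverse_commute)
  then have *: "1 / x ^ (n + 2) \<le> fact (n + 2) * exp (1 / x)"
    unfolding pos_divide_le_eq[OF fact_gt_zero] power_one_over by (simp only: mult.commute)
  have "exp (- 1 / x) / x ^ n = x\<^sup>2 * exp (- 1 / x) * (1 / x ^ (n + 2))"
    using False by (simp add: power2_eq_square)
  also have "\<dots> \<le> x\<^sup>2 * exp (- 1 / x) * (fact (n + 2) * exp (1 / x))"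
    by (rule mult_left_mono[OF *]) simp
  also have "\<dots> = fact (n + 2) * x\<^sup>2"
    by (simp add: mult.left_commute[of "exp _"] flip: exp_add)
  finally show ?thesis using False by (simp add: flat_exp_def)
qed

text \<open>The power 1/x^n is carried along so that the family is stable under differentiation: the
  exponential contributes two powers of 1/x and the denominator one.\<close>

lemma flat_exp_has_derivative:
  "(flat_exp n has_real_derivative (flat_exp (n + 2) x - n * flat_exp (n + 1) x)) (at x)"
proof (cases x "0::real" rule: linorder_cases)
  case less
  have "((\<lambda>_. 0) has_real_derivative 0) (at x)" by simp
  then have "(flat_exp n has_real_derivative 0) (at x)"
    by (rule has_field_derivative_transform_within_open[where S="{..<0}"])
      (use less in \<open>auto simp: flat_exp_def\<close>)
  then show ?thesis using less by (simp add: flat_exp_def)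
next
  case equal
  have "((\<lambda>h. flat_exp n h / h) \<longlongrightarrow> 0) (at 0)"
  proof (rule Lim_null_comparison)
    show "\<forall>\<^sub>F h in at 0. norm (flat_exp n h / h) \<le> fact (n + 2) * \<bar>h\<bar>"
    proof (intro always_eventually allI)
      fix h show "norm (flat_exp n h / h) \<le> fact (n + 2) * \<bar>h\<bar>"
      proof (cases "h = 0")
        case False
        have "\<bar>flat_exp n h\<bar> / \<bar>h\<bar> \<le> (fact (n + 2) * \<bar>h\<bar>\<^sup>2) / \<bar>h\<bar>"
          by (rule divide_right_mono) (use flat_exp_le_power[of n h] in auto)
        also have "\<dots> = fact (n + 2) * \<bar>h\<bar>" using False
          by (simp only: power2_eq_square times_divide_eq_right[symmetric]) simp
        finally show ?thesis by simp
      qed simp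
    qed
    show "((\<lambda>h. fact (n + 2) * \<bar>h\<bar>) \<longlongrightarrow> (0::real)) (at 0)"
      by (auto intro!: tendsto_eq_intros)
  qed
  then show ?thesis using equal by (simp add: DERIV_def flat_exp_def)
next
  case greater
  have "((\<lambda>x. exp (- 1 / x) / x ^ n) has_real_derivative
     (exp (- 1 / x) / x ^ (n + 2) - n * (exp (- 1 / x) / x ^ (n + 1)))) (at x)"
  proof -
    have 1: "((\<lambda>x. exp (- 1 / x)) has_real_derivative exp (- 1 / x) * (inverse x)\<^sup>2) (at x)"
      using greater by (auto intro!: derivative_eq_intros simp: power2_eq_square field_simps)
    have "((\<lambda>x. inverse x ^ n) has_real_derivative real n * (- (inverse x ^ 2) * inverse x ^ (n - 1))) (at x)"
      using DERIV_power[OF DERIV_inverse, of x n UNIV] greater by (simp add: numeral_2_eq_2)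
    moreover have "real n * (- (inverse x ^ 2) * inverse x ^ (n - 1)) = - (real n * inverse x ^ (n + 1))"
      by (cases n) (auto simp: power2_eq_square)
    ultimately have 2: "((\<lambda>x. inverse x ^ n) has_real_derivative - (real n * inverse x ^ (n + 1))) (at x)"
      by (simp only:)
    show ?thesis
      using DERIV_mult[OF 1 2] greater by (simp add: field_simps power2_eq_square)
  qed
  then have "(flat_exp n has_real_derivative
     (exp (- 1 / x) / x ^ (n + 2) - n * (exp (- 1 / x) / x ^ (n + 1)))) (at x)"
    by (rule has_field_derivative_transform_within_open[where S="{0<..}"])
      (use greater in \<open>auto simp: flat_exp_def\<close>)
  then show ?thesis using greater by (simp add: flat_exp_def)
qed

text \<open>The least class that contains all smooth functions and is closed under the operations
  below is closed under directional derivatives; hence its members are smooth.\<close>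

inductive smooth_closure :: "('a::euclidean_space \<Rightarrow> real) \<Rightarrow> bool" where
  base: "smooth_fun f \<Longrightarrow> smooth_closure f"
| const: "smooth_closure (\<lambda>x. c)"
| inner: "smooth_closure (\<lambda>x. x \<bullet> a)"
| add: "smooth_closure f \<Longrightarrow> smooth_closure g \<Longrightarrow> smooth_closure (\<lambda>x. f x + g x)"
| mult: "smooth_closure f \<Longrightarrow> smooth_closure g \<Longrightarrow> smooth_closure (\<lambda>x. f x * g x)"
| flat: "smooth_closure f \<Longrightarrow> smooth_closure (\<lambda>x. flat_exp n (f x))"
| inverse: "smooth_closure f \<Longrightarrow> (\<And>x. f x \<noteq> 0) \<Longrightarrow> smooth_closure (\<lambda>x. inverse (f x))"

lemma dirderiv_iter_append: "dirderiv_iter (vs @ ws) f = dirderiv_iter vs (dirderiv_iter ws f)"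
  by (induction vs) auto

lemma smooth_fun_dirderiv_iter: "smooth_fun f \<Longrightarrow> smooth_fun (dirderiv_iter vs f)"
  unfolding smooth_fun_def by (metis dirderiv_iter_append)

lemma smooth_fun_dirderiv: "smooth_fun f \<Longrightarrow> smooth_fun (dirderiv v f)"
  using smooth_fun_dirderiv_iter[of f "[v]"] by simp

lemma smooth_fun_differentiable: "smooth_fun f \<Longrightarrow> f differentiable (at p)"
  unfolding smooth_fun_def by (metis dirderiv_iter.simps(1))

lemma smooth_closure_dirderiv:
  "smooth_closure f \<Longrightarrow> (\<forall>p. f differentiable (at p)) \<and> (\<forall>v. smooth_closure (dirderiv v f))"
proof (induction rule: smooth_closure.induct)
  case (base f)
  then show ?case
    by (auto intro: smooth_closure.base smooth_fun_dirderiv smooth_fun_differentiable)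
next
  case (const c)
  then show ?case by (auto simp: dirderiv_const intro: smooth_closure.const)
next
  case (inner a)
  then show ?case
    by (auto simp: dirderiv_inner intro!: smooth_closure.const
        bounded_linear_imp_differentiable bounded_linear_inner_left)
next
  case (add f g)
  then show ?case by (simp add: dirderiv_add smooth_closure.add)
next
  case (mult f g)
  then show ?case by (simp add: dirderiv_mult smooth_closure.intros)
next
  case (flat f n)
  have "(\<lambda>x. flat_exp n (f x)) differentiable (at p)" for p
    using has_derivative_compose_real[OF _ flat_exp_has_derivative, of f p n] flat(2)
    unfolding differentiable_def by blast
  moreover have "dirderiv v (\<lambda>x. flat_exp n (f x)) =
      (\<lambda>x. (flat_exp (n + 2) (f x) + (- real n) * flat_exp (n + 1) (f x)) * dirderiv v f x)" for v
    using dirderiv_compose_real[of f "flat_exp n" "\<lambda>y. flat_exp (n + 2) y - n * flat_exp (n + 1) y" v]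
      flat_exp_has_derivative flat(2) by simp
  moreover have "smooth_closure
      (\<lambda>x. (flat_exp (n + 2) (f x) + (- real n) * flat_exp (n + 1) (f x)) * dirderiv v f x)" for v
    by (intro smooth_closure.add smooth_closure.mult smooth_closure.flat smooth_closure.inverse
        smooth_closure.const) (use flat in auto)
  ultimately show ?case by simp
next
  case (inverse f)
  have D: "(inverse has_real_derivative - (inverse (f p) * inverse (f p))) (at (f p))" for p
    using DERIV_inverse[of "f p" UNIV] inverse.hyps by (simp add: power2_eq_square)
  have "(\<lambda>x. inverse (f x)) differentiable (at p)" for p
    using has_derivative_compose_real[of f p inverse, OF _ D[of p]] inverse.IH
    unfolding differentiable_def by blast
  moreover have "dirderiv v (\<lambda>x. inverse (f x)) =
      (\<lambda>x. ((- 1) * (inverse (f x) * inverse (f x))) * dirderiv v f x)" for v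
    using dirderiv_compose_real[of f "inverse" "\<lambda>y. - (inverse y * inverse y)" v] D inverse.IH
    by simp
  moreover have "smooth_closure
      (\<lambda>x. ((- 1) * (inverse (f x) * inverse (f x))) * dirderiv v f x)" for v
    by (intro smooth_closure.add smooth_closure.mult smooth_closure.flat smooth_closure.inverse
        smooth_closure.const) (use inverse in auto)
  ultimately show ?case by simp
qed

lemma smooth_fun_iff_smooth_closure: "smooth_fun f \<longleftrightarrow> smooth_closure f"
proof
  assume f: "smooth_closure f"
  have "smooth_closure (dirderiv_iter vs f)" for vs
    by (induction vs) (auto simp: f smooth_closure_dirderiv)
  then show "smooth_fun f" by (auto simp: smooth_fun_def smooth_closure_dirderiv)
qed (rule smooth_closure.base)

lemmas smooth_intros = smooth_closure.const[folded smooth_fun_iff_smooth_closure]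
  smooth_closure.inner[folded smooth_fun_iff_smooth_closure]
  smooth_closure.add[folded smooth_fun_iff_smooth_closure]
  smooth_closure.mult[folded smooth_fun_iff_smooth_closure]
  smooth_closure.flat[folded smooth_fun_iff_smooth_closure]
  smooth_closure.inverse[folded smooth_fun_iff_smooth_closure]

lemma smooth_fun_uminus: "smooth_fun f \<Longrightarrow> smooth_fun (\<lambda>x. - f x)"
  using smooth_intros(4)[OF smooth_intros(1)[of "-1"]] by simp

lemma smooth_fun_diff: "smooth_fun f \<Longrightarrow> smooth_fun g \<Longrightarrow> smooth_fun (\<lambda>x. f x - g x)"
  using smooth_intros(3)[OF _ smooth_fun_uminus] by simp

lemma smooth_fun_sum: "(\<And>i. i \<in> I \<Longrightarrow> smooth_fun (f i)) \<Longrightarrow> smooth_fun (\<lambda>x. \<Sum>i\<in>I. f i x)"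
  by (induction I rule: infinite_finite_induct) (auto simp: smooth_intros)

lemma smooth_fun_continuous: "smooth_fun f \<Longrightarrow> continuous_on S f"
  by (intro continuous_at_imp_continuous_on ballI differentiable_imp_continuous_within
      smooth_fun_differentiable)

text \<open>Iterated directional derivatives pass through an affine map when each direction v is
  replaced by L v. Applied to the two projections of space-time, this handles functions of x alone
  and of t alone.\<close>

lemma smooth_fun_compose_affine:
  assumes f: "smooth_fun f" and L: "bounded_linear L"
  shows "smooth_fun (\<lambda>x. f (L x + a))"
    and "dirderiv v (\<lambda>x. f (L x + a)) = (\<lambda>x. dirderiv (L v) f (L x + a))"
proof -
  have *: "((\<lambda>x. g (L x + a)) has_derivative (\<lambda>v. dirderiv (L v) g (L p + a))) (at p)"
    if "smooth_fun g" for g p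
  proof -
    have "((\<lambda>x. L x + a) has_derivative L) (at p)"
      using has_derivative_add_const[OF bounded_linear_imp_has_derivative[OF L]] .
    from has_derivative_compose[OF this differentiable_has_derivative_dirderiv
        [OF smooth_fun_differentiable[OF that]]]
    show ?thesis .
  qed
  have D: "dirderiv v (\<lambda>x. g (L x + a)) = (\<lambda>x. dirderiv (L v) g (L x + a))"
    if "smooth_fun g" for g v
    by (rule ext, rule dirderiv_eq, rule *[OF that])
  have "dirderiv_iter vs (\<lambda>x. f (L x + a)) = (\<lambda>x. dirderiv_iter (map L vs) f (L x + a))" for vs
    by (induction vs) (auto simp: D smooth_fun_dirderiv_iter f)
  then show "smooth_fun (\<lambda>x. f (L x + a))"
    unfolding smooth_fun_def using *[OF smooth_fun_dirderiv_iter[OF f]]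
    by (auto simp: differentiable_def)
  show "dirderiv v (\<lambda>x. f (L x + a)) = (\<lambda>x. dirderiv (L v) f (L x + a))" by (rule D[OF f])
qed

section \<open>Test functions\<close>

lemma in_tsupport: "f x \<noteq> 0 \<Longrightarrow> x \<in> tsupport f"
  unfolding tsupport_def by (rule subsetD[OF closure_subset]) simp

lemma not_in_tsupport: "x \<notin> tsupport f \<Longrightarrow> f x = 0"
  using in_tsupport[of f x] by argo

lemma closed_tsupport: "closed (tsupport f)"
  by (simp add: tsupport_def)

lemma tsupport_minimal: "closed S \<Longrightarrow> (\<And>x. f x \<noteq> 0 \<Longrightarrow> x \<in> S) \<Longrightarrow> tsupport f \<subseteq> S"
  unfolding tsupport_def by (rule closure_minimal) auto

lemma dirderiv_eq_0:
  assumes "x \<notin> tsupport f"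
  shows "dirderiv v f x = 0"
proof (rule dirderiv_eq)
  show "(f has_derivative (\<lambda>_. 0)) (at x)"
    by (rule has_derivative_transform_within_open[where f="\<lambda>_. 0" and s="- tsupport f"])
      (use assms closed_tsupport[of f] not_in_tsupport[of _ f] in \<open>auto\<close>)
qed

lemma test_fun_smooth: "test_fun U f \<Longrightarrow> smooth_fun f"
  by (simp add: test_fun_def)

lemma test_fun_subset:
  assumes "test_fun U f" "smooth_fun g" "\<And>x. g x \<noteq> 0 \<Longrightarrow> x \<in> tsupport f"
  shows "test_fun U g"
proof -
  have "tsupport g \<subseteq> tsupport f"
    by (rule tsupport_minimal[OF closed_tsupport assms(3)])
  then show ?thesis
    using assms(1,2) compact_Int_closed[of "tsupport f" "tsupport g"] closed_tsupport[of g]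
    by (auto simp: test_fun_def Int_absorb1)
qed

lemma test_fun_mult:
  assumes f: "test_fun U f" and g: "smooth_fun g"
  shows "test_fun U (\<lambda>x. f x * g x)"
proof (rule test_fun_subset[OF f])
  show "smooth_fun (\<lambda>x. f x * g x)" by (rule smooth_intros(4)[OF test_fun_smooth[OF f] g])
qed (simp add: in_tsupport)

lemma test_fun_dirderiv:
  assumes f: "test_fun U f"
  shows "test_fun U (dirderiv v f)"
proof (rule test_fun_subset[OF f])
  show "smooth_fun (dirderiv v f)" by (rule smooth_fun_dirderiv[OF test_fun_smooth[OF f]])
  show "x \<in> tsupport f" if "dirderiv v f x \<noteq> 0" for x using that dirderiv_eq_0[of x f v] by argo
qed

lemma test_fun_add:
  assumes f: "test_fun U f" and g: "test_fun U g"
  shows "test_fun U (\<lambda>x. f x + g x)"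
proof -
  let ?S = "tsupport f \<union> tsupport g"
  have S: "compact ?S" "?S \<subseteq> U" using f g by (auto simp: test_fun_def)
  have "tsupport (\<lambda>x. f x + g x) \<subseteq> ?S"
  proof (rule tsupport_minimal)
    show "x \<in> ?S" if "f x + g x \<noteq> 0" for x
      using that in_tsupport[of f x] in_tsupport[of g x] by (cases "f x = 0") auto
  qed (simp add: closed_tsupport closed_Un)
  then show ?thesis
    using S f g compact_Int_closed[of ?S "tsupport (\<lambda>x. f x + g x)"] closed_tsupport[of "\<lambda>x. f x + g x"]
    by (auto simp: test_fun_def Int_absorb1 intro: smooth_intros(3))
qed

lemma test_fun_zero: "test_fun U (\<lambda>x. 0)"
  using smooth_intros(1)[of 0] by (simp add: test_fun_def tsupport_def)

lemma test_fun_sum: "(\<And>i. i \<in> I \<Longrightarrow> test_fun U (f i)) \<Longrightarrow> test_fun U (\<lambda>x. \<Sum>i\<in>I. f i x)"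
  by (induction I rule: infinite_finite_induct) (auto simp: test_fun_zero test_fun_add)

lemma test_fun_cmult: "test_fun U f \<Longrightarrow> test_fun U (\<lambda>x. c * f x)"
  using test_fun_mult[OF _ smooth_intros(1)[of c]] by (simp add: mult.commute)

lemma test_fun_mono: "test_fun U f \<Longrightarrow> U \<subseteq> V \<Longrightarrow> test_fun V f"
  by (auto simp: test_fun_def)

lemma test_fun_Cc: "test_fun U f \<Longrightarrow> Cc_fun U f"
  by (auto simp: test_fun_def Cc_fun_def smooth_fun_continuous)

lemma Cc_fun_bounded:
  assumes "Cc_fun U f"
  obtains B where "0 < B" "\<And>x. \<bar>f x\<bar> \<le> B"
proof -
  have "compact (f ` tsupport f)"
    using assms continuous_on_subset[of UNIV f "tsupport f"]
    by (intro compact_continuous_image) (auto simp: Cc_fun_def)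
  then obtain B where B: "0 < B" "\<And>y. y \<in> f ` tsupport f \<Longrightarrow> \<bar>y\<bar> \<le> B"
    using bounded_pos[of "f ` tsupport f"] compact_imp_bounded[of "f ` tsupport f"] by auto
  have "\<bar>f x\<bar> \<le> B" for x
    by (cases "x \<in> tsupport f") (use B not_in_tsupport[of x f] in auto)
  then show ?thesis using B(1) that by blast
qed

text \<open>The argument is a polynomial in x, so the bump is smooth at the centre as well. The same
  function later serves as the weight exp(-1/d).\<close>

definition ball_bump :: "'a::euclidean_space \<Rightarrow> real \<Rightarrow> 'a \<Rightarrow> real" where
  "ball_bump a R x = flat_exp 0 (R\<^sup>2 - (x - a) \<bullet> (x - a))"

lemma smooth_fun_norm_sq: "smooth_fun (\<lambda>x. (x - a) \<bullet> (x - a))"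
proof -
  have "smooth_fun (\<lambda>x. \<Sum>b\<in>Basis. (x \<bullet> b + - (a \<bullet> b)) * (x \<bullet> b + - (a \<bullet> b)))"
    by (intro smooth_fun_sum smooth_intros(1-4))
  moreover have "(\<lambda>x. (x - a) \<bullet> (x - a)) =
      (\<lambda>x. \<Sum>b\<in>Basis. (x \<bullet> b + - (a \<bullet> b)) * (x \<bullet> b + - (a \<bullet> b)))"
    by (rule ext, subst euclidean_inner) (simp add: inner_diff_left)
  ultimately show ?thesis by simp
qed

lemma ball_bump_smooth: "smooth_fun (ball_bump a R)"
  unfolding ball_bump_def[abs_def]
  by (intro smooth_intros smooth_fun_diff smooth_fun_norm_sq)

lemma ball_bump_pos_iff: "0 < R \<Longrightarrow> 0 < ball_bump a R x \<longleftrightarrow> dist a x < R"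
  unfolding ball_bump_def flat_exp_pos_iff
  using power_mono_iff[of R "norm (x - a)" 2]
  by (simp add: dist_norm norm_minus_commute[of a x] power2_norm_eq_inner[symmetric]
      flip: not_le)

lemma ball_bump_nonneg: "0 \<le> ball_bump a R x"
  by (simp add: ball_bump_def flat_exp_nonneg)

lemma ball_bump_test:
  assumes "0 < R" "cball a R \<subseteq> U"
  shows "test_fun U (ball_bump a R)"
proof -
  have "tsupport (ball_bump a R) \<subseteq> cball a R"
    by (rule tsupport_minimal)
     (use ball_bump_pos_iff[OF assms(1), of a] ball_bump_nonneg[of a R] in \<open>force simp: less_le\<close>)+
  then show ?thesis
    using assms compact_Int_closed[of "cball a R" "tsupport (ball_bump a R)"]
      closed_tsupport[of "ball_bump a R"]
    by (auto simp: test_fun_def Int_absorb1 ball_bump_smooth)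
qed

lemma test_fun_pos_on_compact:
  assumes "compact K" "open U" "K \<subseteq> U"
  obtains ch where "test_fun U ch" "\<And>x. 0 \<le> ch x" "\<And>x. x \<in> K \<Longrightarrow> 0 < ch x"
proof -
  have "\<forall>x\<in>K. \<exists>r>0. cball x r \<subseteq> U" using assms open_contains_cball by blast
  then obtain r where r: "\<And>x. x \<in> K \<Longrightarrow> 0 < r x \<and> cball x (r x) \<subseteq> U" by metis
  obtain D where D: "D \<subseteq> K" "finite D" "K \<subseteq> (\<Union>x\<in>D. ball x (r x))"
    by (rule compactE_image[OF assms(1), of K "\<lambda>x. ball x (r x)"]) (use r in force)+
  let ?ch = "\<lambda>x. \<Sum>a\<in>D. ball_bump a (r a) x"
  show ?thesis
  proof (rule that[of ?ch])
    show "test_fun U ?ch" using r D by (intro test_fun_sum ball_bump_test) auto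
    show "0 \<le> ?ch x" for x by (intro sum_nonneg ball_bump_nonneg)
    fix x assume "x \<in> K"
    then obtain a where "a \<in> D" "dist a x < r a" using D by auto
    then show "0 < ?ch x"
      using D r by (intro sum_pos2[of D a] ball_bump_nonneg) (auto simp: ball_bump_pos_iff)
  qed
qed

lemma real_polynomial_function_smooth: "real_polynomial_function p \<Longrightarrow> smooth_fun p"
proof (induction rule: real_polynomial_function.induct)
  case (linear f)
  have "f = (\<lambda>x. x \<bullet> adjoint f 1)"
    using adjoint_works[OF bounded_linear.linear[OF linear], of _ 1] by auto
  then show ?case using smooth_intros(2)[of "adjoint f 1"] by simp
qed (auto intro: smooth_intros(1-4))

text \<open>Stone-Weierstrass is applied to \<psi>/\<open>ch\<close> instead of \<psi>, where
  \<open>ch\<close> is a test function positive on the support of \<psi>. Multiplying the polynomial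
  by \<open>ch\<close> restores compact support, and the error e/B of the quotient becomes e because
  |\<open>ch\<close>| \<le> B.\<close>

lemma test_fun_dense:
  fixes \<psi> :: "'a::euclidean_space \<Rightarrow> real"
  assumes \<psi>: "Cc_fun U \<psi>" and U: "open U" and e: "0 < e"
  obtains \<theta> where "test_fun U \<theta>" "\<And>x. \<bar>\<theta> x - \<psi> x\<bar> \<le> e"
proof -
  have K: "compact (tsupport \<psi>)" "tsupport \<psi> \<subseteq> U" and c: "continuous_on UNIV \<psi>"
    using \<psi> by (auto simp: Cc_fun_def)
  obtain ch where ch: "test_fun U ch" "\<And>x. 0 \<le> ch x" "\<And>x. x \<in> tsupport \<psi> \<Longrightarrow> 0 < ch x"
    by (rule test_fun_pos_on_compact[OF K(1) U K(2)]) blast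
  have cc: "continuous_on UNIV ch" using ch by (simp add: smooth_fun_continuous test_fun_def)
  obtain B where B: "0 < B" "\<And>x. \<bar>ch x\<bar> \<le> B"
    by (rule Cc_fun_bounded[OF test_fun_Cc[OF ch(1)]]) blast
  have o: "open {x. ch x > 0}" using cc by (intro open_Collect_less) (auto)
  \<comment> \<open>The quotient is glued from two open sets that cover the space: the set where
    \<open>ch\<close> is positive, and the complement of the support of \<psi>, where the quotient
    is constantly 0.\<close>
  have "continuous_on ({x. ch x > 0} \<union> - tsupport \<psi>) (\<lambda>x. \<psi> x / ch x)"
  proof (rule continuous_on_open_Un)
    show "continuous_on {x. ch x > 0} (\<lambda>x. \<psi> x / ch x)"
      by (intro continuous_intros continuous_on_subset[OF c] continuous_on_subset[OF cc]) auto
    show "continuous_on (- tsupport \<psi>) (\<lambda>x. \<psi> x / ch x)"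
      by (rule continuous_on_eq[of _ "\<lambda>_. 0"]) (auto simp: not_in_tsupport)
  qed (use o closed_tsupport in auto)
  moreover have "{x. ch x > 0} \<union> - tsupport \<psi> = UNIV" using ch(3) by auto
  ultimately have q: "continuous_on UNIV (\<lambda>x. \<psi> x / ch x)" by simp
  have "compact (tsupport ch)" using ch(1) by (simp add: test_fun_def)
  from Stone_Weierstrass_polynomial_function[OF this continuous_on_subset[OF q], of "e / B"]
  obtain p where p: "polynomial_function p" "\<And>x. x \<in> tsupport ch \<Longrightarrow> \<bar>\<psi> x / ch x - p x\<bar> < e / B"
    using e B by auto
  have sp: "smooth_fun p"
    using p(1) by (simp add: real_polynomial_function_smooth real_polynomial_function_eq)
  show ?thesis
  proof (rule that[of "\<lambda>x. ch x * p x"])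
    show "test_fun U (\<lambda>x. ch x * p x)" using ch(1) sp by (rule test_fun_mult)
    fix x
    show "\<bar>ch x * p x - \<psi> x\<bar> \<le> e"
    proof (cases "ch x = 0")
      case True
      then have "x \<notin> tsupport \<psi>" using ch(3)[of x] by auto
      then show ?thesis using True e by (simp add: not_in_tsupport)
    next
      case False
      then have "ch x * p x - \<psi> x = ch x * (p x - \<psi> x / ch x)" by (simp add: field_simps)
      also have "\<bar>\<dots>\<bar> = \<bar>ch x\<bar> * \<bar>\<psi> x / ch x - p x\<bar>" by (simp add: abs_mult abs_minus_commute)
      also have "\<dots> \<le> B * (e / B)"
        using p(2)[OF in_tsupport[of ch x]] False B by (intro mult_mono) auto
      finally show ?thesis using B by simp
    qed
  qed
qed

lemma continuous_borel_measurable_lebesgue: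
  "continuous_on UNIV f \<Longrightarrow> f \<in> borel_measurable lebesgue"
  by (rule measurable_completion) (simp add: borel_measurable_continuous_onI)

text \<open>Duality between L^1 and smooth functions bounded by 1: sgn w is an almost everywhere
  limit of continuous functions, which are clamped to [-1, 1], cut off at large norm and replaced by
  nearby test functions. Dominated convergence with majorant |w| recovers the integral of
  |w|.\<close>

lemma abs_integral_le_test:
  fixes w :: "'a::euclidean_space \<Rightarrow> real"
  assumes w: "integrable lebesgue w"
    and B: "\<And>\<theta>. test_fun UNIV \<theta> \<Longrightarrow> (\<And>x. \<bar>\<theta> x\<bar> \<le> 1) \<Longrightarrow> (\<integral>x. w x * \<theta> x \<partial>lebesgue) \<le> B"
  shows "(\<integral>x. \<bar>w x\<bar> \<partial>lebesgue) \<le> B"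
proof -
  have [measurable]: "w \<in> borel_measurable lebesgue" using w by auto
  have "(\<lambda>x. sgn (w x)) \<in> borel_measurable lebesgue" by measurable
  then have "(\<lambda>x. sgn (w x)) measurable_on UNIV"
    by (intro lebesgue_measurable_imp_measurable_on) auto
  then obtain N s where N: "negligible N" and s: "\<And>n::nat. continuous_on UNIV (s n)"
    and lim: "\<And>x. x \<notin> N \<Longrightarrow> (\<lambda>n. s n x) \<longlonglongrightarrow> sgn (w x)"
    unfolding measurable_on_def by auto
  define \<psi> where "\<psi> n x = max (-1) (min 1 (s n x)) * max 0 (min 1 (real n + 1 - norm x))" for n x
  have \<psi>1: "\<bar>\<psi> n x\<bar> \<le> 1" for n x
    unfolding \<psi>_def abs_mult by (intro mult_le_one) auto
  have "Cc_fun UNIV (\<psi> n)" for n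
  proof -
    have t: "tsupport (\<psi> n) \<subseteq> cball 0 (real n + 1)"
      by (rule tsupport_minimal) (auto simp: \<psi>_def max_def split: if_splits)
    have "continuous_on UNIV (\<psi> n)" unfolding \<psi>_def by (intro continuous_intros s)
    then show ?thesis
      using compact_Int_closed[OF compact_cball closed_tsupport, of 0 "real n + 1" "\<psi> n"] t
      by (auto simp: Cc_fun_def Int_absorb1)
  qed
  then have "\<exists>\<theta>. test_fun UNIV \<theta> \<and> (\<forall>x. \<bar>\<theta> x - \<psi> n x\<bar> \<le> 1 / (real n + 1))" for n
    by (rule test_fun_dense[of UNIV "\<psi> n" "1 / (real n + 1)"]) auto
  then obtain \<theta> where \<theta>: "\<And>n. test_fun UNIV (\<theta> n)"
    and \<theta>\<psi>: "\<And>n x. \<bar>\<theta> n x - \<psi> n x\<bar> \<le> 1 / (real n + 1)"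
    by metis
  \<comment> \<open>The test function may exceed 1 in modulus by 1/(n+1). This factor brings it back
    to at most 1 and tends to 1.\<close>
  define c where "c n = 1 / (1 + 1 / (real n + 1))" for n
  have c_pos: "0 < c n" for n by (simp add: c_def add_pos_nonneg)
  have c_lim: "c \<longlonglongrightarrow> 1"
  proof -
    have "(\<lambda>n. 1 / (1 + inverse (real (Suc n)))) \<longlonglongrightarrow> 1 / (1 + 0)"
      by (intro tendsto_intros LIMSEQ_inverse_real_of_nat) auto
    then show ?thesis by (simp add: c_def[abs_def] inverse_eq_divide add.commute)
  qed
  have \<theta>1: "\<bar>c n * \<theta> n x\<bar> \<le> 1" for n x
  proof -
    have "\<bar>\<theta> n x\<bar> \<le> 1 + 1 / (real n + 1)" using \<theta>\<psi>[of n x] \<psi>1[of n x] by linarith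
    then show ?thesis using c_pos[of n] unfolding abs_mult c_def
      by (simp add: divide_le_eq add_pos_nonneg)
  qed
  have lim\<theta>: "(\<lambda>n. w x * (c n * \<theta> n x)) \<longlonglongrightarrow> \<bar>w x\<bar>" if "x \<notin> N" for x
  proof -
    have "(\<lambda>n. max (-1) (min 1 (s n x))) \<longlonglongrightarrow> max (-1) (min 1 (sgn (w x)))"
      by (intro tendsto_intros lim that)
    then have 1: "(\<lambda>n. max (-1) (min 1 (s n x))) \<longlonglongrightarrow> sgn (w x)"
      by (simp add: sgn_real_def split: if_splits)
    have "(\<lambda>n. max 0 (min 1 (real n + 1 - norm x))) \<longlonglongrightarrow> 1"
    proof (rule tendsto_eventually)
      show "\<forall>\<^sub>F n in sequentially. max 0 (min 1 (real n + 1 - norm x)) = 1"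
        using eventually_ge_at_top[of "nat \<lceil>norm x\<rceil>"]
      proof eventually_elim
        case (elim n)
        then have "norm x \<le> real n" by linarith
        then show ?case by simp
      qed
    qed
    from tendsto_mult[OF 1 this] have "(\<lambda>n. \<psi> n x) \<longlonglongrightarrow> sgn (w x)" by (simp add: \<psi>_def)
    moreover have "(\<lambda>n. \<theta> n x - \<psi> n x) \<longlonglongrightarrow> 0"
    proof (rule Lim_null_comparison)
      show "\<forall>\<^sub>F n in sequentially. norm (\<theta> n x - \<psi> n x) \<le> 1 / (real n + 1)" using \<theta>\<psi> by simp
      show "(\<lambda>n. 1 / (real n + 1)) \<longlonglongrightarrow> 0"
        using LIMSEQ_inverse_real_of_nat by (simp add: inverse_eq_divide add.commute)
    qed
    ultimately have "(\<lambda>n. (\<theta> n x - \<psi> n x) + \<psi> n x) \<longlonglongrightarrow> 0 + sgn (w x)" by (intro tendsto_add)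
    then have "(\<lambda>n. w x * (c n * \<theta> n x)) \<longlonglongrightarrow> w x * (1 * sgn (w x))"
      by (intro tendsto_mult tendsto_const c_lim) simp
    then show ?thesis by (simp add: abs_sgn)
  qed
  have m: "\<theta> n \<in> borel_measurable lebesgue" for n
    by (rule continuous_borel_measurable_lebesgue[OF smooth_fun_continuous[OF test_fun_smooth[OF \<theta>]]])
  have "(\<lambda>n. \<integral>x. w x * (c n * \<theta> n x) \<partial>lebesgue) \<longlonglongrightarrow> (\<integral>x. \<bar>w x\<bar> \<partial>lebesgue)"
  proof (rule integral_dominated_convergence[where w="\<lambda>x. \<bar>w x\<bar>"])
    show "AE x in lebesgue. (\<lambda>n. w x * (c n * \<theta> n x)) \<longlonglongrightarrow> \<bar>w x\<bar>"
      using N lim\<theta> by (intro AE_I'[of N]) (auto simp: negligible_iff_null_sets)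
    show "AE x in lebesgue. norm (w x * (c n * \<theta> n x)) \<le> \<bar>w x\<bar>" for n
      using \<theta>1[of n] by (intro AE_I2) (simp add: abs_mult[of "w _"] mult_left_le)
  qed (use w m in auto)
  moreover have "(\<integral>x. w x * (c n * \<theta> n x) \<partial>lebesgue) \<le> B" for n
    using \<theta>1 \<theta> by (intro B test_fun_cmult) auto
  ultimately show ?thesis by (intro LIMSEQ_le_const2) auto
qed

text \<open>The transition takes place between 1/2 and 1, so that composing with 2^k times the
  weight gives a cutoff between two consecutive dyadic levels.\<close>

definition smooth_step :: "real \<Rightarrow> real" where
  "smooth_step y = flat_exp 0 (y - 1 / 2) * inverse (flat_exp 0 (y - 1 / 2) + flat_exp 0 (1 - y))"

lemma smooth_step_denominator_pos: "0 < flat_exp 0 (y - 1 / 2) + flat_exp 0 (1 - y)"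
  using flat_exp_nonneg[of 0 "y - 1/2"] flat_exp_nonneg[of 0 "1 - y"]
    flat_exp_pos_iff[of 0 "y - 1/2"] flat_exp_pos_iff[of 0 "1 - y"]
  by (cases "y < 1") (auto intro: add_pos_nonneg add_nonneg_pos)

lemma smooth_fun_smooth_step:
  assumes "smooth_fun f"
  shows "smooth_fun (\<lambda>x. smooth_step (f x))"
proof -
  have a: "smooth_fun (\<lambda>x. flat_exp 0 (f x - 1 / 2))"
    by (rule smooth_intros(5)[OF smooth_fun_diff[OF assms smooth_intros(1)]])
  have b: "smooth_fun (\<lambda>x. flat_exp 0 (1 - f x))"
    by (rule smooth_intros(5)[OF smooth_fun_diff[OF smooth_intros(1) assms]])
  show ?thesis
    unfolding smooth_step_def
    by (rule smooth_intros(4)[OF a smooth_intros(6)[OF smooth_intros(3)[OF a b]]])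
      (use smooth_step_denominator_pos in \<open>auto simp: less_le\<close>)
qed

lemma smooth_fun_ident: "smooth_fun (\<lambda>x::real. x)"
  using smooth_intros(2)[of "1::real"] by simp

lemma smooth_step_smooth: "smooth_fun smooth_step"
  using smooth_fun_smooth_step[OF smooth_fun_ident] by simp

lemma smooth_step_eq_0: "y \<le> 1 / 2 \<Longrightarrow> smooth_step y = 0"
  by (simp add: smooth_step_def flat_exp_def)

lemma smooth_step_eq_1: "1 \<le> y \<Longrightarrow> smooth_step y = 1"
  by (simp add: smooth_step_def flat_exp_def)

lemma smooth_step_mono: "mono smooth_step"
proof (rule monoI)
  fix x y :: real assume "x \<le> y"
  then have a: "flat_exp 0 (x - 1/2) \<le> flat_exp 0 (y - 1/2)" "flat_exp 0 (1 - y) \<le> flat_exp 0 (1 - x)"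
    by (auto intro: flat_exp_0_mono)
  \<comment> \<open>After clearing the two positive denominators this is all that remains, since the
    common product on both sides cancels.\<close>
  have "flat_exp 0 (x - 1/2) * flat_exp 0 (1 - y) \<le> flat_exp 0 (y - 1/2) * flat_exp 0 (1 - x)"
    by (intro mult_mono a flat_exp_nonneg)
  then show "smooth_step x \<le> smooth_step y"
    unfolding smooth_step_def divide_inverse[symmetric]
    using smooth_step_denominator_pos[of x] smooth_step_denominator_pos[of y]
    by (simp add: pos_divide_le_eq pos_le_divide_eq algebra_simps)
qed

lemma smooth_step_bounds: "0 \<le> smooth_step y" "smooth_step y \<le> 1"
proof -
  show "0 \<le> smooth_step y"
    using monoD[OF smooth_step_mono, of "min y 0" y] smooth_step_eq_0[of "min y 0"] by simp
  show "smooth_step y \<le> 1"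
    using monoD[OF smooth_step_mono, of y "max y 1"] smooth_step_eq_1[of "max y 1"] by simp
qed

lemma smooth_fun_real_derivative:
  fixes f :: "real \<Rightarrow> real"
  assumes "smooth_fun f"
  shows "(f has_real_derivative dirderiv 1 f x) (at x)"
proof -
  have D: "(f has_derivative (\<lambda>v. dirderiv v f x)) (at x)"
    by (rule differentiable_has_derivative_dirderiv[OF smooth_fun_differentiable[OF assms]])
  have "(\<lambda>v. dirderiv v f x) = (\<lambda>v. dirderiv 1 f x * v)"
  proof
    fix v show "dirderiv v f x = dirderiv 1 f x * v"
      using linear_scale[OF has_derivative_linear[OF D], of v 1]
      unfolding real_scaleR_def mult_1_right by (rule trans) (rule mult.commute)
  qed
  from subst[where P="\<lambda>d. (f has_derivative d) (at x)", OF this D]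
  show ?thesis by (simp only: has_field_derivative_def)
qed

definition step_deriv :: "real \<Rightarrow> real" where "step_deriv = dirderiv 1 smooth_step"
definition step_deriv2 :: "real \<Rightarrow> real" where "step_deriv2 = dirderiv 1 step_deriv"

lemma step_deriv_smooth: "smooth_fun step_deriv"
  unfolding step_deriv_def by (rule smooth_fun_dirderiv[OF smooth_step_smooth])

lemma step_deriv_derivative: "(smooth_step has_real_derivative step_deriv x) (at x)"
  unfolding step_deriv_def by (rule smooth_fun_real_derivative[OF smooth_step_smooth])

lemma step_deriv2_derivative: "(step_deriv has_real_derivative step_deriv2 x) (at x)"
  unfolding step_deriv2_def by (rule smooth_fun_real_derivative[OF step_deriv_smooth])

lemma step_deriv_nonneg: "0 \<le> step_deriv x"
  by (rule mono_on_imp_deriv_nonneg[OF _ step_deriv_derivative, of UNIV])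
    (use smooth_step_mono in auto)

lemma step_deriv_eq_0: "x < 1 / 2 \<or> 1 < x \<Longrightarrow> step_deriv x = 0 \<and> step_deriv2 x = 0"
proof -
  assume x: "x < 1 / 2 \<or> 1 < x"
  have 0: "step_deriv y = 0" if "y < 1 / 2 \<or> 1 < y" for y
  proof (cases "y < 1 / 2")
    case True
    have "(smooth_step has_real_derivative 0) (at y)"
      by (rule has_field_derivative_transform_within_open[where f="\<lambda>_. 0" and S="{..<1/2}"])
        (use True smooth_step_eq_0 in auto)
    then show ?thesis by (rule DERIV_unique[OF step_deriv_derivative])
  next
    case False
    have "(smooth_step has_real_derivative 0) (at y)"
      by (rule has_field_derivative_transform_within_open[where f="\<lambda>_. 1" and S="{1<..}"])
        (use False that smooth_step_eq_1 in auto)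
    then show ?thesis by (rule DERIV_unique[OF step_deriv_derivative])
  qed
  have "(step_deriv has_real_derivative 0) (at x)"
    by (rule has_field_derivative_transform_within_open[where f="\<lambda>_. 0" and S="{..<1/2} \<union> {1<..}"])
      (use 0 x in auto)
  from DERIV_unique[OF step_deriv2_derivative this] show ?thesis using 0[OF x] by simp
qed

lemma step_deriv_test: "test_fun UNIV step_deriv"
proof -
  have "tsupport step_deriv \<subseteq> {1/2..1}"
  proof (rule tsupport_minimal)
    show "x \<in> {1/2..1}" if "step_deriv x \<noteq> 0" for x
      using that step_deriv_eq_0[of x] by (cases "x < 1 / 2 \<or> 1 < x") auto
  qed simp
  then show ?thesis
    using compact_Int_closed[of "{1/2..1}" "tsupport step_deriv"] closed_tsupport[of step_deriv]
    by (auto simp: test_fun_def Int_absorb1 step_deriv_smooth)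
qed

lemma step_deriv_bounded: obtains C where "0 < C" "\<And>x. \<bar>step_deriv x\<bar> \<le> C" "\<And>x. \<bar>step_deriv2 x\<bar> \<le> C"
proof -
  obtain C1 where "0 < C1" "\<And>x. \<bar>step_deriv x\<bar> \<le> C1"
    by (rule Cc_fun_bounded[OF test_fun_Cc[OF step_deriv_test]]) blast
  moreover obtain C2 where "0 < C2" "\<And>x. \<bar>step_deriv2 x\<bar> \<le> C2"
    unfolding step_deriv2_def
    by (rule Cc_fun_bounded[OF test_fun_Cc[OF test_fun_dirderiv[OF step_deriv_test]]]) blast
  ultimately show ?thesis by (intro that[of "max C1 C2"]) (auto simp: le_max_iff_disj)
qed

section \<open>Averages of test functions\<close>

lemma dirderiv_linear:
  assumes "f differentiable (at p)"
  shows "dirderiv v f p = (\<Sum>b\<in>Basis. (v \<bullet> b) * dirderiv b f p)"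
proof -
  have L: "linear (\<lambda>v. dirderiv v f p)"
    by (rule has_derivative_linear[OF differentiable_has_derivative_dirderiv[OF assms]])
  have "dirderiv v f p = dirderiv (\<Sum>b\<in>Basis. (v \<bullet> b) *\<^sub>R b) f p"
    by (simp only: euclidean_representation)
  also have "\<dots> = (\<Sum>b\<in>Basis. dirderiv ((v \<bullet> b) *\<^sub>R b) f p)"
    by (rule linear_sum[OF L])
  also have "\<dots> = (\<Sum>b\<in>Basis. (v \<bullet> b) * dirderiv b f p)"
    by (rule sum.cong[OF refl]) (use linear_scale[OF L] in \<open>simp only: real_scaleR_def\<close>)
  finally show ?thesis .
qed

lemma test_fun_measurable: "test_fun U h \<Longrightarrow> h \<in> borel_measurable borel"
  by (intro borel_measurable_continuous_onI smooth_fun_continuous test_fun_smooth)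

lemma test_fun_bounded:
  assumes "test_fun U f"
  obtains B where "0 < B" "\<And>x. \<bar>f x\<bar> \<le> B"
  using Cc_fun_bounded[OF test_fun_Cc[OF assms]] by blast

lemma test_fun_lipschitz:
  fixes h :: "'a::euclidean_space \<Rightarrow> real"
  assumes h: "test_fun U h"
  obtains L where "0 \<le> L" "\<And>x y. \<bar>h x - h y\<bar> \<le> L * norm (x - y)"
proof -
  have "\<exists>B>0. \<forall>x. \<bar>dirderiv b h x\<bar> \<le> B" for b
    by (rule test_fun_bounded[OF test_fun_dirderiv[OF h, of b]]) blast
  then obtain B where B: "\<And>b. 0 < B b" "\<And>b x. \<bar>dirderiv b h x\<bar> \<le> B b" by metis
  define L where "L = (\<Sum>b\<in>Basis. B b)"
  have L0: "0 \<le> L" unfolding L_def by (rule sum_nonneg) (simp add: B(1) less_imp_le)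
  have D: "(h has_derivative (\<lambda>v. dirderiv v h x)) (at x)" for x
    by (rule differentiable_has_derivative_dirderiv[OF smooth_fun_differentiable[OF test_fun_smooth[OF h]]])
  have "norm (dirderiv v h x) \<le> norm v * L" for v x
  proof -
    have "\<bar>dirderiv v h x\<bar> = \<bar>\<Sum>b\<in>Basis. (v \<bullet> b) * dirderiv b h x\<bar>"
      by (subst dirderiv_linear[OF smooth_fun_differentiable[OF test_fun_smooth[OF h]]]) simp
    also have "\<dots> \<le> (\<Sum>b\<in>Basis. \<bar>(v \<bullet> b) * dirderiv b h x\<bar>)" by (rule sum_abs)
    also have "\<dots> \<le> (\<Sum>b\<in>Basis. norm v * B b)"
      unfolding abs_mult by (intro sum_mono mult_mono B(2)) (auto simp: Basis_le_norm)
    finally show ?thesis by (simp add: L_def sum_distrib_left)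
  qed
  then have "onorm (\<lambda>v. dirderiv v h x) \<le> L" for x
    by (intro onorm_le) (simp add: mult.commute)
  then have "norm (h x - h y) \<le> L * norm (x - y)" for x y
    by (intro differentiable_bound[where S=UNIV and f'="\<lambda>x v. dirderiv v h x"] D) auto
  then show ?thesis using that L0 by simp
qed

text \<open>The mean value theorem along the segment, combined with Lipschitz bounds for the first
  derivatives. One constant serves all base points y, which is what differentiation under an
  integral will use.\<close>

lemma test_fun_taylor:
  fixes h :: "'a::euclidean_space \<Rightarrow> real"
  assumes h: "test_fun U h"
  obtains C where "0 \<le> C" "\<And>y v. \<bar>h (y + v) - h y - dirderiv v h y\<bar> \<le> C * (norm v)\<^sup>2"
proof -
  have "\<exists>L\<ge>0. \<forall>x y. \<bar>dirderiv b h x - dirderiv b h y\<bar> \<le> L * norm (x - y)" for b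
    by (rule test_fun_lipschitz[OF test_fun_dirderiv[OF h, of b]]) blast
  then obtain L where L: "\<And>b. 0 \<le> L b"
    "\<And>b x y. \<bar>dirderiv b h x - dirderiv b h y\<bar> \<le> L b * norm (x - y)" by metis
  have diff: "h differentiable (at x)" for x
    by (rule smooth_fun_differentiable[OF test_fun_smooth[OF h]])
  show ?thesis
  proof (rule that)
    show "0 \<le> (\<Sum>b\<in>Basis. L b)" by (rule sum_nonneg) (rule L)
    fix y v
    have "((\<lambda>s. h (y + s *\<^sub>R v)) has_real_derivative dirderiv v h (y + s *\<^sub>R v)) (at s)" for s
    proof -
      have "((\<lambda>s::real. y + s *\<^sub>R v) has_derivative (\<lambda>s. s *\<^sub>R v)) (at s)"
        by (auto intro!: derivative_eq_intros)
      from has_derivative_compose[OF this differentiable_has_derivative_dirderiv[OF diff]]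
      have D: "((\<lambda>s. h (y + s *\<^sub>R v)) has_derivative (\<lambda>r. dirderiv (r *\<^sub>R v) h (y + s *\<^sub>R v))) (at s)" .
      have "(\<lambda>r. dirderiv (r *\<^sub>R v) h (y + s *\<^sub>R v)) = (\<lambda>r. dirderiv v h (y + s *\<^sub>R v) * r)"
        using linear_scale[OF has_derivative_linear[OF differentiable_has_derivative_dirderiv
            [OF diff[of "y + s *\<^sub>R v"]]], of _ v]
        by (simp add: mult.commute)
      then show ?thesis using D unfolding has_field_derivative_def by simp
    qed
    from MVT2[of 0 1, OF _ this] obtain s where s: "0 < s" "s < 1"
      "h (y + v) - h y = dirderiv v h (y + s *\<^sub>R v)" by auto
    have "\<bar>h (y + v) - h y - dirderiv v h y\<bar> = \<bar>dirderiv v h (y + s *\<^sub>R v) - dirderiv v h y\<bar>"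
      using s by simp
    also have "\<dots> = \<bar>\<Sum>b\<in>Basis. (v \<bullet> b) * (dirderiv b h (y + s *\<^sub>R v) - dirderiv b h y)\<bar>"
      by (subst (1 2) dirderiv_linear[OF diff]) (simp add: sum_subtractf right_diff_distrib)
    also have "\<dots> \<le> (\<Sum>b\<in>Basis. \<bar>(v \<bullet> b) * (dirderiv b h (y + s *\<^sub>R v) - dirderiv b h y)\<bar>)"
      by (rule sum_abs)
    also have "\<dots> \<le> (\<Sum>b\<in>Basis. norm v * (L b * norm v))"
    proof (rule sum_mono)
      fix b :: 'a assume b: "b \<in> Basis"
      have "norm (s *\<^sub>R v) \<le> norm v" using s by (simp add: mult_left_le_one_le)
      then have "\<bar>dirderiv b h (y + s *\<^sub>R v) - dirderiv b h y\<bar> \<le> L b * norm v"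
        using L(2)[of b "y + s *\<^sub>R v" y] mult_left_mono[OF _ L(1)[of b], of "norm (s *\<^sub>R v)" "norm v"]
        by simp
      then show "\<bar>(v \<bullet> b) * (dirderiv b h (y + s *\<^sub>R v) - dirderiv b h y)\<bar> \<le> norm v * (L b * norm v)"
        unfolding abs_mult by (intro mult_mono Basis_le_norm b) auto
    qed
    also have "\<dots> = (\<Sum>b\<in>Basis. L b) * (norm v)\<^sup>2"
      unfolding sum_distrib_right by (simp add: power2_eq_square mult_ac)
    finally show "\<bar>h (y + v) - h y - dirderiv v h y\<bar> \<le> (\<Sum>b\<in>Basis. L b) * (norm v)\<^sup>2" .
  qed
qed

text \<open>A generalised convolution: k is a weight and l a displacement, both indexed by \<omega>.
  The Gaussian mean at one fixed scale and the heat potential, which also integrates over scales,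
  are both of this form, so smoothness is proved once.\<close>

definition average :: "'c measure \<Rightarrow> ('c \<Rightarrow> real) \<Rightarrow> ('c \<Rightarrow> 'b::euclidean_space) \<Rightarrow> ('b \<Rightarrow> real) \<Rightarrow> 'b \<Rightarrow> real" where
  "average M k l h p = (\<integral>\<omega>. k \<omega> * h (p + l \<omega>) \<partial>M)"

context
  fixes M :: "'c::euclidean_space measure" and k :: "'c \<Rightarrow> real" and l :: "'c \<Rightarrow> 'b::euclidean_space"
  assumes k: "integrable M k" and l[measurable]: "l \<in> borel_measurable M"
begin

lemma average_integrable:
  assumes h: "test_fun U h"
  shows "integrable M (\<lambda>\<omega>. k \<omega> * h (p + l \<omega>))"
proof -
  obtain B where B: "0 < B" "\<And>x. \<bar>h x\<bar> \<le> B" by (rule test_fun_bounded[OF h]) blast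
  have [measurable]: "h \<in> borel_measurable borel" "k \<in> borel_measurable M"
    using test_fun_measurable[OF h] k by auto
  have "integrable M (\<lambda>\<omega>. B * k \<omega>)" using k by simp
  then show ?thesis
  proof (rule Bochner_Integration.integrable_bound)
    show "AE x in M. norm (k x * h (p + l x)) \<le> norm (B * k x)"
      using B by (intro AE_I2) (simp add: abs_mult mult.commute[of B] mult_left_mono)
  qed measurable
qed

text \<open>Integrating the uniform second-order Taylor remainder against |k| leaves a quantity
  bounded by a constant times |y - p|^2, so the derivative may be taken inside the integral.\<close>

lemma average_has_derivative:
  assumes h: "test_fun U h"
  shows "(average M k l h has_derivative (\<lambda>v. average M k l (dirderiv v h) p)) (at p)"
  unfolding has_derivative_at_alt
proof (intro conjI allI impI)
  have diff: "h differentiable (at x)" for x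
    by (rule smooth_fun_differentiable[OF test_fun_smooth[OF h]])
  have ib: "integrable M (\<lambda>\<omega>. k \<omega> * h (q + l \<omega>))" for q by (rule average_integrable[OF h])
  have id: "integrable M (\<lambda>\<omega>. k \<omega> * dirderiv v h (q + l \<omega>))" for q v
    by (rule average_integrable[OF test_fun_dirderiv[OF h]])
  have "average M k l (dirderiv v h) p = (\<Sum>b\<in>Basis. (v \<bullet> b) * average M k l (dirderiv b h) p)" for v
  proof -
    have "average M k l (dirderiv v h) p = (\<integral>\<omega>. (\<Sum>b\<in>Basis. (v \<bullet> b) * (k \<omega> * dirderiv b h (p + l \<omega>))) \<partial>M)"
      unfolding average_def
      by (subst dirderiv_linear[OF diff]) (simp add: sum_distrib_left mult_ac)
    also have "\<dots> = (\<Sum>b\<in>Basis. (v \<bullet> b) * average M k l (dirderiv b h) p)"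
      unfolding average_def by (subst Bochner_Integration.integral_sum) (use id in auto)
    finally show ?thesis .
  qed
  then have eq: "(\<lambda>v. average M k l (dirderiv v h) p) =
      (\<lambda>v. \<Sum>b\<in>Basis. (v \<bullet> b) * average M k l (dirderiv b h) p)" by (rule ext)
  show "bounded_linear (\<lambda>v. average M k l (dirderiv v h) p)"
    unfolding eq by (intro bounded_linear_sum bounded_linear_mult_const bounded_linear_inner_left)
  obtain C where C: "0 \<le> C" "\<And>y v. \<bar>h (y + v) - h y - dirderiv v h y\<bar> \<le> C * (norm v)\<^sup>2"
    by (rule test_fun_taylor[OF h]) blast
  define K where "K = (\<integral>\<omega>. \<bar>k \<omega>\<bar> \<partial>M) * C"
  have K: "0 \<le> K" unfolding K_def using C by (intro mult_nonneg_nonneg integral_nonneg) auto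
  have bound: "norm (average M k l h y - average M k l h p - average M k l (dirderiv (y - p) h) p)
      \<le> K * (norm (y - p))\<^sup>2" for y
  proof -
    have "average M k l h y - average M k l h p - average M k l (dirderiv (y - p) h) p =
        (\<integral>\<omega>. k \<omega> * h (y + l \<omega>) - k \<omega> * h (p + l \<omega>) - k \<omega> * dirderiv (y - p) h (p + l \<omega>) \<partial>M)"
      unfolding average_def using ib id by simp
    also have "norm \<dots> \<le> (\<integral>\<omega>. \<bar>k \<omega>\<bar> * (C * (norm (y - p))\<^sup>2) \<partial>M)"
    proof (rule Bochner_Integration.integral_norm_bound_integral)
      show "integrable M (\<lambda>\<omega>. k \<omega> * h (y + l \<omega>) - k \<omega> * h (p + l \<omega>) - k \<omega> * dirderiv (y - p) h (p + l \<omega>))"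
        by (intro Bochner_Integration.integrable_diff ib id)
      fix \<omega>
      have "norm (k \<omega> * h (y + l \<omega>) - k \<omega> * h (p + l \<omega>) - k \<omega> * dirderiv (y - p) h (p + l \<omega>)) =
          \<bar>k \<omega>\<bar> * \<bar>h ((p + l \<omega>) + (y - p)) - h (p + l \<omega>) - dirderiv (y - p) h (p + l \<omega>)\<bar>"
        by (simp add: abs_mult[symmetric] algebra_simps)
      also have "\<dots> \<le> \<bar>k \<omega>\<bar> * (C * (norm (y - p))\<^sup>2)" by (intro mult_left_mono C) auto
      finally show "norm (k \<omega> * h (y + l \<omega>) - k \<omega> * h (p + l \<omega>) - k \<omega> * dirderiv (y - p) h (p + l \<omega>))
          \<le> \<bar>k \<omega>\<bar> * (C * (norm (y - p))\<^sup>2)" .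
    qed (use k in auto)
    also have "\<dots> = K * (norm (y - p))\<^sup>2" unfolding K_def by simp
    finally show ?thesis .
  qed
  fix e :: real assume e: "0 < e"
  show "\<exists>d>0. \<forall>y. norm (y - p) < d \<longrightarrow>
      norm (average M k l h y - average M k l h p - average M k l (dirderiv (y - p) h) p) \<le> e * norm (y - p)"
  proof (intro exI[of _ "e / (K + 1)"] conjI allI impI)
    show "0 < e / (K + 1)" using e K by simp
    fix y assume "norm (y - p) < e / (K + 1)"
    then have "norm (y - p) * (K + 1) \<le> e" using K by (simp add: pos_less_divide_eq)
    then have "K * norm (y - p) \<le> e" by (simp add: algebra_simps) (smt (verit) norm_ge_zero)
    then have "K * (norm (y - p))\<^sup>2 \<le> e * norm (y - p)"
      unfolding power2_eq_square mult.assoc[symmetric] by (intro mult_right_mono) auto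
    then show "norm (average M k l h y - average M k l h p - average M k l (dirderiv (y - p) h) p) \<le> e * norm (y - p)"
      using bound[of y] by linarith
  qed
qed

lemma dirderiv_average:
  assumes h: "test_fun U h"
  shows "dirderiv v (average M k l h) = average M k l (dirderiv v h)"
  by (rule ext, rule dirderiv_eq[OF average_has_derivative[OF h]])

lemma smooth_average:
  assumes h: "test_fun U h"
  shows "smooth_fun (average M k l h)"
proof -
  have *: "test_fun U (dirderiv_iter vs h) \<and>
      dirderiv_iter vs (average M k l h) = average M k l (dirderiv_iter vs h)" for vs
    by (induction vs) (auto simp: h dirderiv_average test_fun_dirderiv)
  show ?thesis
    unfolding smooth_fun_def differentiable_def
    using * average_has_derivative by metis
qed

end

section \<open>A parametrix for the backward heat operator\<close>

lemma integrable_gauss: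
  assumes a: "0 < (a::real)"
  shows "integrable lborel (\<lambda>z::'a::euclidean_space. exp (- a * (z \<bullet> z)))"
proof (rule integrableI_nonneg)
  have i1: "integrable lborel (\<lambda>x::real. exp (- a * x\<^sup>2))"
  proof -
    have "integrable lborel (\<lambda>x. sqrt (2 * pi * (sqrt (1 / (2 * a)))\<^sup>2) * normal_density 0 (sqrt (1 / (2 * a))) x)"
      using a by (intro integrable_mult_right integrable_normal_density) simp
    moreover have "sqrt (2 * pi * (sqrt (1 / (2 * a)))\<^sup>2) * normal_density 0 (sqrt (1 / (2 * a))) x = exp (- a * x\<^sup>2)" for x
      using a by (simp add: normal_density_def)
    ultimately show ?thesis by simp
  qed
  have eq: "exp (- a * (z \<bullet> z)) = (\<Prod>b\<in>Basis. exp (- a * (z \<bullet> b)\<^sup>2))" for z :: 'a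
    by (subst euclidean_inner) (simp add: exp_sum[symmetric] sum_distrib_left power2_eq_square sum_negf)
  have "(\<integral>\<^sup>+z. ennreal (exp (- a * (z \<bullet> z))) \<partial>(lborel::'a measure)) =
      (\<integral>\<^sup>+z. (\<Prod>b\<in>Basis. ennreal (exp (- a * (z \<bullet> b)\<^sup>2))) \<partial>(lborel::'a measure))"
    unfolding eq by (simp add: prod_ennreal)
  also have "\<dots> = (\<Prod>b\<in>(Basis::'a set). (\<integral>\<^sup>+x. ennreal (exp (- a * x\<^sup>2)) \<partial>lborel))"
    by (rule nn_integral_lborel_prod) auto
  also have "\<dots> < \<infinity>"
    using nn_integral_eq_integral[OF i1] by (simp add: ennreal_power[symmetric] power_less_top_ennreal)
  finally show "(\<integral>\<^sup>+z. ennreal (exp (- a * (z \<bullet> z))) \<partial>(lborel::'a measure)) < \<infinity>" .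
qed auto

text \<open>The normalising constant is kept as an integral; its value never matters, only that it
  is positive and makes the total mass 1.\<close>

definition gauss :: "'a::euclidean_space \<Rightarrow> real" where
  "gauss z = exp (- (1/2) * (z \<bullet> z)) / (\<integral>z. exp (- (1/2) * (z \<bullet> z)) \<partial>(lborel :: 'a measure))"

lemma gauss_integral_pos: "0 < (\<integral>z. exp (- (1/2) * (z \<bullet> z)) \<partial>(lborel :: 'a::euclidean_space measure))"
proof -
  have "\<not> (AE z in lborel :: 'a measure. exp (- (1/2) * (z \<bullet> z)) = 0)"
    by (simp add: trivial_limit_def[symmetric] ae_filter_eq_bot_iff)
  then show ?thesis
    using integral_nonneg_eq_0_iff_AE[OF integrable_gauss[of "1/2", where 'a='a]]
      integral_nonneg_AE[of "\<lambda>z::'a. exp (- (1/2) * (z \<bullet> z))" lborel]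
    by (simp add: less_le)
qed

lemma gauss_integrable: "integrable lborel gauss"
  unfolding gauss_def using integrable_gauss[of "1/2"] by (intro integrable_divide) simp

lemma gauss_integral: "(\<integral>z. gauss z \<partial>(lborel :: 'a::euclidean_space measure)) = 1"
  unfolding gauss_def using gauss_integral_pos[where 'a='a] by simp

lemma gauss_nonneg: "0 \<le> gauss z"
  unfolding gauss_def using gauss_integral_pos[where 'a='a] by (simp add: less_imp_le)

lemma gauss_continuous: "continuous_on UNIV gauss"
  unfolding gauss_def[abs_def]
  by (intro continuous_intros) (use gauss_integral_pos in \<open>simp add: less_le\<close>)

lemma gauss_measurable [measurable]: "gauss \<in> borel_measurable borel"
  by (rule borel_measurable_continuous_onI[OF gauss_continuous])

text \<open>Half of the Gaussian exponent pays for the factor |z|, through |z| \<le>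
  exp(|z|^2/4).\<close>

lemma gauss_norm_integrable: "integrable lborel (\<lambda>z::'a::euclidean_space. norm z * gauss z)"
proof -
  define Z where "Z = (\<integral>z. exp (- (1/2) * (z \<bullet> z)) \<partial>(lborel :: 'a measure))"
  have Z: "0 < Z" unfolding Z_def by (rule gauss_integral_pos)
  have "integrable lborel (\<lambda>z::'a. 2 * exp (- (1/4) * (z \<bullet> z)) / Z)"
    using integrable_gauss[of "1/4"] by (intro integrable_divide integrable_mult_right) simp
  then show ?thesis
  proof (rule Bochner_Integration.integrable_bound)
    show "AE z in lborel :: 'a measure. norm (norm z * gauss z) \<le> norm (2 * exp (- (1/4) * (z \<bullet> z)) / Z)"
    proof (rule AE_I2)
      fix z :: 'a
      have "norm z \<le> 1 + (norm z)\<^sup>2 / 4"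
        using zero_le_power2[of "norm z / 2 - 1"] by (simp add: power2_eq_square algebra_simps)
      also have "\<dots> \<le> exp ((norm z)\<^sup>2 / 4)" by (rule exp_ge_add_one_self)
      finally have *: "norm z \<le> exp ((1/4) * (z \<bullet> z))" by (simp add: power2_norm_eq_inner)
      have "norm z * exp (- (1/2) * (z \<bullet> z)) \<le> exp ((1/4) * (z \<bullet> z)) * exp (- (1/2) * (z \<bullet> z))"
        by (rule mult_right_mono[OF *]) simp
      also have "\<dots> = exp (- (1/4) * (z \<bullet> z))" by (simp add: exp_add[symmetric])
      also have "\<dots> \<le> 2 * exp (- (1/4) * (z \<bullet> z))" by simp
      finally have "norm z * exp (- (1/2) * (z \<bullet> z)) / Z \<le> 2 * exp (- (1/4) * (z \<bullet> z)) / Z"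
        using Z by (intro divide_right_mono) auto
      then show "norm (norm z * gauss z) \<le> norm (2 * exp (- (1/4) * (z \<bullet> z)) / Z)"
        using Z unfolding gauss_def Z_def[symmetric] by (simp add: abs_mult)
    qed
  qed measurable
qed

lemma gauss_inner_integrable: "b \<in> Basis \<Longrightarrow> integrable lborel (\<lambda>z::'a::euclidean_space. (z \<bullet> b) * gauss z)"
  by (rule Bochner_Integration.integrable_bound[OF gauss_norm_integrable])
    (auto simp: abs_mult Basis_le_norm gauss_nonneg intro!: AE_I2 mult_right_mono)

lemma gauss_derivative:
  "((\<lambda>s. gauss (z + s *\<^sub>R b)) has_real_derivative - ((z + s *\<^sub>R b) \<bullet> b) * gauss (z + s *\<^sub>R b)) (at s)"
proof -
  have "((\<lambda>s. (z + s *\<^sub>R b) \<bullet> (z + s *\<^sub>R b)) has_real_derivative 2 * ((z + s *\<^sub>R b) \<bullet> b)) (at s)"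
    unfolding has_field_derivative_def
    by (rule derivative_eq_intros refl)+ (auto simp: inner_commute algebra_simps)
  from DERIV_cmult[OF this, of "-(1/2)"]
  have "((\<lambda>s. - (1/2) * ((z + s *\<^sub>R b) \<bullet> (z + s *\<^sub>R b))) has_real_derivative - ((z + s *\<^sub>R b) \<bullet> b)) (at s)"
    by simp
  from DERIV_cdivide[OF DERIV_chain2[OF DERIV_exp this]]
  show ?thesis unfolding gauss_def by (simp add: mult.commute)
qed

lemma integral_translate:
  fixes F :: "'a::euclidean_space \<Rightarrow> real"
  assumes [measurable]: "F \<in> borel_measurable borel"
  shows "(\<integral>z. F (z + c) \<partial>lborel) = (\<integral>z. F z \<partial>lborel)"
proof -
  have "(\<integral>z. F z \<partial>lborel) = (\<integral>z. F z \<partial>distr lborel borel ((+) c))" by (simp only: lborel_distr_plus)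
  also have "\<dots> = (\<integral>z. F (c + z) \<partial>lborel)" by (subst integral_distr) auto
  finally show ?thesis by (simp add: add.commute)
qed

lemma integrable_translate:
  fixes F :: "'a::euclidean_space \<Rightarrow> real"
  assumes "integrable lborel F"
  shows "integrable lborel (\<lambda>z. F (z + c))"
proof -
  have [measurable]: "F \<in> borel_measurable borel" using assms by simp
  have "integrable (distr lborel borel ((+) c)) F" using assms by (simp only: lborel_distr_plus)
  then show ?thesis by (subst (asm) integrable_distr_eq) (auto simp: add.commute)
qed

lemma integrable_product_bounded:
  fixes f :: "'a::euclidean_space \<Rightarrow> real" and g :: "'b::euclidean_space \<Rightarrow> real"
  assumes f: "integrable lborel f" and g: "integrable lborel g"
    and m[measurable]: "m \<in> borel_measurable borel" and B: "\<And>p. \<bar>m p\<bar> \<le> B"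
  shows "integrable (lborel \<Otimes>\<^sub>M lborel) (\<lambda>(x, y). f x * g y * m (x, y))"
proof -
  have [measurable]: "f \<in> borel_measurable borel" "g \<in> borel_measurable borel" using f g by auto
  have "integrable (lborel \<Otimes>\<^sub>M lborel) (\<lambda>(x, y). f x * g y)"
  proof (rule lborel_pair.Fubini_integrable)
    show "(\<lambda>(x, y). f x * g y) \<in> borel_measurable (lborel \<Otimes>\<^sub>M lborel)" by measurable
    show "integrable lborel (\<lambda>x. \<integral>y. norm (case (x, y) of (x, y) \<Rightarrow> f x * g y) \<partial>lborel)"
      using f by (simp add: abs_mult)
    show "AE x in lborel. integrable lborel (\<lambda>y. case (x, y) of (x, y) \<Rightarrow> f x * g y)"
      using g by simp
  qed
  then have "integrable (lborel \<Otimes>\<^sub>M lborel) (\<lambda>p. B * (case p of (x, y) \<Rightarrow> f x * g y))" by simp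
  then show ?thesis
  proof (rule Bochner_Integration.integrable_bound)
    show "(\<lambda>(x, y). f x * g y * m (x, y)) \<in> borel_measurable (lborel \<Otimes>\<^sub>M lborel)"
    proof -
      have "m \<in> borel_measurable (lborel \<Otimes>\<^sub>M lborel)" by (simp add: lborel_prod)
      then show ?thesis by measurable
    qed
    have "\<bar>m p\<bar> \<le> \<bar>B\<bar>" for p using B[of p] by linarith
    then show "AE p in lborel \<Otimes>\<^sub>M lborel. norm (case p of (x, y) \<Rightarrow> f x * g y * m (x, y))
        \<le> norm (B * (case p of (x, y) \<Rightarrow> f x * g y))"
      by (intro AE_I2) (auto simp: abs_mult mult.commute[of "\<bar>B\<bar>"] intro!: mult_left_mono)
  qed
qed

text \<open>By translation invariance F(z + b) - F(z) has integral 0. Writing this difference as an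
  integral along the segment and exchanging the order of integration yields the integral of F'. No
  boundary terms at infinity appear in this way.\<close>

lemma integral_directional_derivative_eq_0:
  fixes F F' :: "'a::euclidean_space \<Rightarrow> real"
  assumes F: "integrable lborel F" and F': "integrable lborel F'"
    and c: "continuous_on UNIV F'"
    and D: "\<And>z s. ((\<lambda>s. F (z + s *\<^sub>R b)) has_real_derivative F' (z + s *\<^sub>R b)) (at s)"
  shows "(\<integral>z. F' z \<partial>lborel) = 0"
proof -
  have [measurable]: "F \<in> borel_measurable borel" "F' \<in> borel_measurable borel" using F F' by auto
  let ?f = "\<lambda>s z. indicator {0..1} s * F' (z + s *\<^sub>R b)"
  have FTC: "(\<integral>s. indicator {0..1} s * F' (z + s *\<^sub>R b) \<partial>lborel) = F (z + b) - F z" for z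
  proof -
    have "(\<integral>s. indicator {0..1} s *\<^sub>R F' (z + s *\<^sub>R b) \<partial>lborel) = F (z + 1 *\<^sub>R b) - F (z + 0 *\<^sub>R b)"
    proof (rule integral_FTC_atLeastAtMost)
      show "((\<lambda>s. F (z + s *\<^sub>R b)) has_vector_derivative F' (z + s *\<^sub>R b)) (at s within {0..1})" for s
        using D by (simp add: has_real_derivative_iff_has_vector_derivative[symmetric]
            has_field_derivative_at_within)
      show "continuous_on {0..1} (\<lambda>s. F' (z + s *\<^sub>R b))"
        by (intro continuous_on_compose2[OF c] continuous_intros) auto
    qed simp
    then show ?thesis by simp
  qed
  have "integrable (lborel \<Otimes>\<^sub>M lborel) (case_prod ?f)"
  proof (rule lborel_pair.Fubini_integrable)
    show "case_prod ?f \<in> borel_measurable (lborel \<Otimes>\<^sub>M lborel)" by measurable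
    have "(\<integral>z. norm (?f s z) \<partial>lborel) = indicator {0..1} s * (\<integral>z. \<bar>F' z\<bar> \<partial>lborel)" for s
      using integral_translate[of "\<lambda>z. \<bar>F' z\<bar>" "s *\<^sub>R b"] by (simp add: abs_mult)
    then show "integrable lborel (\<lambda>s. \<integral>z. norm (case (s, z) of (s, z) \<Rightarrow> ?f s z) \<partial>lborel)"
      by (simp add: integrable_mult_left)
    show "AE s in lborel. integrable lborel (\<lambda>z. case (s, z) of (s, z) \<Rightarrow> ?f s z)"
      using integrable_translate[OF F'] by simp
  qed
  from lborel_pair.Fubini_integral[OF this]
  have "(\<integral>z. F (z + b) - F z \<partial>lborel) = (\<integral>s. indicator {0..1} (s::real) * (\<integral>z. F' z \<partial>lborel) \<partial>lborel)"
    by (simp add: FTC integral_translate)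
  moreover have "(\<integral>z. F (z + b) - F z \<partial>lborel) = 0"
    using F integrable_translate[OF F] by (simp add: integral_translate)
  ultimately show ?thesis by (simp add: content_real)
qed

lemma dirderiv_chain:
  assumes h: "h differentiable (at (c s))" and c: "(c has_vector_derivative c') (at s)"
  shows "((\<lambda>s. h (c s)) has_real_derivative dirderiv c' h (c s)) (at s)"
proof -
  have D: "(h has_derivative (\<lambda>v. dirderiv v h (c s))) (at (c s))"
    by (rule differentiable_has_derivative_dirderiv[OF h])
  have "((\<lambda>s. h (c s)) has_derivative (\<lambda>r. dirderiv (r *\<^sub>R c') h (c s))) (at s)"
    using has_derivative_compose[OF c[unfolded has_vector_derivative_def] D] .
  moreover have "(\<lambda>r. dirderiv (r *\<^sub>R c') h (c s)) = (\<lambda>r. dirderiv c' h (c s) * r)"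
    using linear_scale[OF has_derivative_linear[OF D], of _ c'] by (simp add: mult.commute)
  ultimately show ?thesis unfolding has_field_derivative_def by simp
qed

lemma dirderiv_pair:
  fixes h :: "'a::euclidean_space \<times> real \<Rightarrow> real"
  assumes "h differentiable (at q)"
  shows "dirderiv (z, r) h q = (\<Sum>a\<in>Basis. (z \<bullet> a) * dirderiv (a, 0) h q) + r * dirderiv (0, 1) h q"
proof -
  have L: "linear (\<lambda>v. dirderiv v h q)"
    by (rule has_derivative_linear[OF differentiable_has_derivative_dirderiv[OF assms]])
  have e: "(z, r) = (\<Sum>a\<in>Basis. (z \<bullet> a) *\<^sub>R (a, 0)) + r *\<^sub>R (0, 1)"
    by (simp add: scaleR_Pair sum_prod euclidean_representation)
  show ?thesis
    by (subst e) (simp only: linear_add[OF L] linear_scale[OF L] linear_sum[OF L] real_scaleR_def)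
qed

text \<open>The Gaussian density has derivative -z times itself, and the chain rule contributes the
  factor r. Read from left to right the formula creates the second derivative in the heat identity;
  read from right to left it removes a derivative from h at the cost of 1/r.\<close>

lemma gauss_integration_by_parts:
  fixes h :: "'a::euclidean_space \<times> real \<Rightarrow> real"
  assumes h: "test_fun U h" and b: "b \<in> Basis"
  shows "(\<integral>z. ((z \<bullet> b) * gauss z) * h (p + (r *\<^sub>R z, \<tau>)) \<partial>lborel) =
    r * (\<integral>z. gauss z * dirderiv (b, 0) h (p + (r *\<^sub>R z, \<tau>)) \<partial>lborel)"
proof -
  have l: "(\<lambda>z. (r *\<^sub>R z, \<tau>)) \<in> borel_measurable lborel" by measurable
  let ?F = "\<lambda>z. gauss z * h (p + (r *\<^sub>R z, \<tau>))"
  let ?G = "\<lambda>z. gauss z * dirderiv (b, 0) h (p + (r *\<^sub>R z, \<tau>))"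
  let ?H = "\<lambda>z. ((z \<bullet> b) * gauss z) * h (p + (r *\<^sub>R z, \<tau>))"
  have iF: "integrable lborel ?F" by (rule average_integrable[OF gauss_integrable l h])
  have iG: "integrable lborel ?G"
    by (rule average_integrable[OF gauss_integrable l test_fun_dirderiv[OF h]])
  have iH: "integrable lborel ?H"
    by (rule average_integrable[OF gauss_inner_integrable[OF b] l h])
  have diff: "h differentiable (at x)" for x
    by (rule smooth_fun_differentiable[OF test_fun_smooth[OF h]])
  have ch: "continuous_on UNIV h" "continuous_on UNIV (dirderiv (b, 0) h)"
    by (auto intro!: smooth_fun_continuous test_fun_smooth[OF h] smooth_fun_dirderiv)
  have "(\<integral>z. r * ?G z - ?H z \<partial>lborel) = 0"
  proof (rule integral_directional_derivative_eq_0[OF iF, where b=b])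
    show "integrable lborel (\<lambda>z. r * ?G z - ?H z)" using iG iH by simp
    show "continuous_on UNIV (\<lambda>z. r * ?G z - ?H z)"
      by (intro continuous_intros gauss_continuous continuous_on_compose2[OF ch(1)]
          continuous_on_compose2[OF ch(2)]) auto
    fix z s
    have "((\<lambda>s. p + (r *\<^sub>R (z + s *\<^sub>R b), \<tau>)) has_vector_derivative (r *\<^sub>R b, 0)) (at s)"
      unfolding has_vector_derivative_def
      by (rule derivative_eq_intros refl)+ (auto simp: scaleR_Pair algebra_simps)
    from dirderiv_chain[OF diff this]
    have "((\<lambda>s. h (p + (r *\<^sub>R (z + s *\<^sub>R b), \<tau>))) has_real_derivative
        r * dirderiv (b, 0) h (p + (r *\<^sub>R (z + s *\<^sub>R b), \<tau>))) (at s)"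
      using linear_scale[OF has_derivative_linear[OF differentiable_has_derivative_dirderiv[OF
            diff[of "p + (r *\<^sub>R (z + s *\<^sub>R b), \<tau>)"]]], of r "(b, 0)"]
      by (simp add: scaleR_Pair)
    from DERIV_mult[OF gauss_derivative this]
    show "((\<lambda>s. gauss (z + s *\<^sub>R b) * h (p + (r *\<^sub>R (z + s *\<^sub>R b), \<tau>))) has_real_derivative
       (r * ?G (z + s *\<^sub>R b) - ?H (z + s *\<^sub>R b))) (at s)"
      by (simp add: algebra_simps)
  qed
  then show ?thesis using iG iH by simp
qed

text \<open>With \<tau> = r^2/2 the measure r dr becomes d\<tau>, and r z for Gaussian z is
  distributed as the heat kernel at time \<tau>. Averaging with this weight along
  \<open>heat_shift\<close> is therefore the Duhamel integral of the backward heat equation over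
  times from 0 to \<rho>^2/2, parametrised by r to stay smooth at \<tau> = 0.\<close>

definition heat_weight :: "real \<Rightarrow> 'a::euclidean_space \<times> real \<Rightarrow> real" where
  "heat_weight \<rho> = (\<lambda>(z, r). gauss z * (r * indicator {0..\<rho>} r))"

definition heat_shift :: "'a::euclidean_space \<times> real \<Rightarrow> 'a \<times> real" where
  "heat_shift = (\<lambda>(z, r). (r *\<^sub>R z, r\<^sup>2 / 2))"

lemma heat_shift_continuous: "continuous_on UNIV (\<lambda>p::'a::euclidean_space \<times> real. (snd p *\<^sub>R fst p, (snd p)\<^sup>2 / 2))"
  by (intro continuous_intros) auto

lemma heat_shift_measurable [measurable]: "heat_shift \<in> borel_measurable borel"
  using borel_measurable_continuous_onI[OF heat_shift_continuous]
  by (simp add: heat_shift_def split_beta')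

lemma integrable_cutoff_real:
  "integrable lborel (\<lambda>r::real. indicator {0..\<rho>} r :: real)"
  "integrable lborel (\<lambda>r::real. r * indicator {0..\<rho>} r)"
proof -
  show i: "integrable lborel (\<lambda>r::real. indicator {0..\<rho>} r :: real)"
    by (rule integrable_real_indicator) (auto simp: emeasure_lborel_Icc_eq)
  show "integrable lborel (\<lambda>r::real. r * indicator {0..\<rho>} r)"
    by (rule Bochner_Integration.integrable_bound[OF integrable_mult_right[OF i, of \<rho>]])
      (auto simp: indicator_def intro!: AE_I2)
qed

lemma heat_weight_integrable: "integrable lborel (heat_weight \<rho>)"
  using integrable_product_bounded[OF gauss_integrable integrable_cutoff_real(2), of "\<lambda>_. 1" 1 \<rho>]
  by (simp add: heat_weight_def lborel_prod)

lemma test_fun_heat_shift_measurable: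
  assumes "test_fun U h"
  shows "(\<lambda>\<omega>. h (p + heat_shift \<omega>)) \<in> borel_measurable borel"
  using test_fun_measurable[OF assms] by measurable

text \<open>The iterated form has the space integral inside, so that Gaussian integration by parts
  can act for each fixed r.\<close>

lemma heat_average_eq:
  fixes h :: "'a::euclidean_space \<times> real \<Rightarrow> real"
  assumes h: "test_fun U h"
  shows "average lborel (heat_weight \<rho>) heat_shift h p =
    (\<integral>r. (r * indicator {0..\<rho>} r) * (\<integral>z. gauss z * h (p + (r *\<^sub>R z, r\<^sup>2 / 2)) \<partial>lborel) \<partial>lborel)"
proof -
  obtain B where B: "\<And>x. \<bar>h x\<bar> \<le> B" by (rule test_fun_bounded[OF h]) blast
  have i: "integrable (lborel \<Otimes>\<^sub>M lborel)
      (\<lambda>(z, r). gauss z * (r * indicator {0..\<rho>} r) * h (p + heat_shift (z, r)))"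
    by (rule integrable_product_bounded[OF gauss_integrable integrable_cutoff_real(2)
          test_fun_heat_shift_measurable[OF h] B])
  have "average lborel (heat_weight \<rho>) heat_shift h p = integral\<^sup>L (lborel \<Otimes>\<^sub>M lborel)
      (\<lambda>(z, r). gauss z * (r * indicator {0..\<rho>} r) * h (p + heat_shift (z, r)))"
    unfolding average_def heat_weight_def lborel_prod by (simp add: split_beta')
  also have "\<dots> = (\<integral>r. (\<integral>z. gauss z * (r * indicator {0..\<rho>} r) * h (p + heat_shift (z, r)) \<partial>lborel) \<partial>lborel)"
    by (rule lborel_pair.integral_snd[OF i, symmetric])
  also have "\<dots> = (\<integral>r. (r * indicator {0..\<rho>} r) * (\<integral>z. gauss z * h (p + (r *\<^sub>R z, r\<^sup>2 / 2)) \<partial>lborel) \<partial>lborel)"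
  proof (rule Bochner_Integration.integral_cong[OF refl])
    fix r :: real
    have "(\<integral>z. gauss z * (r * indicator {0..\<rho>} r) * h (p + heat_shift (z, r)) \<partial>lborel) =
      (\<integral>z. (r * indicator {0..\<rho>} r) * (gauss z * h (p + (r *\<^sub>R z, r\<^sup>2 / 2))) \<partial>lborel)"
      by (rule Bochner_Integration.integral_cong[OF refl]) (simp only: heat_shift_def split mult_ac)
    then show "(\<integral>z. gauss z * (r * indicator {0..\<rho>} r) * h (p + heat_shift (z, r)) \<partial>lborel) =
      (r * indicator {0..\<rho>} r) * (\<integral>z. gauss z * h (p + (r *\<^sub>R z, r\<^sup>2 / 2)) \<partial>lborel)"
      by (simp only: integral_mult_right_zero)
  qed
  finally show ?thesis .
qed

text \<open>Along the curve p + (r z, r^2/2) the derivative of h in r is r times its time derivative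
  plus z times its spatial gradient. Averaged over z, the gradient part becomes r times the
  Laplacian by integration by parts, so the left side is the average of the total change of h along
  these curves, which the fundamental theorem of calculus evaluates at r = 0 and r = \<rho>.\<close>

lemma heat_average_identity:
  fixes h :: "'a::euclidean_space \<times> real \<Rightarrow> real"
  assumes h: "test_fun U h" and \<rho>: "0 \<le> \<rho>"
  defines "A \<equiv> average lborel (heat_weight \<rho>) heat_shift"
  shows "A (dirderiv (0, 1) h) p + (\<Sum>a\<in>Basis. A (dirderiv (a, 0) (dirderiv (a, 0) h)) p) =
    average lborel gauss (\<lambda>z. (\<rho> *\<^sub>R z, \<rho>\<^sup>2 / 2)) h p - h p"
proof -
  let ?I = "\<lambda>r. indicator {0..\<rho>} r :: real"
  let ?q = "\<lambda>z r. p + heat_shift (z, r)"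
  have diff: "h differentiable (at x)" for x
    by (rule smooth_fun_differentiable[OF test_fun_smooth[OF h]])
  have td: "test_fun U (dirderiv v h)" for v by (rule test_fun_dirderiv[OF h])
  have i: "integrable (lborel \<Otimes>\<^sub>M lborel) (\<lambda>(z, r). f z * g r * dirderiv v h (?q z r))"
    if "integrable lborel f" "integrable lborel g" for f :: "'a \<Rightarrow> real" and g :: "real \<Rightarrow> real" and v
  proof -
    obtain B where B: "\<And>x. \<bar>dirderiv v h x\<bar> \<le> B" by (rule test_fun_bounded[OF td]) blast
    show ?thesis
      by (rule integrable_product_bounded[OF that test_fun_heat_shift_measurable[OF td] B])
  qed
  have i0: "integrable (lborel \<Otimes>\<^sub>M lborel) (\<lambda>(z, r). gauss z * (r * ?I r) * dirderiv (0, 1) h (?q z r))"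
    by (rule i[OF gauss_integrable integrable_cutoff_real(2)])
  have ia: "integrable (lborel \<Otimes>\<^sub>M lborel) (\<lambda>(z, r). ((z \<bullet> a) * gauss z) * ?I r * dirderiv (a, 0) h (?q z r))"
    if "a \<in> Basis" for a
    by (rule i[OF gauss_inner_integrable[OF that] integrable_cutoff_real(1)])
  let ?f = "\<lambda>z r. gauss z * (?I r * dirderiv (z, r) h (?q z r))"
  have f_eq: "?f z r = gauss z * (r * ?I r) * dirderiv (0, 1) h (?q z r) +
      (\<Sum>a\<in>Basis. ((z \<bullet> a) * gauss z) * ?I r * dirderiv (a, 0) h (?q z r))" for z r
    by (subst dirderiv_pair[OF diff]) (simp add: algebra_simps sum_distrib_left)
  have int_f: "integrable (lborel \<Otimes>\<^sub>M lborel) (case_prod ?f)"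
    unfolding f_eq split_beta'
    by (intro Bochner_Integration.integrable_add Bochner_Integration.integrable_sum)
      (use i0 ia in \<open>auto simp: split_beta'\<close>)
  have FTC: "(\<integral>r. ?I r * dirderiv (z, r) h (?q z r) \<partial>lborel) = h (p + (\<rho> *\<^sub>R z, \<rho>\<^sup>2 / 2)) - h p" for z
  proof -
    have "(\<integral>r. ?I r *\<^sub>R dirderiv (z, r) h (p + (r *\<^sub>R z, r\<^sup>2 / 2)) \<partial>lborel) =
       h (p + (\<rho> *\<^sub>R z, \<rho>\<^sup>2 / 2)) - h (p + (0 *\<^sub>R z, 0\<^sup>2 / 2))"
    proof (rule integral_FTC_atLeastAtMost[OF \<rho>])
      fix r :: real
      have "((\<lambda>r. p + (r *\<^sub>R z, r\<^sup>2 / 2)) has_vector_derivative (z, r)) (at r)"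
        unfolding has_vector_derivative_def
        by (rule derivative_eq_intros refl)+ (auto simp: scaleR_Pair)
      from dirderiv_chain[OF diff this]
      show "((\<lambda>r. h (p + (r *\<^sub>R z, r\<^sup>2 / 2))) has_vector_derivative
          dirderiv (z, r) h (p + (r *\<^sub>R z, r\<^sup>2 / 2))) (at r within {0..\<rho>})"
        by (simp add: has_real_derivative_iff_has_vector_derivative[symmetric] has_field_derivative_at_within)
    next
      have cd: "continuous_on UNIV (dirderiv v h)" for v
        by (rule smooth_fun_continuous[OF test_fun_smooth[OF td]])
      show "continuous_on {0..\<rho>} (\<lambda>r. dirderiv (z, r) h (p + (r *\<^sub>R z, r\<^sup>2 / 2)))"
        by (subst dirderiv_pair[OF diff]) (intro continuous_intros continuous_on_compose2[OF cd]; auto)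
    qed
    then show ?thesis by (simp add: heat_shift_def zero_prod_def[symmetric])
  qed
  have lV: "(\<lambda>z::'a. (\<rho> *\<^sub>R z, \<rho>\<^sup>2 / 2)) \<in> borel_measurable lborel" by measurable
  have "average lborel gauss (\<lambda>z. (\<rho> *\<^sub>R z, \<rho>\<^sup>2 / 2)) h p - h p =
      (\<integral>z. gauss z * (h (p + (\<rho> *\<^sub>R z, \<rho>\<^sup>2 / 2)) - h p) \<partial>lborel)"
    using average_integrable[OF gauss_integrable lV h, of p] gauss_integrable[where 'a='a] gauss_integral[where 'a='a]
    by (simp add: average_def right_diff_distrib)
  also have "\<dots> = (\<integral>z. (\<integral>r. ?f z r \<partial>lborel) \<partial>lborel)"
    by (simp add: FTC)
  also have "\<dots> = (\<integral>(z, r). ?f z r \<partial>(lborel \<Otimes>\<^sub>M lborel))"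
    by (rule lborel_pair.integral_fst[OF int_f])
  also have "\<dots> = (\<integral>(z, r). gauss z * (r * ?I r) * dirderiv (0, 1) h (?q z r) \<partial>(lborel \<Otimes>\<^sub>M lborel)) +
      (\<Sum>a\<in>Basis. (\<integral>(z, r). ((z \<bullet> a) * gauss z) * ?I r * dirderiv (a, 0) h (?q z r) \<partial>(lborel \<Otimes>\<^sub>M lborel)))"
    unfolding f_eq split_beta'
    by (subst Bochner_Integration.integral_add, (use i0 ia in \<open>auto simp: split_beta'\<close>)[2],
        subst Bochner_Integration.integral_sum) (use ia in \<open>auto simp: split_beta'\<close>)
  also have "(\<integral>(z, r). gauss z * (r * ?I r) * dirderiv (0, 1) h (?q z r) \<partial>(lborel \<Otimes>\<^sub>M lborel)) =
      A (dirderiv (0, 1) h) p"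
    unfolding A_def average_def heat_weight_def lborel_prod by (simp add: split_beta')
  also have "(\<Sum>a\<in>Basis. (\<integral>(z, r). ((z \<bullet> a) * gauss z) * ?I r * dirderiv (a, 0) h (?q z r) \<partial>(lborel \<Otimes>\<^sub>M lborel))) =
     (\<Sum>a\<in>Basis. A (dirderiv (a, 0) (dirderiv (a, 0) h)) p)"
  proof (rule sum.cong[OF refl])
    fix a :: 'a assume a: "a \<in> Basis"
    have "(\<integral>(z, r). ((z \<bullet> a) * gauss z) * ?I r * dirderiv (a, 0) h (?q z r) \<partial>(lborel \<Otimes>\<^sub>M lborel)) =
       (\<integral>r. (\<integral>z. ((z \<bullet> a) * gauss z) * ?I r * dirderiv (a, 0) h (?q z r) \<partial>lborel) \<partial>lborel)"
      by (rule lborel_pair.integral_snd[OF ia[OF a], symmetric])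
    also have "\<dots> = (\<integral>r. ?I r * (\<integral>z. ((z \<bullet> a) * gauss z) * dirderiv (a, 0) h (p + (r *\<^sub>R z, r\<^sup>2 / 2)) \<partial>lborel) \<partial>lborel)"
    proof (rule Bochner_Integration.integral_cong[OF refl])
      fix r :: real
      have "(\<integral>z. ((z \<bullet> a) * gauss z) * ?I r * dirderiv (a, 0) h (?q z r) \<partial>lborel) =
        (\<integral>z. ?I r * (((z \<bullet> a) * gauss z) * dirderiv (a, 0) h (p + (r *\<^sub>R z, r\<^sup>2 / 2))) \<partial>lborel)"
        by (rule Bochner_Integration.integral_cong[OF refl]) (simp only: heat_shift_def split mult_ac)
      then show "(\<integral>z. ((z \<bullet> a) * gauss z) * ?I r * dirderiv (a, 0) h (?q z r) \<partial>lborel) =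
        ?I r * (\<integral>z. ((z \<bullet> a) * gauss z) * dirderiv (a, 0) h (p + (r *\<^sub>R z, r\<^sup>2 / 2)) \<partial>lborel)"
        by (simp only: integral_mult_right_zero)
    qed
    also have "\<dots> = A (dirderiv (a, 0) (dirderiv (a, 0) h)) p"
      unfolding A_def heat_average_eq[OF test_fun_dirderiv[OF td]] gauss_integration_by_parts[OF td a]
      by (simp add: mult_ac)
    finally show "(\<integral>(z, r). ((z \<bullet> a) * gauss z) * ?I r * dirderiv (a, 0) h (?q z r) \<partial>(lborel \<Otimes>\<^sub>M lborel)) =
       A (dirderiv (a, 0) (dirderiv (a, 0) h)) p" .
  qed
  finally show ?thesis by simp
qed

text \<open>W is the Duhamel integral of \<open>dxi b\<close> \<theta> and V the Gaussian mean of
  the same function at scale \<rho>. Moving the derivative from \<theta> onto the Gaussian costs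
  1/r, so V is of size 1/\<rho>, and W, integrated against r dr up to \<rho>, is of size \<rho>.
  Only the supremum of \<theta> enters these bounds, as a duality argument for the L^1 norm
  requires.\<close>

lemma heat_parametrix:
  "\<exists>c>0. \<forall>b\<in>(Basis::'a::euclidean_space set). \<forall>\<theta> \<rho>. test_fun UNIV \<theta> \<longrightarrow> (\<forall>p. \<bar>\<theta> p\<bar> \<le> 1) \<longrightarrow> 0 < \<rho> \<longrightarrow>
    (\<exists>W V. smooth_fun W \<and> smooth_fun V \<and> (\<forall>p. \<bar>W p\<bar> \<le> c * \<rho>) \<and> (\<forall>p. \<bar>V p\<bar> \<le> c / \<rho>) \<and>
      (\<forall>p. dt W p + lapx W p = V p - dxi b \<theta> p))"
proof -
  define c where "c = (\<integral>z. norm z * gauss z \<partial>(lborel::'a measure)) + 1"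
  have c: "0 < c" unfolding c_def by (intro add_nonneg_pos integral_nonneg) (auto simp: gauss_nonneg)
  have "\<exists>W V. smooth_fun W \<and> smooth_fun V \<and> (\<forall>p. \<bar>W p\<bar> \<le> c * \<rho>) \<and> (\<forall>p. \<bar>V p\<bar> \<le> c / \<rho>) \<and>
      (\<forall>p. dt W p + lapx W p = V p - dxi b \<theta> p)"
    if b: "b \<in> Basis" and \<theta>: "test_fun UNIV \<theta>" and \<theta>1: "\<And>p. \<bar>\<theta> p\<bar> \<le> 1" and \<rho>: "0 < \<rho>"
    for b :: 'a and \<theta> :: "'a \<times> real \<Rightarrow> real" and \<rho>
  proof -
    define h where "h = dirderiv (b, 0) \<theta>"
    have h: "test_fun UNIV h" unfolding h_def by (rule test_fun_dirderiv[OF \<theta>])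
    \<comment> \<open>Both bounds rest on this estimate: r times the mean of a derivative of
      \<theta> equals the mean of \<theta> against the b-component of z, which is at most the first
      absolute moment.\<close>
    have J: "\<bar>r * (\<integral>z. gauss z * h (p + (r *\<^sub>R z, \<tau>)) \<partial>lborel)\<bar> \<le> c" for r p \<tau>
    proof -
      have "\<bar>\<integral>z. ((z \<bullet> b) * gauss z) * \<theta> (p + (r *\<^sub>R z, \<tau>)) \<partial>lborel\<bar> \<le>
          (\<integral>z. \<bar>((z \<bullet> b) * gauss z) * \<theta> (p + (r *\<^sub>R z, \<tau>))\<bar> \<partial>lborel)"
        by (rule integral_abs_bound)
      also have "\<dots> \<le> (\<integral>z. norm z * gauss z \<partial>(lborel::'a measure))"
      proof (rule integral_mono'[OF gauss_norm_integrable])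
        fix z :: 'a
        have "\<bar>z \<bullet> b\<bar> * gauss z * \<bar>\<theta> (p + (r *\<^sub>R z, \<tau>))\<bar> \<le> (norm z * gauss z) * 1"
          by (intro mult_mono \<theta>1 mult_right_mono Basis_le_norm b gauss_nonneg mult_nonneg_nonneg) auto
        then show "\<bar>(z \<bullet> b) * gauss z * \<theta> (p + (r *\<^sub>R z, \<tau>))\<bar> \<le> norm z * gauss z"
          by (simp add: abs_mult gauss_nonneg)
      qed (simp add: gauss_nonneg)
      finally show ?thesis
        unfolding gauss_integration_by_parts[OF \<theta> b] h_def c_def by simp
    qed
    have lm: "(\<lambda>z::'a. (\<rho> *\<^sub>R z, \<rho>\<^sup>2 / 2)) \<in> borel_measurable lborel" by measurable
    have hm: "heat_shift \<in> borel_measurable lborel" by simp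
    let ?V = "average lborel gauss (\<lambda>z. (\<rho> *\<^sub>R z, \<rho>\<^sup>2 / 2)) h"
    let ?W = "average lborel (heat_weight \<rho>) heat_shift h"
    have D: "dirderiv v (average lborel (heat_weight \<rho>) heat_shift k) =
        average lborel (heat_weight \<rho>) heat_shift (dirderiv v k)" if "test_fun UNIV k"
      for k :: "'a \<times> real \<Rightarrow> real" and v
      by (rule dirderiv_average[OF heat_weight_integrable hm that])
    show ?thesis
    proof (rule exI[of _ ?W], rule exI[of _ ?V], intro conjI allI)
      show "smooth_fun ?W" by (rule smooth_average[OF heat_weight_integrable hm h])
      show "smooth_fun ?V" by (rule smooth_average[OF gauss_integrable lm h])
      fix p
      show "\<bar>?V p\<bar> \<le> c / \<rho>"
        using J[of \<rho> p "\<rho>\<^sup>2 / 2"] \<rho> unfolding average_def by (simp add: abs_mult field_simps)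
      show "\<bar>?W p\<bar> \<le> c * \<rho>"
      proof -
        have "\<bar>?W p\<bar> \<le> (\<integral>r. \<bar>(r * indicator {0..\<rho>} r) * (\<integral>z. gauss z * h (p + (r *\<^sub>R z, r\<^sup>2 / 2)) \<partial>lborel)\<bar> \<partial>lborel)"
          unfolding heat_average_eq[OF h] by (rule integral_abs_bound)
        also have "\<dots> \<le> (\<integral>r. c * indicator {0..\<rho>} r \<partial>lborel)"
        proof (rule integral_mono')
          show "integrable lborel (\<lambda>r::real. c * indicator {0..\<rho>} r)"
            using integrable_cutoff_real(1) by simp
          show "\<bar>(r * indicator {0..\<rho>} r) * (\<integral>z. gauss z * h (p + (r *\<^sub>R z, r\<^sup>2 / 2)) \<partial>lborel)\<bar> \<le> c * indicator {0..\<rho>} r" for r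
            using J[of r p "r\<^sup>2 / 2"] c by (auto simp: indicator_def)
          show "0 \<le> c * indicator {0..\<rho>} r" for r using c by simp
        qed
        also have "\<dots> = c * \<rho>" using \<rho> by (simp add: content_real)
        finally show ?thesis .
      qed
      have "dt ?W p + lapx ?W p = average lborel (heat_weight \<rho>) heat_shift (dirderiv (0, 1) h) p +
          (\<Sum>a\<in>Basis. average lborel (heat_weight \<rho>) heat_shift (dirderiv (a, 0) (dirderiv (a, 0) h)) p)"
        unfolding dt_def lapx_def dxi_def D[OF h] D[OF test_fun_dirderiv[OF h]] ..
      then show "dt ?W p + lapx ?W p = ?V p - dxi b \<theta> p"
        using heat_average_identity[OF h, of \<rho> p] \<rho> unfolding dxi_def h_def[symmetric] by simp
    qed
  qed
  then show ?thesis using c by blast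
qed

section \<open>The Riesz representation theorem for open subsets of Euclidean space\<close>

lemma Cc_fun_dominated:
  assumes f: "Cc_fun U f" and g: "continuous_on UNIV g" and z: "\<And>x. f x = 0 \<Longrightarrow> g x = 0"
  shows "Cc_fun U g"
proof -
  have "tsupport g \<subseteq> tsupport f"
  proof (rule tsupport_minimal[OF closed_tsupport])
    show "x \<in> tsupport f" if "g x \<noteq> 0" for x
      using that z[of x] in_tsupport[of f x] by argo
  qed
  then show ?thesis
    using f g compact_Int_closed[of "tsupport f" "tsupport g"] closed_tsupport[of g]
    by (auto simp: Cc_fun_def Int_absorb1)
qed

lemma Cc_fun_continuous: "Cc_fun U f \<Longrightarrow> continuous_on S f"
  unfolding Cc_fun_def using continuous_on_subset[of UNIV f S] by auto

lemma Cc_fun_add: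
  assumes f: "Cc_fun U f" and g: "Cc_fun U g"
  shows "Cc_fun U (\<lambda>x. f x + g x)"
proof -
  let ?S = "tsupport f \<union> tsupport g"
  have S: "compact ?S" "?S \<subseteq> U" using f g by (auto simp: Cc_fun_def)
  have "tsupport (\<lambda>x. f x + g x) \<subseteq> ?S"
  proof (rule tsupport_minimal)
    show "x \<in> ?S" if "f x + g x \<noteq> 0" for x
      using that in_tsupport[of f x] in_tsupport[of g x] by (cases "f x = 0") auto
  qed (simp add: closed_tsupport closed_Un)
  moreover have "continuous_on UNIV (\<lambda>x. f x + g x)"
    by (intro continuous_intros Cc_fun_continuous[OF f] Cc_fun_continuous[OF g])
  ultimately show ?thesis
    using S compact_Int_closed[of ?S "tsupport (\<lambda>x. f x + g x)"] closed_tsupport[of "\<lambda>x. f x + g x"]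
    by (auto simp: Cc_fun_def Int_absorb1)
qed

lemma Cc_fun_cmult: "Cc_fun U f \<Longrightarrow> Cc_fun U (\<lambda>x. c * f x)"
  by (rule Cc_fun_dominated[of U f]) (auto intro!: continuous_on_mult_left Cc_fun_continuous[of U f])

lemma Cc_fun_zero: "Cc_fun U (\<lambda>x. 0)"
  by (simp add: Cc_fun_def tsupport_def)

lemma Cc_fun_sum: "(\<And>i. i \<in> I \<Longrightarrow> Cc_fun U (f i)) \<Longrightarrow> Cc_fun U (\<lambda>x. \<Sum>i\<in>I. f i x)"
  by (induction I rule: infinite_finite_induct) (auto simp: Cc_fun_zero Cc_fun_add)

text \<open>A function positive on K is divided by half its minimum there. The strict bound makes
  the set where f exceeds 1 an open neighbourhood of K, and in this form it is used later.\<close>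

lemma Cc_fun_ge_1_on_compact:
  assumes "compact K" "open U" "K \<subseteq> U"
  obtains f where "test_fun U f" "\<And>x. 0 \<le> f x" "\<And>x. x \<in> K \<Longrightarrow> 1 < f x"
proof -
  obtain g where g: "test_fun U g" "\<And>x. 0 \<le> g x" "\<And>x. x \<in> K \<Longrightarrow> 0 < g x"
    by (rule test_fun_pos_on_compact[OF assms]) blast
  show ?thesis
  proof (cases "K = {}")
    case True
    then show ?thesis using g that by blast
  next
    case False
    have "continuous_on K g" by (rule Cc_fun_continuous[OF test_fun_Cc[OF g(1)]])
    then obtain x0 where x0: "x0 \<in> K" "\<And>x. x \<in> K \<Longrightarrow> g x0 \<le> g x"
      using continuous_attains_inf[OF assms(1) False] by blast
    have p: "0 < g x0" using g(3) x0(1) by blast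
    show ?thesis
    proof (rule that[of "\<lambda>x. 2 / g x0 * g x"])
      show "test_fun U (\<lambda>x. 2 / g x0 * g x)" by (rule test_fun_cmult[OF g(1)])
      show "0 \<le> 2 / g x0 * g x" for x using g(2)[of x] p by simp
      show "1 < 2 / g x0 * g x" if "x \<in> K" for x using x0(2)[OF that] p by (simp add: field_simps)
    qed
  qed
qed

text \<open>The distance to the complement of U. The whole space is treated separately because
  \<open>infdist\<close> to the empty set is 0 by convention.\<close>

lemma open_positivity_function:
  fixes U :: "'a::euclidean_space set"
  assumes "open U"
  obtains e where "continuous_on UNIV e" "\<And>x. (0::real) \<le> e x" "\<And>x. 0 < e x \<longleftrightarrow> x \<in> U"
proof (cases "U = UNIV")
  case True
  show ?thesis by (rule that[of "\<lambda>_. 1"]) (auto simp: True)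
next
  case False
  then have ne: "- U \<noteq> {}" by auto
  have "closed (- U)" using assms by auto
  then have "infdist x (- U) = 0 \<longleftrightarrow> x \<notin> U" for x
    using in_closed_iff_infdist_zero[OF _ ne, of x] by auto
  then show ?thesis
    by (intro that[of "\<lambda>x. infdist x (- U)"]) (auto intro!: continuous_intros simp: infdist_nonneg less_le)
qed

section \<open>Positive functionals and the outer measure they induce\<close>

locale positive_functional =
  fixes U :: "'a::euclidean_space set" and \<Lambda> :: "('a \<Rightarrow> real) \<Rightarrow> real"
  assumes open_U: "open U"
    and add: "Cc_fun U f \<Longrightarrow> Cc_fun U g \<Longrightarrow> \<Lambda> (\<lambda>x. f x + g x) = \<Lambda> f + \<Lambda> g"
    and scale: "Cc_fun U f \<Longrightarrow> \<Lambda> (\<lambda>x. c * f x) = c * \<Lambda> f"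
    and nonneg: "Cc_fun U f \<Longrightarrow> (\<And>x. 0 \<le> f x) \<Longrightarrow> 0 \<le> \<Lambda> f"
begin

lemma zero: "\<Lambda> (\<lambda>x. 0) = 0"
  using scale[OF Cc_fun_zero, of 0] by simp

lemma sum: "(\<And>i. i \<in> I \<Longrightarrow> Cc_fun U (f i)) \<Longrightarrow> \<Lambda> (\<lambda>x. \<Sum>i\<in>I. f i x) = (\<Sum>i\<in>I. \<Lambda> (f i))"
  by (induction I rule: infinite_finite_induct) (auto simp: zero add Cc_fun_sum)

lemma mono:
  assumes f: "Cc_fun U f" and g: "Cc_fun U g" and le: "\<And>x. f x \<le> g x"
  shows "\<Lambda> f \<le> \<Lambda> g"
proof -
  have "0 \<le> \<Lambda> (\<lambda>x. g x + (-1) * f x)"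
    by (rule nonneg[OF Cc_fun_add[OF g Cc_fun_cmult[OF f]]]) (use le in simp)
  then show ?thesis unfolding add[OF g Cc_fun_cmult[OF f]] scale[OF f] by simp
qed

text \<open>Admissible functions are only dominated by the indicator of V; their supports may touch
  the boundary of V. This keeps the condition pointwise, and \<open>lower\<close> supplies the
  missing compactness. V itself may reach outside U, since \<open>Cc_fun\<close> confines the
  supports.\<close>

definition below :: "'a set \<Rightarrow> ('a \<Rightarrow> real) set" where
  "below V = {f. Cc_fun U f \<and> (\<forall>x. 0 \<le> f x \<and> f x \<le> indicator V x)}"

definition inner_mass :: "'a set \<Rightarrow> ennreal" where
  "inner_mass V = (SUP f\<in>below V. ennreal (\<Lambda> f))"

definition outer :: "'a set \<Rightarrow> ennreal" where
  "outer A = (INF V\<in>{V. open V \<and> A \<subseteq> V}. inner_mass V)"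

lemma below_mono: "V \<subseteq> W \<Longrightarrow> below V \<subseteq> below W"
  unfolding below_def by (auto simp: indicator_def split: if_splits) (metis in_mono order.trans zero_le_one)

lemma inner_mass_mono: "V \<subseteq> W \<Longrightarrow> inner_mass V \<le> inner_mass W"
  unfolding inner_mass_def by (rule SUP_subset_mono[OF below_mono]) auto

lemma inner_mass_upper: "f \<in> below V \<Longrightarrow> ennreal (\<Lambda> f) \<le> inner_mass V"
  unfolding inner_mass_def by (rule SUP_upper)

lemma outer_open: "open V \<Longrightarrow> outer V = inner_mass V"
  unfolding outer_def by (intro antisym INF_lower INF_greatest) (auto intro: inner_mass_mono)

lemma outer_mono: "A \<subseteq> B \<Longrightarrow> outer A \<le> outer B"
  unfolding outer_def by (rule INF_superset_mono) auto

lemma below_D: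
  assumes "f \<in> below V"
  shows "Cc_fun U f" "0 \<le> f x" "f x \<le> 1" "x \<notin> V \<Longrightarrow> f x = 0"
proof -
  have f: "Cc_fun U f" "0 \<le> f x" "f x \<le> indicator V x" using assms by (auto simp: below_def)
  show "Cc_fun U f" "0 \<le> f x" by fact+
  show "f x \<le> 1" using f(3) by (cases "x \<in> V") auto
  show "f x = 0" if "x \<notin> V" using f(2,3) that by (simp add: indicator_def)
qed

text \<open>Lowering a function moves its support into the interior of the positivity set, at a small cost.\<close>

lemma lower:
  assumes f: "f \<in> below V" and e: "0 < e"
  obtains d where "0 < d" "(\<lambda>x. max 0 (f x - d)) \<in> below V"
    "\<Lambda> f \<le> \<Lambda> (\<lambda>x. max 0 (f x - d)) + e"
proof -
  have fC: "Cc_fun U f" by (rule below_D[OF f])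
  obtain g where g: "test_fun U g" "\<And>x. 0 \<le> g x" "\<And>x. x \<in> tsupport f \<Longrightarrow> 1 < g x"
    by (rule Cc_fun_ge_1_on_compact[of "tsupport f" U]) (use fC open_U in \<open>auto simp: Cc_fun_def\<close>)
  have gC: "Cc_fun U g" by (rule test_fun_Cc[OF g(1)])
  define d where "d = e / (\<Lambda> g + 1)"
  have Lg: "0 \<le> \<Lambda> g" by (rule nonneg[OF gC g(2)])
  have d: "0 < d" using e Lg by (simp add: d_def)
  have c: "continuous_on UNIV (\<lambda>x. max 0 (f x - d))"
    by (intro continuous_intros Cc_fun_continuous[OF fC])
  have fd: "Cc_fun U (\<lambda>x. max 0 (f x - d))"
    by (rule Cc_fun_dominated[OF fC c]) (use d in auto)
  show ?thesis
  proof (rule that[OF d])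
    show "(\<lambda>x. max 0 (f x - d)) \<in> below V"
      unfolding below_def
    proof (intro CollectI conjI allI fd)
      fix x show "max 0 (f x - d) \<le> indicator V x"
        using below_D(3)[OF f, of x] below_D(4)[OF f, of x] d by (auto simp: indicator_def)
    qed simp
    have "\<Lambda> f \<le> \<Lambda> (\<lambda>x. max 0 (f x - d) + d * g x)"
    proof (rule mono[OF fC Cc_fun_add[OF fd Cc_fun_cmult[OF gC]]])
      fix x
      show "f x \<le> max 0 (f x - d) + d * g x"
      proof (cases "f x = 0")
        case True then show ?thesis using d g(2)[of x] by simp
      next
        case False
        then have "d * 1 \<le> d * g x" using g(3)[OF in_tsupport[of f x]] d by (intro mult_left_mono) auto
        then show ?thesis by simp
      qed
    qed
    also have "\<dots> = \<Lambda> (\<lambda>x. max 0 (f x - d)) + d * \<Lambda> g"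
      by (simp add: add[OF fd Cc_fun_cmult[OF gC]] scale[OF gC])
    also have "d * \<Lambda> g \<le> e" using e Lg by (simp add: d_def divide_le_eq mult_left_mono)
    finally show "\<Lambda> f \<le> \<Lambda> (\<lambda>x. max 0 (f x - d)) + e" by simp
  qed
qed

lemma compact_superlevel:
  assumes f: "Cc_fun U f" and d: "0 < d"
  shows "compact {x. d \<le> f x}"
proof -
  have "closed {x. d \<le> f x}" by (intro closed_Collect_le continuous_intros Cc_fun_continuous[OF f])
  moreover have "{x. d \<le> f x} \<subseteq> tsupport f"
  proof
    fix x assume "x \<in> {x. d \<le> f x}"
    then show "x \<in> tsupport f" using d in_tsupport[of f x] by force
  qed
  ultimately show ?thesis
    using f compact_Int_closed[of "tsupport f" "{x. d \<le> f x}"] by (auto simp: Cc_fun_def Int_absorb1)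
qed

text \<open>After lowering, the function vanishes off a compact subset of the union, which finitely
  many V i cover. A partition of unity built from continuous functions positive exactly on the V i
  splits it into admissible pieces.\<close>

lemma inner_mass_countable_subadditive:
  fixes V :: "nat \<Rightarrow> 'a set"
  assumes V: "\<And>i. open (V i)"
  shows "inner_mass (\<Union>i. V i) \<le> (\<Sum>i. inner_mass (V i))"
  unfolding inner_mass_def[of "\<Union>i. V i"]
proof (rule SUP_least, rule ennreal_le_epsilon)
  fix f and e :: real assume f: "f \<in> below (\<Union>i. V i)" and e: "0 < e"
  obtain d where d: "0 < d" "(\<lambda>x. max 0 (f x - d)) \<in> below (\<Union>i. V i)"
    "\<Lambda> f \<le> \<Lambda> (\<lambda>x. max 0 (f x - d)) + e"
    by (rule lower[OF f e]) blast
  define h where "h = (\<lambda>x. max 0 (f x - d))"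
  have hC: "Cc_fun U h" unfolding h_def by (rule below_D[OF d(2)])
  have h01: "0 \<le> h x" "h x \<le> 1" for x unfolding h_def using below_D(2-4)[OF d(2), of x] by auto
  define K where "K = {x. d \<le> f x}"
  have K: "compact K" unfolding K_def by (rule compact_superlevel[OF below_D(1)[OF f] d(1)])
  have hK: "h x = 0" if "x \<notin> K" for x using that by (simp add: h_def K_def)
  have "K \<subseteq> (\<Union>i. V i)"
    using below_D(4)[OF f] d(1) unfolding K_def by force
  then obtain n where n: "K \<subseteq> (\<Union>i<n. V i)"
  proof -
    assume *: "\<And>n. K \<subseteq> (\<Union>i<n. V i) \<Longrightarrow> thesis" and KV: "K \<subseteq> (\<Union>i. V i)"
    obtain I where I: "finite I" "K \<subseteq> (\<Union>i\<in>I. V i)"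
      by (rule compactE_image[OF K, of UNIV V]) (use V KV in auto)
    then have "K \<subseteq> (\<Union>i<Suc (Max I). V i)"
      using Max_ge[OF I(1)] by (force simp: less_Suc_eq_le)
    then show thesis by (rule *)
  qed
  have "\<exists>e. continuous_on UNIV e \<and> (\<forall>x. (0::real) \<le> e x) \<and> (\<forall>x. 0 < e x \<longleftrightarrow> x \<in> V i)" for i
    by (rule open_positivity_function[OF V[of i]]) blast
  then obtain g where g: "\<And>i. continuous_on UNIV (g i)" "\<And>i x. (0::real) \<le> g i x"
    "\<And>i x. 0 < g i x \<longleftrightarrow> x \<in> V i" by metis
  define s where "s x = (\<Sum>i<n. g i x)" for x
  have s0: "0 \<le> s x" for x unfolding s_def by (intro sum_nonneg g)
  have sc: "continuous_on UNIV s" unfolding s_def by (intro continuous_intros g)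
  obtain m where m: "0 < m" "\<And>x. x \<in> K \<Longrightarrow> m \<le> s x"
  proof (cases "K = {}")
    case True then show ?thesis using that[of 1] by auto
  next
    case False
    obtain x0 where x0: "x0 \<in> K" "\<And>x. x \<in> K \<Longrightarrow> s x0 \<le> s x"
      using continuous_attains_inf[OF K False continuous_on_subset[OF sc]] by blast
    obtain i where "i < n" "x0 \<in> V i" using n x0(1) by auto
    then have "0 < s x0" unfolding s_def by (intro sum_pos2[of _ i] g) (auto simp: g(3))
    then show ?thesis using that[of "s x0"] x0(2) by blast
  qed
  \<comment> \<open>The maximum with m keeps the denominator positive everywhere and changes nothing
    on K, where s is at least m; off K the factor h vanishes.\<close>
  define p where "p i x = h x * g i x / max (s x) m" for i x
  have pb: "p i \<in> below (V i)" if "i < n" for i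
    unfolding below_def
  proof (intro CollectI conjI allI)
    show "Cc_fun U (p i)"
      unfolding p_def
    proof (rule Cc_fun_dominated[OF hC])
      have "max (s x) m \<noteq> 0" for x using m(1) by linarith
      then show "continuous_on UNIV (\<lambda>x. h x * g i x / max (s x) m)"
        by (intro continuous_intros Cc_fun_continuous[OF hC] g sc) auto
    qed simp
    fix x
    show "0 \<le> p i x" unfolding p_def using m(1) g(2)[of i x] h01[of x] by (auto intro!: divide_nonneg_pos mult_nonneg_nonneg simp: max_def)
    show "p i x \<le> indicator (V i) x"
    proof (cases "x \<in> V i")
      case True
      have "g i x \<le> s x" unfolding s_def using that by (intro member_le_sum g) auto
      then have "h x * g i x \<le> 1 * max (s x) m" using h01[of x] g(2)[of i x] by (intro mult_mono) auto
      then show ?thesis using True m(1) by (simp add: p_def divide_le_eq max_def split: if_splits)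
    next
      case False
      then have "g i x = 0" using g(2,3)[of i x] by (metis less_le)
      then show ?thesis by (simp add: p_def)
    qed
  qed
  have "h = (\<lambda>x. \<Sum>i<n. p i x)"
  proof
    fix x
    have "(\<Sum>i<n. p i x) = h x * s x / max (s x) m"
      unfolding p_def s_def by (simp add: sum_distrib_left sum_divide_distrib)
    also have "\<dots> = h x"
      using m(1) m(2)[of x] hK[of x] by (cases "x \<in> K") (auto simp: max_def)
    finally show "h x = (\<Sum>i<n. p i x)" by simp
  qed
  then have "\<Lambda> h = (\<Sum>i<n. \<Lambda> (p i))"
    using sum[of "{..<n}" p] below_D(1)[OF pb] by simp
  then have "ennreal (\<Lambda> h) = (\<Sum>i<n. ennreal (\<Lambda> (p i)))"
    using nonneg[OF below_D(1)[OF pb] below_D(2)[OF pb]] by (subst sum_ennreal) auto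
  also have "\<dots> \<le> (\<Sum>i<n. inner_mass (V i))"
    by (intro sum_mono inner_mass_upper pb) auto
  also have "\<dots> \<le> (\<Sum>i. inner_mass (V i))" by (rule sum_le_suminf) auto
  finally have 1: "ennreal (\<Lambda> h) \<le> (\<Sum>i. inner_mass (V i))" .
  have "ennreal (\<Lambda> f) \<le> ennreal (\<Lambda> h + e)" using d(3) unfolding h_def by (rule ennreal_leI)
  also have "\<dots> = ennreal (\<Lambda> h) + ennreal e"
    using e nonneg[OF hC h01(1)] by (simp add: ennreal_plus)
  also have "\<dots> \<le> (\<Sum>i. inner_mass (V i)) + ennreal e" by (rule add_right_mono[OF 1])
  finally show "ennreal (\<Lambda> f) \<le> (\<Sum>i. inner_mass (V i)) + ennreal e" .
qed

lemma outer_empty: "outer {} = 0"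
proof -
  have "inner_mass {} \<le> 0"
    unfolding inner_mass_def
  proof (rule SUP_least)
    fix f assume "f \<in> below {}"
    then have "f = (\<lambda>x. 0)" using below_D(4)[of f "{}"] by auto
    then show "ennreal (\<Lambda> f) \<le> 0" by (simp add: zero)
  qed
  then show ?thesis using outer_open[of "{}"] by simp
qed

lemma outer_close:
  assumes "outer A < c"
  shows "\<exists>V. open V \<and> A \<subseteq> V \<and> inner_mass V < c"
  using assms unfolding outer_def INF_less_iff by auto

lemma outer_countable_subadditive:
  fixes A :: "nat \<Rightarrow> 'a set"
  shows "outer (\<Union>i. A i) \<le> (\<Sum>i. outer (A i))"
proof (rule ennreal_le_epsilon)
  fix e :: real assume e: "0 < e" and fin: "(\<Sum>i. outer (A i)) < top"
  have "outer (A i) < outer (A i) + e * (1/2)^Suc i" for i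
    using fin e by (auto simp add: less_top dest!: ennreal_suminf_lessD)
  from outer_close[OF this] obtain V where V: "\<And>i. open (V i)" "\<And>i. A i \<subseteq> V i"
    "\<And>i. inner_mass (V i) < outer (A i) + e * (1/2)^Suc i" by metis
  have "outer (\<Union>i. A i) \<le> outer (\<Union>i. V i)" by (rule outer_mono) (use V(2) in blast)
  also have "\<dots> = inner_mass (\<Union>i. V i)" by (rule outer_open) (use V(1) in blast)
  also have "\<dots> \<le> (\<Sum>i. inner_mass (V i))" by (rule inner_mass_countable_subadditive[OF V(1)])
  also have "\<dots> \<le> (\<Sum>i. outer (A i) + e * (1/2) ^ Suc i)"
    by (intro suminf_le less_imp_le V(3)) auto
  also have "\<dots> = (\<Sum>i. outer (A i)) + (\<Sum>i. ennreal e * ennreal ((1/2) ^ Suc i))"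
    using e by (subst suminf_add[symmetric])
      (auto simp del: ennreal_suminf_cmult simp add: ennreal_mult[symmetric])
  also have "\<dots> = (\<Sum>i. outer (A i)) + e"
    unfolding ennreal_suminf_cmult
    by (subst suminf_ennreal_eq[OF zero_le_power power_half_series]) auto
  finally show "outer (\<Union>i. A i) \<le> (\<Sum>i. outer (A i)) + ennreal e" .
qed

lemma outer_measure_space: "outer_measure_space (Pow UNIV) outer"
  unfolding outer_measure_space_def positive_def increasing_def countably_subadditive_def
  using outer_empty outer_mono outer_countable_subadditive by auto

lemma outer_Un: "outer (A \<union> B) \<le> outer A + outer B"
proof -
  define C :: "nat \<Rightarrow> 'a set" where "C i = (if i = 0 then A else if i = 1 then B else {})" for i
  have "(\<Union>i. C i) = A \<union> B"
  proof (intro antisym subsetI)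
    fix x assume "x \<in> A \<union> B"
    then have "x \<in> C 0 \<or> x \<in> C 1" by (auto simp: C_def)
    then show "x \<in> (\<Union>i. C i)" by blast
  qed (auto simp: C_def split: if_splits)
  moreover have "(\<Sum>i. outer (C i)) = (\<Sum>i\<in>{0, 1}. outer (C i))"
    by (rule suminf_finite) (auto simp: outer_empty C_def)
  ultimately show ?thesis using outer_countable_subadditive[of C] by (simp add: C_def)
qed

text \<open>The splitting is tested on open W containing A. A nearly optimal function for V \<inter>
  W, once lowered, vanishes off a compact K inside V. Any admissible function for W - K can be added
  to it without exceeding 1, and W - K contains W - V.\<close>

lemma open_in_lambda_system:
  assumes V: "open V"
  shows "V \<in> lambda_system UNIV (Pow UNIV) outer"
  unfolding lambda_system_def
proof (intro CollectI conjI ballI)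
  fix A :: "'a set"
  have "outer (V \<inter> A) + outer ((UNIV - V) \<inter> A) \<le> outer A"
    unfolding outer_def[of A]
  proof (rule INF_greatest)
    fix W assume "W \<in> {V. open V \<and> A \<subseteq> V}"
    then have W: "open W" "A \<subseteq> W" by auto
    have "inner_mass (V \<inter> W) + outer (W - V) \<le> inner_mass W"
      unfolding inner_mass_def[of "V \<inter> W"]
    proof (subst ennreal_SUP_add_left[symmetric])
      show "below (V \<inter> W) \<noteq> {}"
        using Cc_fun_zero[of U] by (auto simp: below_def intro!: exI[of _ "\<lambda>_. 0"])
      show "(SUP f\<in>below (V \<inter> W). ennreal (\<Lambda> f) + outer (W - V)) \<le> inner_mass W"
      proof (rule SUP_least, rule ennreal_le_epsilon)
        fix f and e :: real assume f: "f \<in> below (V \<inter> W)" and e: "0 < e"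
        obtain d where d: "0 < d" "(\<lambda>x. max 0 (f x - d)) \<in> below (V \<inter> W)"
          "\<Lambda> f \<le> \<Lambda> (\<lambda>x. max 0 (f x - d)) + e"
          by (rule lower[OF f e]) blast
        define h where "h = (\<lambda>x. max 0 (f x - d))"
        have hC: "Cc_fun U h" unfolding h_def by (rule below_D[OF d(2)])
        have h01: "0 \<le> h x" "h x \<le> 1" "x \<notin> W \<Longrightarrow> h x = 0" for x
          unfolding h_def using below_D(2-4)[OF d(2), of x] by auto
        define K where "K = {x. d \<le> f x}"
        have K: "compact K" unfolding K_def by (rule compact_superlevel[OF below_D(1)[OF f] d(1)])
        have KV: "K \<subseteq> V" using below_D(4)[OF f] d(1) unfolding K_def by force
        have o: "open (W - K)" using W(1) compact_imp_closed[OF K] by (rule open_Diff)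
        have "outer (W - V) \<le> inner_mass (W - K)"
          using outer_mono[of "W - V" "W - K"] outer_open[OF o] KV by auto
        moreover have "inner_mass (W - K) + ennreal (\<Lambda> h) \<le> inner_mass W"
          unfolding inner_mass_def[of "W - K"]
        proof (subst ennreal_SUP_add_left[symmetric])
          show "below (W - K) \<noteq> {}"
            using Cc_fun_zero[of U] by (auto simp: below_def intro!: exI[of _ "\<lambda>_. 0"])
          show "(SUP g\<in>below (W - K). ennreal (\<Lambda> g) + ennreal (\<Lambda> h)) \<le> inner_mass W"
          proof (rule SUP_least)
            fix g assume g: "g \<in> below (W - K)"
            have "(\<lambda>x. h x + g x) \<in> below W"
              unfolding below_def
            proof (intro CollectI conjI allI Cc_fun_add hC below_D(1)[OF g])
              fix x
              show "0 \<le> h x + g x" using h01(1)[of x] below_D(2)[OF g, of x] by simp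
              have "x \<notin> K \<Longrightarrow> h x = 0" by (simp add: h_def K_def)
              then show "h x + g x \<le> indicator W x"
                using h01[of x] below_D(3)[OF g, of x] below_D(4)[OF g, of x]
                by (cases "x \<in> K"; cases "x \<in> W") auto
            qed
            from inner_mass_upper[OF this]
            show "ennreal (\<Lambda> g) + ennreal (\<Lambda> h) \<le> inner_mass W"
              unfolding add[OF hC below_D(1)[OF g]]
              using nonneg[OF hC h01(1)] nonneg[OF below_D(1)[OF g] below_D(2)[OF g]]
              by (simp add: ennreal_plus add.commute)
          qed
        qed
        ultimately have 1: "ennreal (\<Lambda> h) + outer (W - V) \<le> inner_mass W"
          by (metis add.commute add_left_mono order_trans)
        have "ennreal (\<Lambda> f) \<le> ennreal (\<Lambda> h + e)" using d(3) unfolding h_def by (rule ennreal_leI)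
        also have "\<dots> = ennreal (\<Lambda> h) + ennreal e"
          using e nonneg[OF hC h01(1)] by (simp add: ennreal_plus)
        finally have "ennreal (\<Lambda> f) + outer (W - V) \<le> ennreal (\<Lambda> h) + ennreal e + outer (W - V)"
          by (rule add_right_mono)
        also have "\<dots> = (ennreal (\<Lambda> h) + outer (W - V)) + ennreal e" by (simp add: ac_simps)
        also have "\<dots> \<le> inner_mass W + ennreal e" by (rule add_right_mono[OF 1])
        finally show "ennreal (\<Lambda> f) + outer (W - V) \<le> inner_mass W + ennreal e" .
      qed
    qed
    moreover have "outer (V \<inter> A) \<le> inner_mass (V \<inter> W)"
      using outer_mono[of "V \<inter> A" "V \<inter> W"] outer_open[of "V \<inter> W"] W V by (simp add: open_Int inf.coboundedI2)
    moreover have "outer ((UNIV - V) \<inter> A) \<le> outer (W - V)"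
      using W by (intro outer_mono) auto
    ultimately show "outer (V \<inter> A) + outer ((UNIV - V) \<inter> A) \<le> inner_mass W"
      by (meson add_mono order_trans)
  qed
  moreover have "outer A \<le> outer (V \<inter> A) + outer ((UNIV - V) \<inter> A)"
    using outer_Un[of "V \<inter> A" "(UNIV - V) \<inter> A"] by (simp add: Int_Diff_Un Un_Diff_Int inf_commute Diff_Int_distrib2)
      (metis Int_Diff_Un inf_commute Diff_eq Compl_eq_Diff_UNIV)
  ultimately show "outer (V \<inter> A) + outer ((UNIV - V) \<inter> A) = outer A" by (rule antisym)
qed simp

section \<open>The Caratheodory measure on Borel sets and its integrals\<close>

definition riesz :: "'a measure" where
  "riesz = measure_of UNIV (sets borel) outer"

lemma riesz_sets [simp, measurable_cong]: "sets riesz = sets borel" "space riesz = UNIV"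
proof -
  show "sets riesz = sets borel"
    unfolding riesz_def using sets.sigma_sets_eq[of "borel::'a measure"]
    by (simp add: sets_measure_of)
  show "space riesz = UNIV" unfolding riesz_def by (rule space_measure_of_conv)
qed

lemma riesz_emeasure:
  assumes "A \<in> sets borel"
  shows "emeasure riesz A = outer A"
proof -
  have ms: "measure_space UNIV (lambda_system UNIV (Pow UNIV) outer) outer"
    by (rule sigma_algebra.caratheodory_lemma[OF sigma_algebra_Pow outer_measure_space])
  then have sa: "sigma_algebra UNIV (lambda_system UNIV (Pow UNIV) outer)"
    by (simp add: measure_space_def)
  have "sets borel \<subseteq> lambda_system UNIV (Pow UNIV) outer"
    unfolding borel_def sets_measure_of[OF subset_UNIV[of "{S. open S}", unfolded Pow_UNIV[symmetric]]]
    by (rule sigma_algebra.sigma_sets_subset[OF sa]) (use open_in_lambda_system in auto)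
  then have "measure_space UNIV (sets borel) outer"
    using measure_down[OF ms] sets.sigma_algebra_axioms[of borel] by simp
  then show ?thesis
    unfolding riesz_def measure_space_def using assms by (intro emeasure_measure_of_sigma) auto
qed

lemma riesz_open_le:
  assumes f: "Cc_fun U f" "\<And>x. 0 \<le> f x" and V: "open V" "\<And>x. x \<in> V \<Longrightarrow> 1 \<le> f x"
  shows "emeasure riesz V \<le> ennreal (\<Lambda> f)"
proof -
  have "inner_mass V \<le> ennreal (\<Lambda> f)"
    unfolding inner_mass_def
  proof (rule SUP_least)
    fix g assume g: "g \<in> below V"
    show "ennreal (\<Lambda> g) \<le> ennreal (\<Lambda> f)"
    proof (intro ennreal_leI mono below_D(1)[OF g] f(1))
      fix x show "g x \<le> f x"
        using below_D(3)[OF g, of x] below_D(4)[OF g, of x] f(2)[of x] V(2)[of x] by (cases "x \<in> V") auto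
    qed
  qed
  then show ?thesis using V by (simp add: riesz_emeasure outer_open)
qed

lemma riesz_compact_finite:
  assumes K: "compact K" "K \<subseteq> U"
  shows "emeasure riesz K < \<infinity>"
proof -
  obtain f where f: "test_fun U f" "\<And>x. 0 \<le> f x" "\<And>x. x \<in> K \<Longrightarrow> 1 < f x"
    by (rule Cc_fun_ge_1_on_compact[OF K(1) open_U K(2)]) blast
  have o: "open {x. 1 < f x}"
    by (intro open_Collect_less continuous_intros Cc_fun_continuous[OF test_fun_Cc[OF f(1)]])
  have "emeasure riesz K \<le> emeasure riesz {x. 1 < f x}"
    using f(3) o by (intro emeasure_mono) auto
  also have "\<dots> \<le> ennreal (\<Lambda> f)"
    by (rule riesz_open_le[OF test_fun_Cc[OF f(1)] f(2) o]) simp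
  finally show ?thesis by (simp add: le_less_trans[OF _ ennreal_less_top])
qed

lemma riesz_integrable:
  assumes f: "Cc_fun U f"
  shows "integrable riesz f"
proof -
  obtain B where B: "0 < B" "\<And>x. \<bar>f x\<bar> \<le> B" by (rule Cc_fun_bounded[OF f]) blast
  have K: "compact (tsupport f)" "tsupport f \<subseteq> U" using f by (auto simp: Cc_fun_def)
  have "integrable riesz (\<lambda>x. B * indicator (tsupport f) x)"
    using riesz_compact_finite[OF K] closed_tsupport[of f]
    by (intro integrable_mult_right integrable_real_indicator) auto
  then show ?thesis
  proof (rule Bochner_Integration.integrable_bound)
    have "f \<in> borel_measurable borel" by (rule borel_measurable_continuous_onI[OF Cc_fun_continuous[OF f]])
    then show "f \<in> borel_measurable riesz" by (simp add: measurable_cong_sets[OF riesz_sets(1) refl])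
    show "AE x in riesz. norm (f x) \<le> norm (B * indicator (tsupport f) x)"
      using B not_in_tsupport[of _ f] by (intro AE_I2) (auto simp: indicator_def)
  qed
qed

text \<open>A layer-cake argument with step 1/n: n f is the sum of the slices \<open>g k\<close>,
  and each slice lies between the indicators of {f > (k+1)/n} and {f > k/n}. Functional and integral
  of \<open>g k\<close> therefore both lie between two consecutive values of the distribution
  function m, and the gaps telescope to at most m 0.\<close>

lemma riesz_integral_nonneg:
  assumes f: "Cc_fun U f" and f0: "\<And>x. 0 \<le> f x"
  shows "(\<integral>x. f x \<partial>riesz) = \<Lambda> f"
proof -
  obtain B where B: "0 < B" "\<And>x. \<bar>f x\<bar> \<le> B" by (rule Cc_fun_bounded[OF f]) blast
  have fc: "continuous_on UNIV f" by (rule Cc_fun_continuous[OF f])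
  define m where "m t = measure riesz {x. t < f x}" for t
  have o: "open {x. t < f x}" for t by (intro open_Collect_less continuous_intros fc)
  have fin: "emeasure riesz {x. t < f x} < \<infinity>" if "0 \<le> t" for t
  proof -
    have "emeasure riesz {x. t < f x} \<le> emeasure riesz (tsupport f)"
    proof (rule emeasure_mono)
      show "{x. t < f x} \<subseteq> tsupport f"
      proof
        fix x assume "x \<in> {x. t < f x}"
        then show "x \<in> tsupport f" using that in_tsupport[of f x] by force
      qed
    qed (use closed_tsupport[of f] in auto)
    also have "\<dots> < \<infinity>" by (rule riesz_compact_finite) (use f in \<open>auto simp: Cc_fun_def\<close>)
    finally show ?thesis .
  qed
  have m_eq: "emeasure riesz {x. t < f x} = ennreal (m t)" if "0 \<le> t" for t
    unfolding m_def using fin[OF that] by (intro emeasure_eq_ennreal_measure) auto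
  have key: "\<bar>(\<integral>x. f x \<partial>riesz) - \<Lambda> f\<bar> \<le> m 0 / real n" if n: "0 < n" for n :: nat
  proof -
    define N where "N = nat \<lceil>real n * B\<rceil>"
    define g where "g k x = max 0 (min 1 (real n * f x - real k))" for k :: nat and x
    have gC: "Cc_fun U (g k)" for k
      unfolding g_def by (rule Cc_fun_dominated[OF f]) (auto intro!: continuous_intros fc)
    have g01: "0 \<le> g k x" "g k x \<le> 1" for k x by (auto simp: g_def)
    \<comment> \<open>The unit slices of t add up to t as long as t lies between 0 and M; N is
      chosen so that n f never exceeds it.\<close>
    have sum_clamp: "(\<Sum>k<M. max 0 (min 1 (t - real k))) = max 0 (min (real M) t)" for t and M :: nat
      by (induction M) (auto simp: max_def min_def)
    have f_eq: "f = (\<lambda>x. (1 / real n) * (\<Sum>k<N. g k x))"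
    proof
      fix x
      have "real n * f x \<le> real n * B" using B(2)[of x] by (intro mult_left_mono) auto
      also have "\<dots> \<le> real N" unfolding N_def by (rule real_nat_ceiling_ge)
      finally have "(\<Sum>k<N. g k x) = real n * f x"
        unfolding g_def sum_clamp using f0[of x] by (simp add: min_def max_def)
      then show "f x = (1 / real n) * (\<Sum>k<N. g k x)" using n by simp
    qed
    have Lf: "\<Lambda> f = (1 / real n) * (\<Sum>k<N. \<Lambda> (g k))"
      by (subst f_eq) (simp only: scale[OF Cc_fun_sum[OF gC]] sum[OF gC])
    have If: "(\<integral>x. f x \<partial>riesz) = (1 / real n) * (\<Sum>k<N. (\<integral>x. g k x \<partial>riesz))"
      by (subst f_eq) (simp add: Bochner_Integration.integral_sum riesz_integrable[OF gC])
    let ?t = "\<lambda>k. real k / real n"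
    have up: "\<Lambda> (g k) \<le> m (?t k)" "(\<integral>x. g k x \<partial>riesz) \<le> m (?t k)" for k
    proof -
      have le: "g k x \<le> indicator {x. ?t k < f x} x" for x
        using n by (auto simp: g_def indicator_def field_simps)
      have "g k \<in> below {x. ?t k < f x}" unfolding below_def using gC g01 le by auto
      from inner_mass_upper[OF this] have "ennreal (\<Lambda> (g k)) \<le> ennreal (m (?t k))"
        using m_eq[of "?t k"] o by (simp add: riesz_emeasure outer_open)
      then show "\<Lambda> (g k) \<le> m (?t k)" by (simp add: m_def)
      have "(\<integral>x. g k x \<partial>riesz) \<le> (\<integral>x. indicator {x. ?t k < f x} x \<partial>riesz)"
        by (intro integral_mono riesz_integrable gC integrable_real_indicator le)
          (use o fin[of "?t k"] in auto)
      then show "(\<integral>x. g k x \<partial>riesz) \<le> m (?t k)" using o by (simp add: m_def)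
    qed
    have low: "m (?t (Suc k)) \<le> \<Lambda> (g k)" "m (?t (Suc k)) \<le> (\<integral>x. g k x \<partial>riesz)" for k
    proof -
      have ge: "1 \<le> g k x" if "?t (Suc k) < f x" for x
        using that n by (auto simp: g_def field_simps)
      have "emeasure riesz {x. ?t (Suc k) < f x} \<le> ennreal (\<Lambda> (g k))"
        by (rule riesz_open_le[OF gC g01(1) o]) (use ge in auto)
      then show "m (?t (Suc k)) \<le> \<Lambda> (g k)"
        using m_eq[of "?t (Suc k)"] nonneg[OF gC g01(1)] by simp
      have "(\<integral>x. indicator {x. ?t (Suc k) < f x} x \<partial>riesz) \<le> (\<integral>x. g k x \<partial>riesz)"
        by (intro integral_mono riesz_integrable gC integrable_real_indicator)
          (use o fin[of "?t (Suc k)"] ge g01 in \<open>auto simp: indicator_def\<close>)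
      then show "m (?t (Suc k)) \<le> (\<integral>x. g k x \<partial>riesz)" using o by (simp add: m_def)
    qed
    have "\<bar>(\<Sum>k<N. (\<integral>x. g k x \<partial>riesz)) - (\<Sum>k<N. \<Lambda> (g k))\<bar> \<le> (\<Sum>k<N. m (?t k) - m (?t (Suc k)))"
      unfolding sum_subtractf[symmetric]
      by (rule order_trans[OF sum_abs sum_mono]) (use up low in \<open>smt (verit)\<close>)
    also have "\<dots> = m (?t 0) - m (?t N)" by (rule sum_lessThan_telescope')
    also have "\<dots> \<le> m 0" by (simp add: m_def)
    finally show ?thesis
      unfolding Lf If right_diff_distrib[symmetric] abs_mult using n by (simp add: divide_right_mono)
  qed
  have "(\<lambda>n. m 0 / real n) \<longlonglongrightarrow> 0" by (rule lim_const_over_n)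
  then have "\<bar>(\<integral>x. f x \<partial>riesz) - \<Lambda> f\<bar> \<le> 0"
    by (rule LIMSEQ_le_const) (auto intro!: exI[of _ 1] key)
  then show ?thesis by simp
qed

lemma riesz_integral:
  assumes f: "Cc_fun U f"
  shows "(\<integral>x. f x \<partial>riesz) = \<Lambda> f"
proof -
  have p: "Cc_fun U (\<lambda>x. max 0 (f x))" "Cc_fun U (\<lambda>x. max 0 (- f x))"
    by (rule Cc_fun_dominated[OF f]; auto intro!: continuous_intros Cc_fun_continuous[OF f])+
  have fe: "f = (\<lambda>x. max 0 (f x) + (- 1) * max 0 (- f x))" by (auto simp: max_def)
  have "\<Lambda> f = \<Lambda> (\<lambda>x. max 0 (f x)) + (-1) * \<Lambda> (\<lambda>x. max 0 (- f x))"
    by (subst fe) (simp only: add[OF p(1) Cc_fun_cmult[OF p(2)]] scale[OF p(2)])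
  moreover have "(\<integral>x. f x \<partial>riesz) = (\<integral>x. max 0 (f x) \<partial>riesz) + (-1) * (\<integral>x. max 0 (- f x) \<partial>riesz)"
    by (subst fe, subst Bochner_Integration.integral_add)
      (use riesz_integrable[OF p(1)] riesz_integrable[OF p(2)] in auto)
  ultimately show ?thesis
    using riesz_integral_nonneg[OF p(1)] riesz_integral_nonneg[OF p(2)] by simp
qed

text \<open>If the functional is unbounded near the boundary of U, boundary points can have infinite
  outer measure. The density given by the indicator of U removes everything outside U and leaves
  integrals of functions supported in U unchanged.\<close>

theorem riesz_representation:
  "\<exists>\<mu>. radon_on U \<mu> \<and> (\<forall>f. Cc_fun U f \<longrightarrow> (\<integral>x. f x \<partial>\<mu>) = \<Lambda> f)"
proof (intro exI[of _ "density riesz (indicator U)"] conjI allI impI)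
  have U: "U \<in> sets borel" using open_U by simp
  have e: "emeasure (density riesz (indicator U)) A = emeasure riesz (U \<inter> A)" if "A \<in> sets borel" for A
    using that U by (subst emeasure_density) (auto simp: indicator_inter_arith[symmetric])
  show "radon_on U (density riesz (indicator U))"
    unfolding radon_on_def
  proof (intro conjI allI impI)
    show "emeasure (density riesz (indicator U)) (UNIV - U) = 0"
      using U by (subst e) auto
    fix K assume K: "compact K \<and> K \<subseteq> U"
    then have "U \<inter> K = K" by auto
    then show "emeasure (density riesz (indicator U)) K < \<infinity>"
      using K riesz_compact_finite[of K] by (subst e) (auto simp: compact_imp_closed)
  qed simp
  fix f assume f: "Cc_fun U f"
  have fm: "f \<in> borel_measurable riesz" using riesz_integrable[OF f] by auto
  have "(\<integral>x. f x \<partial>density riesz (\<lambda>x. ennreal (indicator U x))) = (\<integral>x. indicator U x * f x \<partial>riesz)"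
    using U by (subst integral_density[OF fm]) auto
  also have "(\<lambda>x. indicator U x * f x) = f"
    using f not_in_tsupport[of _ f] by (auto simp: Cc_fun_def indicator_def fun_eq_iff)
  finally show "(\<integral>x. f x \<partial>density riesz (indicator U)) = \<Lambda> f"
    by (simp add: riesz_integral[OF f] ennreal_indicator)
qed

end

section \<open>Lebesgue integrals on space-time\<close>

lemma integrable_mult_bounded_support:
  fixes F w :: "'a::euclidean_space \<Rightarrow> real"
  assumes F: "set_integrable lebesgue C F" and w: "w \<in> borel_measurable lebesgue"
    and B: "\<And>x. \<bar>w x\<bar> \<le> B" and C: "\<And>x. x \<notin> C \<Longrightarrow> w x = 0"
  shows "integrable lebesgue (\<lambda>x. F x * w x)"
proof -
  have i: "integrable lebesgue (\<lambda>x. indicator C x * F x)"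
    using F by (simp add: set_integrable_def)
  have "integrable lebesgue (\<lambda>x. (indicator C x * F x) * w x)"
  proof (rule Bochner_Integration.integrable_bound[OF integrable_mult_right[OF i, of B]])
    show "(\<lambda>x. indicator C x * F x * w x) \<in> borel_measurable lebesgue"
      using borel_measurable_integrable[OF i] w by (rule borel_measurable_times)
    have "\<bar>w x\<bar> \<le> \<bar>B\<bar>" for x using B[of x] by linarith
    then show "AE x in lebesgue. norm (indicator C x * F x * w x) \<le> norm (B * (indicator C x * F x))"
      by (intro AE_I2) (simp add: abs_mult mult.commute[of "\<bar>B\<bar>"] mult_left_mono)
  qed
  moreover have "(\<lambda>x. (indicator C x * F x) * w x) = (\<lambda>x. F x * w x)"
  proof
    fix x show "indicator C x * F x * w x = F x * w x" using C[of x] by (cases "x \<in> C") auto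
  qed
  ultimately show ?thesis by simp
qed

lemma AE_lborel_slices:
  assumes N: "N \<in> null_sets (lborel :: ('a::euclidean_space \<times> real) measure)"
  shows "AE t in lborel. AE x in lborel. (x, t) \<notin> N"
proof -
  have "N \<in> null_sets (lborel \<Otimes>\<^sub>M lborel)" unfolding lborel_prod by (rule N)
  then have Ns: "N \<in> sets (lborel \<Otimes>\<^sub>M lborel)" by (rule null_setsD2)
  have "AE p in lborel \<Otimes>\<^sub>M lborel. p \<notin> N" unfolding lborel_prod using N by (rule AE_not_in)
  then have "AE x in lborel. AE t in lborel. (x, t) \<notin> N" by (rule lborel_pair.AE_pair)
  moreover have "{p \<in> space (lborel \<Otimes>\<^sub>M lborel). (fst p, snd p) \<notin> N} \<in> sets (lborel \<Otimes>\<^sub>M lborel)"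
    using sets.compl_sets[OF Ns] by (simp add: set_diff_eq Collect_conj_eq)
  ultimately show ?thesis using lborel_pair.AE_commute[of "\<lambda>x t. (x, t) \<notin> N"] by simp
qed

text \<open>Lebesgue measure on space-time is a completed product, so slices of a measurable
  function need not be measurable. Arguments of Fubini type are run on a Borel representative that
  agrees with F on almost every time slice, up to null sets.\<close>

lemma lebesgue_borel_representative:
  fixes F :: "'a::euclidean_space \<times> real \<Rightarrow> real"
  assumes "F \<in> borel_measurable lebesgue"
  obtains F' where "F' \<in> borel_measurable borel" "AE p in lebesgue. F p = F' p"
    "AE t in lborel. AE x in lborel. F (x, t) = F' (x, t)"
proof -
  obtain F' where F': "F' \<in> borel_measurable lborel" "AE p in lborel. F p = F' p"
    using completion_ex_borel_measurable_real[OF assms] by blast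
  from F'(2) obtain N where N0: "{p \<in> space lborel. F p \<noteq> F' p} \<subseteq> N"
    "emeasure lborel N = 0" "N \<in> sets lborel"
    by (rule AE_E)
  have N: "N \<in> null_sets lborel" "{p. F p \<noteq> F' p} \<subseteq> N" using N0 by auto
  have "AE t in lborel. AE x in lborel. F (x, t) = F' (x, t)"
    using AE_lborel_slices[OF N(1)]
  proof eventually_elim
    case (elim t)
    then show ?case
    proof eventually_elim
      case (elim x)
      then show ?case using N(2) by auto
    qed
  qed
  moreover have "AE p in lebesgue. F p = F' p" using F'(2) by (rule AE_completion)
  ultimately show ?thesis using F'(1) that by simp
qed

text \<open>This turns a statement known for each time separately, up to a null set depending on the
  time, into one almost everywhere in space-time. It is how the sign of u reaches the space-time
  integrals.\<close>

lemma AE_eq_of_slices: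
  fixes F G :: "'a::euclidean_space \<times> real \<Rightarrow> real"
  assumes F: "F \<in> borel_measurable lebesgue" and G: "G \<in> borel_measurable lebesgue"
    and eq: "\<And>t. AE x in lebesgue. F (x, t) = G (x, t)"
  shows "AE p in lebesgue. F p = G p"
proof -
  obtain F' where F': "F' \<in> borel_measurable borel" "AE p in lebesgue. F p = F' p"
    "AE t in lborel. AE x in lborel. F (x, t) = F' (x, t)"
    by (rule lebesgue_borel_representative[OF F]) blast
  obtain G' where G': "G' \<in> borel_measurable borel" "AE p in lebesgue. G p = G' p"
    "AE t in lborel. AE x in lborel. G (x, t) = G' (x, t)"
    by (rule lebesgue_borel_representative[OF G]) blast
  have eq': "AE x in lborel. F (x, t) = G (x, t)" for t
    using eq[of t] by (simp add: AE_completion_iff)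
  have "AE t in lborel. AE x in lborel. F' (x, t) = G' (x, t)"
    using F'(3) G'(3)
  proof eventually_elim
    case (elim t)
    then show ?case using eq'[of t] by eventually_elim simp
  qed
  moreover have "(\<lambda>p. F' p - G' p) \<in> borel_measurable (lborel \<Otimes>\<^sub>M lborel)"
    using F'(1) G'(1) unfolding lborel_prod by simp
  from measurable_sets[OF this, of "{0}"]
  have S: "{p \<in> space (lborel \<Otimes>\<^sub>M lborel). F' p = G' p} \<in> sets (lborel \<Otimes>\<^sub>M lborel)"
    by (simp add: vimage_def Int_def conj_commute)
  ultimately have *: "AE x in lborel. AE t in lborel. F' (x, t) = G' (x, t)"
    using lborel_pair.AE_commute[of "\<lambda>x t. F' (x, t) = G' (x, t)"] by simp
  have "AE p in lborel. F' p = G' p"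
    using lborel_pair.AE_pair_measure[OF S *] unfolding lborel_prod .
  then have "AE p in lebesgue. F' p = G' p" by (rule AE_completion)
  with F'(2) G'(2) show ?thesis by eventually_elim simp
qed

text \<open>The slice integrals are supplied as a Borel function Y, so that in the application they
  are the masses of u, which are defined at every single time and not just at almost every
  one.\<close>

lemma lebesgue_Fubini:
  fixes F :: "'a::euclidean_space \<times> real \<Rightarrow> real"
  assumes F: "integrable lebesgue F" and m: "\<And>t. (\<lambda>x. F (x, t)) \<in> borel_measurable lebesgue"
    and Y: "Y \<in> borel_measurable borel" "\<And>t. (\<integral>x. F (x, t) \<partial>lebesgue) = Y t"
  shows "(\<integral>p. F p \<partial>lebesgue) = (\<integral>t. Y t \<partial>lborel)" "integrable lborel Y"
proof -
  obtain F' where F': "F' \<in> borel_measurable borel" "AE p in lebesgue. F p = F' p"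
    "AE t in lborel. AE x in lborel. F (x, t) = F' (x, t)"
    by (rule lebesgue_borel_representative[OF borel_measurable_integrable[OF F]]) blast
  have mF': "F' \<in> borel_measurable lebesgue"
    using F'(1) by (intro measurable_completion) simp
  have "integrable lebesgue F'"
    using F F'(2) mF' by (subst integrable_cong_AE[of F' lebesgue F]) auto
  then have "integrable lborel F'" using F'(1) by (subst (asm) integrable_completion) auto
  then have i: "integrable (lborel \<Otimes>\<^sub>M lborel) (\<lambda>(x, t). F' (x, t))" by (simp add: lborel_prod)
  have sl: "AE t in lborel. (\<integral>x. F' (x, t) \<partial>lborel) = Y t"
    using F'(3)
  proof eventually_elim
    case (elim t)
    have m': "(\<lambda>x. F' (x, t)) \<in> borel_measurable borel" using F'(1) by measurable
    have "(\<integral>x. F' (x, t) \<partial>lborel) = (\<integral>x. F' (x, t) \<partial>lebesgue)"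
      using m' by (subst integral_completion) auto
    also have "\<dots> = (\<integral>x. F (x, t) \<partial>lebesgue)"
    proof (rule integral_cong_AE)
      show "(\<lambda>x. F' (x, t)) \<in> borel_measurable lebesgue" using m' by (intro measurable_completion) simp
      show "AE x in lebesgue. F' (x, t) = F (x, t)"
        using elim by (intro AE_completion) (auto elim: eventually_mono)
    qed (rule m)
    finally show ?case using Y(2) by simp
  qed
  have iF: "integrable lborel (\<lambda>t. \<integral>x. F' (x, t) \<partial>lborel)"
    using lborel_pair.integrable_snd[OF i] by simp
  show "integrable lborel Y"
    using iF sl Y(1) by (subst integrable_cong_AE[where g="\<lambda>t. \<integral>x. F' (x, t) \<partial>lborel"]) (auto elim: eventually_mono)
  have "(\<integral>p. F p \<partial>lebesgue) = (\<integral>p. F' p \<partial>lebesgue)"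
    using F'(2) mF' F by (intro integral_cong_AE) auto
  also have "\<dots> = (\<integral>p. F' p \<partial>lborel)" using F'(1) by (subst integral_completion) auto
  also have "\<dots> = (\<integral>t. \<integral>x. F' (x, t) \<partial>lborel \<partial>lborel)"
    using lborel_pair.integral_snd[OF i] by (simp add: lborel_prod)
  also have "\<dots> = (\<integral>t. Y t \<partial>lborel)"
    using sl Y(1) borel_measurable_integrable[OF iF] by (intro integral_cong_AE) auto
  finally show "(\<integral>p. F p \<partial>lebesgue) = (\<integral>t. Y t \<partial>lborel)" .
qed

section \<open>Cutoffs in time\<close>

text \<open>For n > 0 it rises just after t1 and falls just after t2, each within time 1/n. The
  limit is the indicator of \<open>{t1<..t2}\<close>, and the support reaches slightly beyond
  t2.\<close>

definition time_cutoff :: "real \<Rightarrow> real \<Rightarrow> real \<Rightarrow> real \<Rightarrow> real" where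
  "time_cutoff n t1 t2 t = smooth_step (n * (t - t1)) - smooth_step (n * (t - t2))"

text \<open>The time derivative of one edge of the cutoff: an approximate identity concentrated to
  the right of \<tau>.\<close>

definition time_kernel :: "real \<Rightarrow> real \<Rightarrow> real \<Rightarrow> real" where
  "time_kernel n \<tau> t = n * step_deriv (n * (t - \<tau>))"

lemma smooth_fun_real_affine: "smooth_fun (\<lambda>t::real. n * (t - \<tau>))"
  by (intro smooth_intros(4) smooth_fun_diff smooth_fun_ident smooth_intros(1))

lemma time_cutoff_smooth: "smooth_fun (time_cutoff n t1 t2)"
  unfolding time_cutoff_def[abs_def]
  by (intro smooth_fun_diff smooth_fun_smooth_step smooth_fun_real_affine)

lemma time_cutoff_deriv: "dirderiv 1 (time_cutoff n t1 t2) t = time_kernel n t1 t - time_kernel n t2 t"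
proof -
  have *: "((\<lambda>t. smooth_step (n * (t - \<tau>))) has_real_derivative time_kernel n \<tau> t) (at t)" for \<tau>
  proof -
    have "((\<lambda>t. n * (t - \<tau>)) has_real_derivative n) (at t)" by (auto intro!: derivative_eq_intros)
    from DERIV_chain2[OF step_deriv_derivative this] show ?thesis
      by (simp add: time_kernel_def mult.commute)
  qed
  have "(time_cutoff n t1 t2 has_real_derivative time_kernel n t1 t - time_kernel n t2 t) (at t)"
    unfolding time_cutoff_def[abs_def] by (rule DERIV_diff[OF * *])
  then show ?thesis
    by (rule DERIV_unique[OF smooth_fun_real_derivative[OF time_cutoff_smooth]])
qed

lemma time_kernel_nonneg: "0 \<le> n \<Longrightarrow> 0 \<le> time_kernel n \<tau> t"
  by (simp add: time_kernel_def step_deriv_nonneg)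

lemma time_kernel_continuous: "continuous_on S (time_kernel n \<tau>)"
  unfolding time_kernel_def[abs_def]
  by (intro continuous_intros continuous_on_compose2[OF smooth_fun_continuous[OF step_deriv_smooth, of UNIV]]) auto

lemma time_kernel_support:
  assumes "0 < n" "time_kernel n \<tau> t \<noteq> 0"
  shows "t \<in> {\<tau>..\<tau> + 1 / n}"
proof -
  have "\<not> (n * (t - \<tau>) < 1 / 2 \<or> 1 < n * (t - \<tau>))"
    using assms(2) step_deriv_eq_0[of "n * (t - \<tau>)"] by (auto simp: time_kernel_def)
  then have "1 / 2 \<le> n * (t - \<tau>)" "n * (t - \<tau>) \<le> 1" by auto
  then have "0 < n * (t - \<tau>)" "t - \<tau> \<le> 1 / n"
    using assms(1) by (linarith, simp add: pos_le_divide_eq mult.commute)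
  then show ?thesis using assms(1) by (auto simp: zero_less_mult_iff)
qed

lemma time_cutoff_bounds:
  assumes "0 < n" "t1 \<le> t2"
  shows "0 \<le> time_cutoff n t1 t2 t" "time_cutoff n t1 t2 t \<le> 1"
  using monoD[OF smooth_step_mono, of "n * (t - t2)" "n * (t - t1)"] assms
    smooth_step_bounds[of "n * (t - t1)"] smooth_step_bounds[of "n * (t - t2)"]
  by (auto simp: time_cutoff_def mult_left_mono)

lemma time_cutoff_support:
  assumes "0 < n" "t1 \<le> t2" "time_cutoff n t1 t2 t \<noteq> 0"
  shows "t \<in> {t1..t2 + 1 / n}"
proof -
  have le: "n * (t - t2) \<le> n * (t - t1)" using assms(1,2) by (intro mult_left_mono) auto
  have "\<not> n * (t - t1) \<le> 1 / 2"
  proof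
    assume "n * (t - t1) \<le> 1 / 2"
    then show False using assms(3) le smooth_step_eq_0[of "n * (t - t1)"] smooth_step_eq_0[of "n * (t - t2)"]
      by (simp add: time_cutoff_def)
  qed
  moreover have "\<not> 1 \<le> n * (t - t2)"
  proof
    assume "1 \<le> n * (t - t2)"
    then show False using assms(3) le smooth_step_eq_1[of "n * (t - t1)"] smooth_step_eq_1[of "n * (t - t2)"]
      by (simp add: time_cutoff_def)
  qed
  ultimately have "0 < n * (t - t1)" "t - t2 \<le> 1 / n"
    using assms(1) by (linarith, simp add: pos_le_divide_eq mult.commute)
  then show ?thesis using assms(1) by (auto simp: zero_less_mult_iff)
qed

lemma smooth_step_tendsto:
  assumes n: "filterlim n at_top sequentially"
  shows "(\<lambda>k. smooth_step (n k * (t - \<tau>))) \<longlonglongrightarrow> (if \<tau> < t then 1 else 0)"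
proof (rule tendsto_eventually)
  show "\<forall>\<^sub>F k in sequentially. smooth_step (n k * (t - \<tau>)) = (if \<tau> < t then 1 else 0)"
    using filterlim_at_top_dense[THEN iffD1, OF n, rule_format, of 0]
      filterlim_at_top_dense[THEN iffD1, OF n, rule_format, of "1 / (t - \<tau>)"]
  proof eventually_elim
    case (elim k)
    show ?case
    proof (cases "\<tau> < t")
      case True
      then have "1 \<le> n k * (t - \<tau>)" using elim by (simp add: field_simps)
      then show ?thesis using True by (simp add: smooth_step_eq_1)
    next
      case False
      then have "n k * (t - \<tau>) \<le> 0" using elim by (simp add: mult_le_0_iff)
      then show ?thesis using False by (simp add: smooth_step_eq_0)
    qed
  qed
qed

lemma time_cutoff_tendsto:
  assumes n: "filterlim n at_top sequentially" and "t1 \<le> t2"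
  shows "(\<lambda>k. time_cutoff (n k) t1 t2 t) \<longlonglongrightarrow> indicator {t1<..t2} t"
proof -
  have "(if t1 < t then 1 else 0) - (if t2 < t then 1 else 0) = (indicator {t1<..t2} t :: real)"
    using assms(2) by (auto simp: indicator_def)
  then show ?thesis
    unfolding time_cutoff_def
    using tendsto_diff[OF smooth_step_tendsto[OF n, of t t1] smooth_step_tendsto[OF n, of t t2]] by simp
qed

lemma integral_step_deriv: "(\<integral>r. step_deriv r \<partial>lborel) = 1"
proof -
  have "(\<integral>r. indicator {0..2} r *\<^sub>R step_deriv r \<partial>lborel) = smooth_step 2 - smooth_step 0"
    by (rule integral_FTC_atLeastAtMost)
      (auto intro!: smooth_fun_continuous step_deriv_smooth has_field_derivative_at_within step_deriv_derivative
        simp: has_real_derivative_iff_has_vector_derivative[symmetric])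
  moreover have "(\<lambda>r. indicator {0..2} r *\<^sub>R step_deriv r) = step_deriv"
  proof
    fix r show "indicator {0..2} r *\<^sub>R step_deriv r = step_deriv r"
      using step_deriv_eq_0[of r] by (cases "r \<in> {0..2}") auto
  qed
  ultimately show ?thesis by (simp add: smooth_step_eq_0 smooth_step_eq_1)
qed

text \<open>The substitution t = \<tau> + r/n turns the kernel into the fixed density
  \<open>step_deriv\<close> of total mass 1 supported in [1/2, 1]. Only values of X within 1/N to
  the right of \<tau> enter, so continuity on that interval yields both the limit and the dominating
  constant.\<close>

lemma time_kernel_tendsto:
  fixes X :: "real \<Rightarrow> real"
  assumes n: "filterlim n at_top sequentially" "\<And>k. 0 < n k" "\<And>k. N \<le> n k" and N: "0 < N"
    and X: "X \<in> borel_measurable borel" "continuous_on {\<tau>..\<tau> + 1 / N} X"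
  shows "(\<lambda>k. \<integral>t. X t * time_kernel (n k) \<tau> t \<partial>lborel) \<longlonglongrightarrow> X \<tau>"
proof -
  have sub: "(\<integral>t. X t * time_kernel (n k) \<tau> t \<partial>lborel) = (\<integral>r. X (\<tau> + r / n k) * step_deriv r \<partial>lborel)" for k
  proof -
    have "(\<integral>t. X t * time_kernel (n k) \<tau> t \<partial>lborel) =
        (1 / n k) * (\<integral>r. X (\<tau> + r / n k) * (n k * step_deriv r) \<partial>lborel)"
      using lborel_integral_real_affine[of "1 / n k" "\<lambda>t. X t * time_kernel (n k) \<tau> t" \<tau>] n(2)[of k]
      by (simp add: time_kernel_def)
    also have "(\<integral>r. X (\<tau> + r / n k) * (n k * step_deriv r) \<partial>lborel) =
        n k * (\<integral>r. X (\<tau> + r / n k) * step_deriv r \<partial>lborel)"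
      unfolding integral_mult_right_zero[symmetric] by (simp add: mult.left_commute)
    finally show ?thesis using n(2)[of k] by simp
  qed
  have "compact (X ` {\<tau>..\<tau> + 1 / N})" by (rule compact_continuous_image[OF X(2) compact_Icc])
  then obtain B where B: "0 < B" "\<And>y. y \<in> X ` {\<tau>..\<tau> + 1 / N} \<Longrightarrow> \<bar>y\<bar> \<le> B"
    using bounded_pos[of "X ` {\<tau>..\<tau> + 1 / N}"] compact_imp_bounded[of "X ` {\<tau>..\<tau> + 1 / N}"] by auto
  have inI: "\<tau> + r / n k \<in> {\<tau>..\<tau> + 1 / N}" if "step_deriv r \<noteq> 0" for r k
  proof -
    have "0 \<le> r \<and> r \<le> 1" using that step_deriv_eq_0[of r] by (cases "r < 1 / 2 \<or> 1 < r") auto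
    then have "0 \<le> r" "r \<le> 1" by auto
    then have "r / n k \<le> 1 / N" using n(3)[of k] N by (intro frac_le) auto
    then show ?thesis using \<open>0 \<le> r\<close> n(2)[of k] by auto
  qed
  have sm: "step_deriv \<in> borel_measurable borel" by (rule test_fun_measurable[OF step_deriv_test])
  have "integrable lborel step_deriv"
    using integral_step_deriv not_integrable_integral_eq[of lborel step_deriv]
    by (cases "integrable lborel step_deriv") auto
  then have isd: "integrable lborel (\<lambda>r. B * step_deriv r)" by simp
  have "(\<lambda>k. \<integral>r. X (\<tau> + r / n k) * step_deriv r \<partial>lborel) \<longlonglongrightarrow> (\<integral>r. X \<tau> * step_deriv r \<partial>lborel)"
  proof (rule integral_dominated_convergence[OF _ _ isd])
    show "(\<lambda>r. X (\<tau> + r / n k) * step_deriv r) \<in> borel_measurable lborel" for k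
      using X(1) sm by measurable
    show "(\<lambda>r. X \<tau> * step_deriv r) \<in> borel_measurable lborel" using sm by measurable
    show "AE r in lborel. norm (X (\<tau> + r / n k) * step_deriv r) \<le> B * step_deriv r" for k
    proof (rule AE_I2)
      fix r :: real
      show "norm (X (\<tau> + r / n k) * step_deriv r) \<le> B * step_deriv r"
      proof (cases "step_deriv r = 0")
        case False
        then have "\<bar>X (\<tau> + r / n k)\<bar> \<le> B" using B(2) inI by blast
        then show ?thesis using step_deriv_nonneg[of r] by (simp add: abs_mult mult_right_mono)
      qed simp
    qed
    show "AE r in lborel. (\<lambda>k. X (\<tau> + r / n k) * step_deriv r) \<longlonglongrightarrow> X \<tau> * step_deriv r"
    proof (rule AE_I2)
      fix r :: real
      show "(\<lambda>k. X (\<tau> + r / n k) * step_deriv r) \<longlonglongrightarrow> X \<tau> * step_deriv r"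
      proof (cases "step_deriv r = 0")
        case False
        have "(\<lambda>k. r / n k) \<longlonglongrightarrow> 0" by (rule tendsto_divide_0[OF tendsto_const filterlim_at_top_imp_at_infinity[OF n(1)]])
        then have "(\<lambda>k. \<tau> + r / n k) \<longlonglongrightarrow> \<tau> + 0" by (intro tendsto_intros)
        then have "(\<lambda>k. X (\<tau> + r / n k)) \<longlonglongrightarrow> X \<tau>"
          using N inI[OF False] by (intro continuous_on_tendsto_compose[OF X(2)]) auto
        then show ?thesis by (intro tendsto_intros)
      qed simp
    qed
  qed
  then show ?thesis by (simp add: sub integral_step_deriv)
qed

section \<open>Weak solutions\<close>

definition lap :: "('a::euclidean_space \<Rightarrow> real) \<Rightarrow> 'a \<Rightarrow> real" where
  "lap \<phi> x = (\<Sum>b\<in>Basis. dirderiv b (dirderiv b \<phi>) x)"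

lemma lap_test_fun: "test_fun U \<phi> \<Longrightarrow> test_fun U (lap \<phi>)"
  unfolding lap_def[abs_def] by (intro test_fun_sum test_fun_dirderiv)

lemma dirderiv_zero: "smooth_fun f \<Longrightarrow> dirderiv 0 f x = 0"
  using linear_0[OF has_derivative_linear[OF differentiable_has_derivative_dirderiv[OF smooth_fun_differentiable]]]
  by blast

lemma smooth_fun_fst: "smooth_fun \<phi> \<Longrightarrow> smooth_fun (\<lambda>p::'a::euclidean_space \<times> real. \<phi> (fst p))"
  and dirderiv_fst: "smooth_fun \<phi> \<Longrightarrow> dirderiv v (\<lambda>p::'a \<times> real. \<phi> (fst p)) = (\<lambda>p. dirderiv (fst v) \<phi> (fst p))"
  using smooth_fun_compose_affine(1)[of \<phi> fst 0] smooth_fun_compose_affine(2)[where f=\<phi> and L=fst and v=v and a=0]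
    bounded_linear_fst by auto

lemma smooth_fun_snd: "smooth_fun \<eta> \<Longrightarrow> smooth_fun (\<lambda>p::'a::euclidean_space \<times> real. \<eta> (snd p))"
  and dirderiv_snd: "smooth_fun \<eta> \<Longrightarrow> dirderiv v (\<lambda>p::'a \<times> real. \<eta> (snd p)) = (\<lambda>p. dirderiv (snd v) \<eta> (snd p))"
  using smooth_fun_compose_affine(1)[of \<eta> snd 0] smooth_fun_compose_affine(2)[where f=\<eta> and L=snd and v=v and a=0]
    bounded_linear_snd by auto

lemma dirderiv_product:
  assumes "smooth_fun f" "smooth_fun g"
  shows "dirderiv v (\<lambda>x. f x * g x) p = f p * dirderiv v g p + dirderiv v f p * g p"
  by (subst dirderiv_mult) (auto intro: smooth_fun_differentiable assms)

context
  fixes \<phi> :: "'a::euclidean_space \<Rightarrow> real" and \<eta> :: "real \<Rightarrow> real"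
  assumes \<phi>: "smooth_fun \<phi>" and \<eta>: "smooth_fun \<eta>"
begin

lemma smooth_separated: "smooth_fun (\<lambda>p. \<phi> (fst p) * \<eta> (snd p))"
  by (rule smooth_intros(4)[OF smooth_fun_fst[OF \<phi>] smooth_fun_snd[OF \<eta>]])

lemma dt_separated: "dt (\<lambda>p. \<phi> (fst p) * \<eta> (snd p)) p = \<phi> (fst p) * dirderiv 1 \<eta> (snd p)"
  unfolding dt_def
  by (simp add: dirderiv_product smooth_fun_fst smooth_fun_snd dirderiv_fst dirderiv_snd \<phi> \<eta> dirderiv_zero)

lemma dxi_separated: "dxi b (\<lambda>p. \<phi> (fst p) * \<eta> (snd p)) = (\<lambda>p. dirderiv b \<phi> (fst p) * \<eta> (snd p))"
  unfolding dxi_def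
  by (rule ext) (simp add: dirderiv_product smooth_fun_fst smooth_fun_snd dirderiv_fst dirderiv_snd \<phi> \<eta> dirderiv_zero)

end

lemma lapx_separated:
  assumes \<phi>: "smooth_fun \<phi>" and \<eta>: "smooth_fun \<eta>"
  shows "lapx (\<lambda>p. \<phi> (fst p) * \<eta> (snd p)) p = lap \<phi> (fst p) * \<eta> (snd p)"
  unfolding lapx_def lap_def dxi_separated[OF \<phi> \<eta>] dxi_separated[OF smooth_fun_dirderiv[OF \<phi>] \<eta>]
  by (simp add: sum_distrib_right)

lemma separated_test_fun:
  assumes \<phi>: "test_fun \<Omega> \<phi>" and \<eta>: "smooth_fun \<eta>"
    and S: "{a..b} \<subseteq> tint T" "\<And>t. \<eta> t \<noteq> 0 \<Longrightarrow> t \<in> {a..b}"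
  shows "test_fun (cyl \<Omega> T) (\<lambda>p. \<phi> (fst p) * \<eta> (snd p))"
proof -
  let ?C = "tsupport \<phi> \<times> {a..b}"
  let ?z = "\<lambda>p. \<phi> (fst p) * \<eta> (snd p)"
  have C: "compact ?C" "?C \<subseteq> cyl \<Omega> T"
    using \<phi> S(1) by (auto simp: test_fun_def cyl_def intro!: compact_Times)
  have "tsupport ?z \<subseteq> ?C"
  proof (rule tsupport_minimal[OF compact_imp_closed[OF C(1)]])
    show "p \<in> ?C" if "?z p \<noteq> 0" for p
      using that S(2)[of "snd p"] in_tsupport[of \<phi> "fst p"] by (cases p) auto
  qed
  then show ?thesis
    using C compact_Int_closed[OF C(1) closed_tsupport[of ?z]]
      smooth_separated[OF test_fun_smooth[OF \<phi>] \<eta>]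
    by (auto simp: test_fun_def Int_absorb1)
qed

lemma set_integral_eq_integral:
  fixes F :: "'a \<Rightarrow> real"
  assumes "\<And>p. p \<notin> S \<Longrightarrow> F p = 0"
  shows "(LINT p:S|M. F p) = (LINT p|M. F p)"
  unfolding set_lebesgue_integral_def
  by (rule Bochner_Integration.integral_cong[OF refl]) (use assms in \<open>auto simp: indicator_def\<close>)

lemma abs_integral_mult_le:
  fixes F w m :: "'a \<Rightarrow> real"
  assumes i: "integrable M (\<lambda>p. F p * w p)" and B: "\<And>p. \<bar>m p\<bar> \<le> B"
  shows "\<bar>\<integral>p. F p * (w p * m p) \<partial>M\<bar> \<le> B * (\<integral>p. \<bar>F p\<bar> * \<bar>w p\<bar> \<partial>M)"
proof -
  have "\<bar>\<integral>p. F p * (w p * m p) \<partial>M\<bar> \<le> (\<integral>p. \<bar>F p * (w p * m p)\<bar> \<partial>M)" by (rule integral_abs_bound)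
  also have "\<dots> \<le> (\<integral>p. B * (\<bar>F p\<bar> * \<bar>w p\<bar>) \<partial>M)"
  proof (rule integral_mono')
    show "integrable M (\<lambda>p. B * (\<bar>F p\<bar> * \<bar>w p\<bar>))"
      using integrable_abs[OF i] by (simp add: abs_mult)
    have B0: "0 \<le> B" using B[of undefined] by linarith
    show "0 \<le> B * (\<bar>F p\<bar> * \<bar>w p\<bar>)" for p using B0 by simp
    show "\<bar>F p * (w p * m p)\<bar> \<le> B * (\<bar>F p\<bar> * \<bar>w p\<bar>)" for p
      using mult_left_mono[OF B[of p], of "\<bar>F p\<bar> * \<bar>w p\<bar>"] by (simp add: abs_mult mult_ac)
  qed
  finally show ?thesis by simp
qed

text \<open>A nonnegative weak solution together with one chosen weak gradient, so that all later
  estimates speak of the same g.\<close>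

locale hj_solution =
  fixes q :: real and \<Omega> :: "'a::euclidean_space set" and T :: ereal
    and u :: "'a \<Rightarrow> real \<Rightarrow> real" and g :: "'a \<Rightarrow> real \<Rightarrow> 'a"
  assumes q: "0 < q" "q \<le> 1" and open_domain: "open \<Omega>" and T_pos: "0 < T"
    and slice_integrable: "\<And>K t. compact K \<Longrightarrow> K \<subseteq> \<Omega> \<Longrightarrow> t \<in> tint T \<Longrightarrow> set_integrable lebesgue K (\<lambda>x. u x t)"
    and slice_continuous: "\<And>K t. compact K \<Longrightarrow> K \<subseteq> \<Omega> \<Longrightarrow> t \<in> tint T \<Longrightarrow>
      ((\<lambda>s. LINT x:K|lebesgue. \<bar>u x s - u x t\<bar>) \<longlongrightarrow> 0) (at t within tint T)"
    and local_u: "\<And>C. compact C \<Longrightarrow> C \<subseteq> cyl \<Omega> T \<Longrightarrow> set_integrable lebesgue C (\<lambda>p. u (fst p) (snd p))"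
    and local_g: "\<And>C. compact C \<Longrightarrow> C \<subseteq> cyl \<Omega> T \<Longrightarrow> set_integrable lebesgue C (\<lambda>p. g (fst p) (snd p))"
    and local_f: "\<And>C. compact C \<Longrightarrow> C \<subseteq> cyl \<Omega> T \<Longrightarrow> set_integrable lebesgue C (\<lambda>p. norm (g (fst p) (snd p)) powr q)"
    and gradient: "\<And>\<phi> b. test_fun (cyl \<Omega> T) \<phi> \<Longrightarrow> b \<in> Basis \<Longrightarrow>
      (LINT p:cyl \<Omega> T|lebesgue. u (fst p) (snd p) * dxi b \<phi> p)
        = - (LINT p:cyl \<Omega> T|lebesgue. (g (fst p) (snd p) \<bullet> b) * \<phi> p)"
    and equation: "\<And>\<phi>. test_fun (cyl \<Omega> T) \<phi> \<Longrightarrow>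
      (LINT p:cyl \<Omega> T|lebesgue. - u (fst p) (snd p) * dt \<phi> p - u (fst p) (snd p) * lapx \<phi> p
                 + norm (g (fst p) (snd p)) powr q * \<phi> p) = 0"
    and u_nonneg: "\<And>t. t \<in> tint T \<Longrightarrow> AE x in lebesgue. x \<in> \<Omega> \<longrightarrow> 0 \<le> u x t"
begin

definition uu :: "'a \<times> real \<Rightarrow> real" where "uu p = u (fst p) (snd p)"
definition gi :: "'a \<Rightarrow> 'a \<times> real \<Rightarrow> real" where "gi b p = g (fst p) (snd p) \<bullet> b"
definition ff :: "'a \<times> real \<Rightarrow> real" where "ff p = norm (g (fst p) (snd p)) powr q"

definition loc_int :: "('a \<times> real \<Rightarrow> real) \<Rightarrow> bool" where
  "loc_int F \<longleftrightarrow> (\<forall>C. compact C \<longrightarrow> C \<subseteq> cyl \<Omega> T \<longrightarrow> set_integrable lebesgue C F)"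

lemma loc_int_uu: "loc_int uu" and loc_int_ff: "loc_int ff" and loc_int_gi: "loc_int (gi b)"
  using local_u local_f local_g integrable_inner_left[of b lebesgue]
  unfolding loc_int_def uu_def[abs_def] ff_def[abs_def] gi_def[abs_def] set_integrable_def
  by (auto simp: inner_scaleR_left[symmetric] simp del: inner_scaleR_left)

lemma loc_int_abs: "loc_int F \<Longrightarrow> loc_int (\<lambda>p. \<bar>F p\<bar>)"
  unfolding loc_int_def by (auto intro: set_integrable_abs)

lemma loc_int_mult:
  assumes "loc_int F" "w \<in> borel_measurable lebesgue" "\<And>p. \<bar>w p\<bar> \<le> B"
    "compact C" "C \<subseteq> cyl \<Omega> T" "\<And>p. p \<notin> C \<Longrightarrow> w p = 0"
  shows "integrable lebesgue (\<lambda>p. F p * w p)"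
  by (rule integrable_mult_bounded_support[OF _ assms(2,3,6)]) (use assms in \<open>auto simp: loc_int_def\<close>)

lemma loc_int_test:
  assumes F: "loc_int F" and w: "test_fun (cyl \<Omega> T) w"
  shows "integrable lebesgue (\<lambda>p. F p * w p)"
proof -
  obtain B where B: "\<And>p. \<bar>w p\<bar> \<le> B" by (rule test_fun_bounded[OF w]) blast
  show ?thesis
    by (rule loc_int_mult[OF F _ B, where C="tsupport w"])
      (use w not_in_tsupport[of _ w] continuous_borel_measurable_lebesgue[OF smooth_fun_continuous[OF test_fun_smooth[OF w]]]
        in \<open>auto simp: test_fun_def\<close>)
qed

lemma loc_int_abs_test:
  assumes F: "loc_int F" and w: "test_fun (cyl \<Omega> T) w"
  shows "integrable lebesgue (\<lambda>p. \<bar>F p\<bar> * \<bar>w p\<bar>)"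
  using integrable_abs[OF loc_int_test[OF F w]] by (simp add: abs_mult)

lemma test_fun_outside: "test_fun (cyl \<Omega> T) w \<Longrightarrow> p \<notin> cyl \<Omega> T \<Longrightarrow> w p = 0"
  using not_in_tsupport[of p w] by (auto simp: test_fun_def)

lemma gradient_identity:
  assumes w: "test_fun (cyl \<Omega> T) w" and b: "b \<in> Basis"
  shows "(\<integral>p. uu p * dxi b w p \<partial>lebesgue) = - (\<integral>p. gi b p * w p \<partial>lebesgue)"
proof -
  have "test_fun (cyl \<Omega> T) (dxi b w)" unfolding dxi_def by (rule test_fun_dirderiv[OF w])
  then show ?thesis
    using gradient[OF w b] test_fun_outside[OF w] test_fun_outside[of "dxi b w"]
    unfolding uu_def gi_def by (simp add: set_integral_eq_integral)
qed

lemma test_fun_dt: "test_fun U w \<Longrightarrow> test_fun U (dt w)"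
  unfolding dt_def by (rule test_fun_dirderiv)

lemma test_fun_dxi: "test_fun U w \<Longrightarrow> test_fun U (dxi b w)"
  unfolding dxi_def by (rule test_fun_dirderiv)

lemma test_fun_lapx: "test_fun U w \<Longrightarrow> test_fun U (lapx w)"
  unfolding lapx_def[abs_def] by (intro test_fun_sum test_fun_dxi)

lemma equation_identity:
  assumes w: "test_fun (cyl \<Omega> T) w"
  shows "(\<integral>p. uu p * dt w p \<partial>lebesgue) + (\<integral>p. uu p * lapx w p \<partial>lebesgue) = (\<integral>p. ff p * w p \<partial>lebesgue)"
proof -
  have z: "w p = 0" "dt w p = 0" "lapx w p = 0" if "p \<notin> cyl \<Omega> T" for p
    using that test_fun_outside[OF w] test_fun_outside[OF test_fun_dt[OF w]]
      test_fun_outside[OF test_fun_lapx[OF w]] by auto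
  have "(\<integral>p. - uu p * dt w p - uu p * lapx w p + ff p * w p \<partial>lebesgue) = 0"
    using equation[OF w] unfolding uu_def ff_def
    by (subst (asm) set_integral_eq_integral) (auto simp: z)
  then show ?thesis
    using loc_int_test[OF loc_int_uu test_fun_dt[OF w]] loc_int_test[OF loc_int_uu test_fun_lapx[OF w]]
      loc_int_test[OF loc_int_ff w] by simp
qed

text \<open>\<open>gi b\<close> times \<zeta> is tested against \<theta> with |\<theta>| \<le> 1,
  and the derivative of \<theta> is replaced by V minus the backward heat operator applied to W. The
  part with V costs 1/\<rho>. The part with W is the equation tested with \<zeta> W, of size \<rho>,
  plus commutators with \<zeta>. The result is linear in u, its gradient and f.\<close>

lemma gradient_estimate:
  "\<exists>c>0. \<forall>b\<in>Basis. \<forall>\<zeta> \<rho>. test_fun (cyl \<Omega> T) \<zeta> \<longrightarrow> 0 < \<rho> \<longrightarrow>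
    (\<integral>p. \<bar>gi b p\<bar> * \<bar>\<zeta> p\<bar> \<partial>lebesgue) \<le>
      (\<integral>p. \<bar>uu p\<bar> * \<bar>dxi b \<zeta> p\<bar> \<partial>lebesgue) + c / \<rho> * (\<integral>p. \<bar>uu p\<bar> * \<bar>\<zeta> p\<bar> \<partial>lebesgue)
      + c * \<rho> * ((\<integral>p. \<bar>ff p\<bar> * \<bar>\<zeta> p\<bar> \<partial>lebesgue) + (\<integral>p. \<bar>uu p\<bar> * \<bar>dt \<zeta> p\<bar> \<partial>lebesgue)
        + (\<integral>p. \<bar>uu p\<bar> * \<bar>lapx \<zeta> p\<bar> \<partial>lebesgue)
        + 2 * (\<Sum>a\<in>Basis. \<integral>p. \<bar>gi a p\<bar> * \<bar>dxi a \<zeta> p\<bar> \<partial>lebesgue))"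
proof -
  obtain c where c: "0 < c" and par: "\<And>b \<theta> \<rho>. b \<in> (Basis::'a set) \<Longrightarrow> test_fun UNIV \<theta> \<Longrightarrow> (\<forall>p. \<bar>\<theta> p\<bar> \<le> 1) \<Longrightarrow> 0 < \<rho> \<Longrightarrow>
    (\<exists>W V. smooth_fun W \<and> smooth_fun V \<and> (\<forall>p. \<bar>W p\<bar> \<le> c * \<rho>) \<and> (\<forall>p. \<bar>V p\<bar> \<le> c / \<rho>) \<and>
      (\<forall>p. dt W p + lapx W p = V p - dxi b \<theta> p))"
    using heat_parametrix[where 'a='a] by metis
  have "(\<integral>p. \<bar>gi b p\<bar> * \<bar>\<zeta> p\<bar> \<partial>lebesgue) \<le>
      (\<integral>p. \<bar>uu p\<bar> * \<bar>dxi b \<zeta> p\<bar> \<partial>lebesgue) + c / \<rho> * (\<integral>p. \<bar>uu p\<bar> * \<bar>\<zeta> p\<bar> \<partial>lebesgue)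
      + c * \<rho> * ((\<integral>p. \<bar>ff p\<bar> * \<bar>\<zeta> p\<bar> \<partial>lebesgue) + (\<integral>p. \<bar>uu p\<bar> * \<bar>dt \<zeta> p\<bar> \<partial>lebesgue)
        + (\<integral>p. \<bar>uu p\<bar> * \<bar>lapx \<zeta> p\<bar> \<partial>lebesgue)
        + 2 * (\<Sum>a\<in>Basis. \<integral>p. \<bar>gi a p\<bar> * \<bar>dxi a \<zeta> p\<bar> \<partial>lebesgue))" (is "_ \<le> ?R")
    if b: "b \<in> Basis" and \<zeta>: "test_fun (cyl \<Omega> T) \<zeta>" and \<rho>: "0 < \<rho>" for b \<zeta> \<rho>
  proof -
    have "(\<integral>p. \<bar>gi b p * \<zeta> p\<bar> \<partial>lebesgue) \<le> ?R"
    proof (rule abs_integral_le_test[OF loc_int_test[OF loc_int_gi \<zeta>]])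
      fix \<theta> :: "'a \<times> real \<Rightarrow> real" assume \<theta>: "test_fun UNIV \<theta>" and \<theta>1: "\<And>p. \<bar>\<theta> p\<bar> \<le> 1"
      obtain W V where W: "smooth_fun W" and V: "smooth_fun V" and Wb: "\<And>p. \<bar>W p\<bar> \<le> c * \<rho>"
        and Vb: "\<And>p. \<bar>V p\<bar> \<le> c / \<rho>" and WV: "\<And>p. dt W p + lapx W p = V p - dxi b \<theta> p"
        using par[OF b \<theta> _ \<rho>] \<theta>1 by blast
      note sz = test_fun_smooth[OF \<zeta>] and st = test_fun_smooth[OF \<theta>]
      have tm: "test_fun (cyl \<Omega> T) (\<lambda>p. w p * k p)" if "test_fun (cyl \<Omega> T) w" "smooth_fun k" for w k
        by (rule test_fun_mult[OF that])
      have iu: "integrable lebesgue (\<lambda>p. uu p * w p)" if "test_fun (cyl \<Omega> T) w" for w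
        by (rule loc_int_test[OF loc_int_uu that])
      have dW: "smooth_fun (dxi a W)" for a unfolding dxi_def by (rule smooth_fun_dirderiv[OF W])
      have dt_prod: "dt (\<lambda>p. \<zeta> p * W p) p = \<zeta> p * dt W p + dt \<zeta> p * W p" for p
        unfolding dt_def by (rule dirderiv_product[OF sz W])
      have dxi_prod: "dxi a (\<lambda>p. w p * k p) p = w p * dxi a k p + dxi a w p * k p"
        if "smooth_fun w" "smooth_fun k" for w k a p
        unfolding dxi_def by (rule dirderiv_product[OF that])
      have lapx_prod: "lapx (\<lambda>p. \<zeta> p * W p) p = \<zeta> p * lapx W p +
          2 * (\<Sum>a\<in>Basis. dxi a \<zeta> p * dxi a W p) + lapx \<zeta> p * W p" for p
      proof -
        have "dxi a (dxi a (\<lambda>p. \<zeta> p * W p)) p = \<zeta> p * dxi a (dxi a W) p +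
            2 * (dxi a \<zeta> p * dxi a W p) + dxi a (dxi a \<zeta>) p * W p" for a
        proof -
          have "dxi a (\<lambda>p. \<zeta> p * W p) = (\<lambda>p. \<zeta> p * dxi a W p + dxi a \<zeta> p * W p)"
            by (rule ext) (rule dxi_prod[OF sz W])
          then have "dxi a (dxi a (\<lambda>p. \<zeta> p * W p)) p =
             dxi a (\<lambda>p. \<zeta> p * dxi a W p) p + dxi a (\<lambda>p. dxi a \<zeta> p * W p) p"
            unfolding dxi_def
            by (simp add: dirderiv_add smooth_fun_differentiable smooth_intros(4) sz W smooth_fun_dirderiv)
          then show ?thesis
            using dxi_prod[OF sz dW] dxi_prod[OF test_fun_smooth[OF test_fun_dxi[OF \<zeta>]] W] by simp
        qed
        then show ?thesis
          unfolding lapx_def by (simp add: sum.distrib sum_distrib_left sum_distrib_right)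
      qed
      \<comment> \<open>The cross term 2 grad \<zeta> . grad W is the only one with a derivative of
        W, for which no bound is available. Integrating by parts once more moves that derivative
        onto u; this brings in \<open>gi a\<close> times \<open>dxi a\<close> \<zeta> and reverses
        the sign of the term with \<open>lapx\<close> \<zeta>.\<close>
      have E4: "(\<integral>p. uu p * dxi a (\<lambda>p. dxi a \<zeta> p * W p) p \<partial>lebesgue) = - (\<integral>p. gi a p * (dxi a \<zeta> p * W p) \<partial>lebesgue)"
        if "a \<in> Basis" for a by (rule gradient_identity[OF tm[OF test_fun_dxi[OF \<zeta>] W] that])
      have pw: "uu p * (\<zeta> p * (dt W p + lapx W p)) = uu p * dt (\<lambda>p. \<zeta> p * W p) p + uu p * lapx (\<lambda>p. \<zeta> p * W p) p
          - uu p * (dt \<zeta> p * W p) + uu p * (lapx \<zeta> p * W p)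
          - 2 * (\<Sum>a\<in>Basis. uu p * dxi a (\<lambda>p. dxi a \<zeta> p * W p) p)" for p
      proof -
        have "(\<Sum>a\<in>Basis. uu p * dxi a (\<lambda>p. dxi a \<zeta> p * W p) p) =
            uu p * (\<Sum>a\<in>Basis. dxi a \<zeta> p * dxi a W p) + uu p * (lapx \<zeta> p * W p)"
          unfolding lapx_def dxi_prod[OF test_fun_smooth[OF test_fun_dxi[OF \<zeta>]] W]
          by (simp add: sum.distrib sum_distrib_left sum_distrib_right distrib_left)
        then show ?thesis unfolding dt_prod lapx_prod by (simp add: algebra_simps)
      qed
      have tz: "test_fun (cyl \<Omega> T) (\<lambda>p. \<zeta> p * W p)" by (rule tm[OF \<zeta> W])
      have i1: "integrable lebesgue (\<lambda>p. uu p * dt (\<lambda>p. \<zeta> p * W p) p)" by (rule iu[OF test_fun_dt[OF tz]])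
      have i2: "integrable lebesgue (\<lambda>p. uu p * lapx (\<lambda>p. \<zeta> p * W p) p)" by (rule iu[OF test_fun_lapx[OF tz]])
      have i3: "integrable lebesgue (\<lambda>p. uu p * (dt \<zeta> p * W p))" by (rule iu[OF tm[OF test_fun_dt[OF \<zeta>] W]])
      have i4: "integrable lebesgue (\<lambda>p. uu p * (lapx \<zeta> p * W p))" by (rule iu[OF tm[OF test_fun_lapx[OF \<zeta>] W]])
      have i5: "integrable lebesgue (\<lambda>p. uu p * dxi a (\<lambda>p. dxi a \<zeta> p * W p) p)" for a
        by (rule iu[OF test_fun_dxi[OF tm[OF test_fun_dxi[OF \<zeta>] W]]])
      have E5: "(\<integral>p. uu p * (\<zeta> p * (dt W p + lapx W p)) \<partial>lebesgue) =
          (\<integral>p. ff p * (\<zeta> p * W p) \<partial>lebesgue) - (\<integral>p. uu p * (dt \<zeta> p * W p) \<partial>lebesgue)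
          + (\<integral>p. uu p * (lapx \<zeta> p * W p) \<partial>lebesgue)
          + 2 * (\<Sum>a\<in>Basis. \<integral>p. gi a p * (dxi a \<zeta> p * W p) \<partial>lebesgue)"
      proof -
        have "(\<integral>p. uu p * (\<zeta> p * (dt W p + lapx W p)) \<partial>lebesgue) =
          (\<integral>p. uu p * dt (\<lambda>p. \<zeta> p * W p) p \<partial>lebesgue) + (\<integral>p. uu p * lapx (\<lambda>p. \<zeta> p * W p) p \<partial>lebesgue)
          - (\<integral>p. uu p * (dt \<zeta> p * W p) \<partial>lebesgue) + (\<integral>p. uu p * (lapx \<zeta> p * W p) \<partial>lebesgue)
          - 2 * (\<Sum>a\<in>Basis. \<integral>p. uu p * dxi a (\<lambda>p. dxi a \<zeta> p * W p) p \<partial>lebesgue)"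
          unfolding pw using i1 i2 i3 i4 i5 by simp
        then show ?thesis
          using equation_identity[OF tz] E4 by (simp add: sum_negf)
      qed
      have i6: "integrable lebesgue (\<lambda>p. uu p * (\<zeta> p * V p))" by (rule iu[OF tm[OF \<zeta> V]])
      have i7: "integrable lebesgue (\<lambda>p. uu p * (dxi b \<zeta> p * \<theta> p))" by (rule iu[OF tm[OF test_fun_dxi[OF \<zeta>] st]])
      have i8: "integrable lebesgue (\<lambda>p. uu p * (\<zeta> p * (dt W p + lapx W p)))"
        unfolding pw using i1 i2 i3 i4 i5 by simp
      have "(\<integral>p. gi b p * \<zeta> p * \<theta> p \<partial>lebesgue) = - (\<integral>p. uu p * dxi b (\<lambda>p. \<zeta> p * \<theta> p) p \<partial>lebesgue)"
        using gradient_identity[OF tm[OF \<zeta> st] b] by (simp add: mult.assoc)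
      also have "(\<lambda>p. uu p * dxi b (\<lambda>p. \<zeta> p * \<theta> p) p) =
          (\<lambda>p. uu p * (\<zeta> p * V p) - uu p * (\<zeta> p * (dt W p + lapx W p)) + uu p * (dxi b \<zeta> p * \<theta> p))"
        unfolding dxi_prod[OF sz st] WV by (rule ext) (simp add: algebra_simps)
      also have "(\<integral>p. uu p * (\<zeta> p * V p) - uu p * (\<zeta> p * (dt W p + lapx W p)) + uu p * (dxi b \<zeta> p * \<theta> p) \<partial>lebesgue) =
          (\<integral>p. uu p * (\<zeta> p * V p) \<partial>lebesgue) - (\<integral>p. uu p * (\<zeta> p * (dt W p + lapx W p)) \<partial>lebesgue)
          + (\<integral>p. uu p * (dxi b \<zeta> p * \<theta> p) \<partial>lebesgue)"
        using i6 i7 i8 by simp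
      finally have main: "(\<integral>p. gi b p * \<zeta> p * \<theta> p \<partial>lebesgue) =
          - (\<integral>p. uu p * (\<zeta> p * V p) \<partial>lebesgue) - (\<integral>p. uu p * (dxi b \<zeta> p * \<theta> p) \<partial>lebesgue)
          + (\<integral>p. ff p * (\<zeta> p * W p) \<partial>lebesgue) - (\<integral>p. uu p * (dt \<zeta> p * W p) \<partial>lebesgue)
          + (\<integral>p. uu p * (lapx \<zeta> p * W p) \<partial>lebesgue)
          + 2 * (\<Sum>a\<in>Basis. \<integral>p. gi a p * (dxi a \<zeta> p * W p) \<partial>lebesgue)"
        unfolding E5 by simp
      have b1: "\<bar>\<integral>p. uu p * (\<zeta> p * V p) \<partial>lebesgue\<bar> \<le> c / \<rho> * (\<integral>p. \<bar>uu p\<bar> * \<bar>\<zeta> p\<bar> \<partial>lebesgue)"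
        by (rule abs_integral_mult_le[OF iu[OF \<zeta>] Vb])
      have b2: "\<bar>\<integral>p. uu p * (dxi b \<zeta> p * \<theta> p) \<partial>lebesgue\<bar> \<le> 1 * (\<integral>p. \<bar>uu p\<bar> * \<bar>dxi b \<zeta> p\<bar> \<partial>lebesgue)"
        by (rule abs_integral_mult_le[OF iu[OF test_fun_dxi[OF \<zeta>]] \<theta>1])
      have b3: "\<bar>\<integral>p. ff p * (\<zeta> p * W p) \<partial>lebesgue\<bar> \<le> c * \<rho> * (\<integral>p. \<bar>ff p\<bar> * \<bar>\<zeta> p\<bar> \<partial>lebesgue)"
        by (rule abs_integral_mult_le[OF loc_int_test[OF loc_int_ff \<zeta>] Wb])
      have b4: "\<bar>\<integral>p. uu p * (dt \<zeta> p * W p) \<partial>lebesgue\<bar> \<le> c * \<rho> * (\<integral>p. \<bar>uu p\<bar> * \<bar>dt \<zeta> p\<bar> \<partial>lebesgue)"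
        by (rule abs_integral_mult_le[OF iu[OF test_fun_dt[OF \<zeta>]] Wb])
      have b5: "\<bar>\<integral>p. uu p * (lapx \<zeta> p * W p) \<partial>lebesgue\<bar> \<le> c * \<rho> * (\<integral>p. \<bar>uu p\<bar> * \<bar>lapx \<zeta> p\<bar> \<partial>lebesgue)"
        by (rule abs_integral_mult_le[OF iu[OF test_fun_lapx[OF \<zeta>]] Wb])
      have "(\<Sum>a\<in>Basis. \<integral>p. gi a p * (dxi a \<zeta> p * W p) \<partial>lebesgue) \<le>
          (\<Sum>a\<in>Basis. c * \<rho> * (\<integral>p. \<bar>gi a p\<bar> * \<bar>dxi a \<zeta> p\<bar> \<partial>lebesgue))"
        by (rule sum_mono, rule order_trans[OF abs_ge_self],
            rule abs_integral_mult_le[OF loc_int_test[OF loc_int_gi test_fun_dxi[OF \<zeta>]] Wb])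
      then have b6: "(\<Sum>a\<in>Basis. \<integral>p. gi a p * (dxi a \<zeta> p * W p) \<partial>lebesgue) \<le>
          c * \<rho> * (\<Sum>a\<in>Basis. \<integral>p. \<bar>gi a p\<bar> * \<bar>dxi a \<zeta> p\<bar> \<partial>lebesgue)"
        by (simp add: sum_distrib_left)
      show "(\<integral>p. gi b p * \<zeta> p * \<theta> p \<partial>lebesgue) \<le> ?R"
        unfolding main distrib_left using b1 b2 b3 b4 b5 b6 by linarith
    qed
    then show ?thesis by (simp add: abs_mult)
  qed
  then show ?thesis using c by blast
qed

end

lemma tint_interval: "0 < t1 \<Longrightarrow> t2 \<in> tint T \<Longrightarrow> {t1..t2} \<subseteq> tint T"
  unfolding tint_def by (auto intro: le_less_trans[of "ereal _" "ereal t2"])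

text \<open>Room of length 1/N after t for the falling edge of a time cutoff; it exists because t is
  strictly below T.\<close>

lemma tint_extend:
  assumes "t \<in> tint T"
  obtains N where "0 < N" "t + 1 / N \<in> tint T"
proof -
  have "ereal t < T" "0 < t" using assms by (auto simp: tint_def)
  then obtain s where s: "ereal t < ereal s" "ereal s < T" using ereal_dense2[of "ereal t" T] by auto
  show ?thesis
    by (rule that[of "1 / (s - t)"]) (use s \<open>0 < t\<close> in \<open>auto simp: tint_def\<close>)
qed

lemma tint_borel: "tint T \<in> sets borel"
proof -
  have "tint T = {0<..} \<inter> ereal -` {..<T}" by (auto simp: tint_def)
  moreover have "open (ereal -` {..<T})" by (intro open_vimage continuous_on_ereal) (auto intro!: continuous_intros)
  ultimately show ?thesis by auto
qed

lemma separated_measurable: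
  fixes \<phi> :: "'a::euclidean_space \<Rightarrow> real" and \<eta> :: "real \<Rightarrow> real"
  assumes "continuous_on UNIV \<phi>" "\<eta> \<in> borel_measurable borel"
  shows "(\<lambda>p. \<phi> (fst p) * \<eta> (snd p)) \<in> borel_measurable lebesgue"
proof (rule measurable_completion)
  have "(\<lambda>p::'a \<times> real. \<phi> (fst p)) \<in> borel_measurable borel"
    by (intro borel_measurable_continuous_onI continuous_on_compose2[OF assms(1)] continuous_intros) auto
  moreover have "(\<lambda>p::'a \<times> real. \<eta> (snd p)) \<in> borel_measurable borel"
    by (rule measurable_compose[OF _ assms(2)]) (intro borel_measurable_continuous_onI continuous_intros)
  ultimately show "(\<lambda>p. \<phi> (fst p) * \<eta> (snd p)) \<in> borel_measurable lborel" by simp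
qed

lemma Cc_fun_abs: "Cc_fun U f \<Longrightarrow> Cc_fun U (\<lambda>x. \<bar>f x\<bar>)"
  by (rule Cc_fun_dominated[of U f]) (auto intro!: continuous_on_rabs Cc_fun_continuous[of U f])

context hj_solution
begin

text \<open>This is X(t) of the overview. The integral runs over the whole space, which is harmless
  for \<phi> supported in \<Omega>.\<close>

definition mass :: "('a \<Rightarrow> real) \<Rightarrow> real \<Rightarrow> real" where
  "mass \<phi> t = (\<integral>x. u x t * \<phi> x \<partial>lebesgue)"

lemma mass_integrable:
  assumes \<phi>: "Cc_fun \<Omega> \<phi>" and t: "t \<in> tint T"
  shows "integrable lebesgue (\<lambda>x. u x t * \<phi> x)"
proof -
  obtain B where B: "\<And>x. \<bar>\<phi> x\<bar> \<le> B" by (rule Cc_fun_bounded[OF \<phi>]) blast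
  show ?thesis
    by (rule integrable_mult_bounded_support[OF slice_integrable[OF _ _ t, of "tsupport \<phi>"] _ B])
      (use \<phi> not_in_tsupport[of _ \<phi>] continuous_borel_measurable_lebesgue[OF Cc_fun_continuous[OF \<phi>]]
        in \<open>auto simp: Cc_fun_def\<close>)
qed

lemma mass_nonneg:
  assumes "Cc_fun \<Omega> \<phi>" "\<And>x. 0 \<le> \<phi> x" "t \<in> tint T"
  shows "0 \<le> mass \<phi> t"
  unfolding mass_def
proof (rule integral_nonneg_AE)
  show "AE x in lebesgue. 0 \<le> u x t * \<phi> x"
    using u_nonneg[OF assms(3)]
  proof eventually_elim
    case (elim x)
    show ?case
    proof (cases "x \<in> \<Omega>")
      case True then show ?thesis using elim assms(2)[of x] by simp
    next
      case False
      then have "\<phi> x = 0" using assms(1) not_in_tsupport[of x \<phi>] by (auto simp: Cc_fun_def)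
      then show ?thesis by simp
    qed
  qed
qed

lemma mass_continuous:
  assumes \<phi>: "Cc_fun \<Omega> \<phi>"
  shows "continuous_on (tint T) (mass \<phi>)"
  unfolding continuous_on_def
proof
  fix t assume t: "t \<in> tint T"
  obtain B where B: "0 < B" "\<And>x. \<bar>\<phi> x\<bar> \<le> B" by (rule Cc_fun_bounded[OF \<phi>]) blast
  let ?K = "tsupport \<phi>"
  have K: "compact ?K" "?K \<subseteq> \<Omega>" using \<phi> by (auto simp: Cc_fun_def)
  have bound: "norm (mass \<phi> s - mass \<phi> t) \<le> (LINT x:?K|lebesgue. \<bar>u x s - u x t\<bar>) * B" if s: "s \<in> tint T" for s
  proof -
    have i: "set_integrable lebesgue ?K (\<lambda>x. \<bar>u x s - u x t\<bar>)"
      by (intro set_integrable_abs set_integral_diff slice_integrable K s t)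
    have "mass \<phi> s - mass \<phi> t = (\<integral>x. u x s * \<phi> x - u x t * \<phi> x \<partial>lebesgue)"
      unfolding mass_def using mass_integrable[OF \<phi> s] mass_integrable[OF \<phi> t] by simp
    also have "norm \<dots> \<le> (\<integral>x. norm (u x s * \<phi> x - u x t * \<phi> x) \<partial>lebesgue)" by (rule integral_norm_bound)
    also have "\<dots> \<le> (\<integral>x. (indicator ?K x *\<^sub>R \<bar>u x s - u x t\<bar>) * B \<partial>lebesgue)"
    proof (rule integral_mono')
      show "integrable lebesgue (\<lambda>x. (indicator ?K x *\<^sub>R \<bar>u x s - u x t\<bar>) * B)"
        using i unfolding set_integrable_def by simp
      show "0 \<le> (indicator ?K x *\<^sub>R \<bar>u x s - u x t\<bar>) * B" for x using B(1) by simp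
      show "norm (u x s * \<phi> x - u x t * \<phi> x) \<le> (indicator ?K x *\<^sub>R \<bar>u x s - u x t\<bar>) * B" for x
      proof (cases "x \<in> ?K")
        case True
        have "\<bar>u x s - u x t\<bar> * \<bar>\<phi> x\<bar> \<le> \<bar>u x s - u x t\<bar> * B" by (intro mult_left_mono B) simp
        then show ?thesis using True by (simp add: left_diff_distrib[symmetric] abs_mult)
      next
        case False then show ?thesis using not_in_tsupport[of x \<phi>] by simp
      qed
    qed
    finally show ?thesis by (simp add: set_lebesgue_integral_def)
  qed
  have "((\<lambda>s. mass \<phi> s - mass \<phi> t) \<longlongrightarrow> 0) (at t within tint T)"
  proof (rule Lim_null_comparison)
    show "\<forall>\<^sub>F s in at t within tint T. norm (mass \<phi> s - mass \<phi> t) \<le> (LINT x:?K|lebesgue. \<bar>u x s - u x t\<bar>) * B"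
      unfolding eventually_at_topological using bound by (auto intro!: exI[of _ UNIV])
    show "((\<lambda>s. (LINT x:?K|lebesgue. \<bar>u x s - u x t\<bar>) * B) \<longlongrightarrow> 0) (at t within tint T)"
      using tendsto_mult_left_zero[OF slice_continuous[OF K t]] .
  qed
  then show "(mass \<phi> \<longlongrightarrow> mass \<phi> t) (at t within tint T)" by (rule LIM_zero_cancel)
qed

text \<open>Extension by zero to all times, which makes the mass a Borel function on the line as the
  Fubini lemma demands.\<close>

definition massi :: "('a \<Rightarrow> real) \<Rightarrow> real \<Rightarrow> real" where
  "massi \<phi> t = indicator (tint T) t * mass \<phi> t"

lemma massi_measurable: "Cc_fun \<Omega> \<phi> \<Longrightarrow> massi \<phi> \<in> borel_measurable borel"
  using borel_measurable_continuous_on_indicator[OF tint_borel mass_continuous]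
  by (simp add: massi_def[abs_def])

lemma massi_continuous:
  assumes "Cc_fun \<Omega> \<phi>" "S \<subseteq> tint T"
  shows "continuous_on S (massi \<phi>)"
  by (rule continuous_on_eq[OF continuous_on_subset[OF mass_continuous[OF assms(1)] assms(2)]])
    (use assms(2) in \<open>auto simp: massi_def\<close>)

text \<open>On C, the function u and its absolute value agree almost everywhere on every time slice,
  hence almost everywhere in space-time. The indicator of C provides the joint
  measurability.\<close>

lemma uu_nonneg:
  assumes C: "compact C" "C \<subseteq> cyl \<Omega> T"
  shows "AE p in lebesgue. p \<in> C \<longrightarrow> 0 \<le> uu p"
proof -
  let ?F = "\<lambda>p. indicator C p * uu p"
  have m: "?F \<in> borel_measurable lebesgue"
    using loc_int_uu C unfolding loc_int_def set_integrable_def by (auto dest: borel_measurable_integrable)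
  have "AE p in lebesgue. ?F p = \<bar>?F p\<bar>"
  proof (rule AE_eq_of_slices[OF m])
    show "(\<lambda>p. \<bar>?F p\<bar>) \<in> borel_measurable lebesgue" using m by measurable
    fix t
    show "AE x in lebesgue. ?F (x, t) = \<bar>?F (x, t)\<bar>"
    proof (cases "t \<in> tint T")
      case True
      show ?thesis using u_nonneg[OF True]
      proof eventually_elim
        case (elim x)
        then show ?case using C(2) by (auto simp: indicator_def uu_def cyl_def)
      qed
    next
      case False
      then have "(x, t) \<notin> C" for x using C(2) by (auto simp: cyl_def)
      then show ?thesis by simp
    qed
  qed
  then show ?thesis
  proof eventually_elim
    case (elim p)
    then show ?case by (auto simp: indicator_def)
  qed
qed

lemma separated_integrable:
  assumes F: "loc_int F" and \<phi>: "Cc_fun \<Omega> \<phi>" and \<eta>: "\<eta> \<in> borel_measurable borel" "\<And>t. \<bar>\<eta> t\<bar> \<le> B"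
    and S: "{a..b} \<subseteq> tint T" "\<And>t. \<eta> t \<noteq> 0 \<Longrightarrow> t \<in> {a..b}"
  shows "integrable lebesgue (\<lambda>p. F p * (\<phi> (fst p) * \<eta> (snd p)))"
proof -
  obtain A where A: "0 < A" "\<And>x. \<bar>\<phi> x\<bar> \<le> A" by (rule Cc_fun_bounded[OF \<phi>]) blast
  have "\<bar>\<phi> (fst p) * \<eta> (snd p)\<bar> \<le> A * B" for p
    unfolding abs_mult using A by (intro mult_mono A(2) \<eta>(2)) auto
  then show ?thesis
  proof (rule loc_int_mult[OF F separated_measurable[OF Cc_fun_continuous[OF \<phi>] \<eta>(1)], where C="tsupport \<phi> \<times> {a..b}"])
    show "compact (tsupport \<phi> \<times> {a..b})" "tsupport \<phi> \<times> {a..b} \<subseteq> cyl \<Omega> T"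
      using \<phi> S(1) by (auto simp: Cc_fun_def cyl_def intro!: compact_Times)
    show "\<phi> (fst p) * \<eta> (snd p) = 0" if "p \<notin> tsupport \<phi> \<times> {a..b}" for p
      using that S(2)[of "snd p"] in_tsupport[of \<phi> "fst p"] by (cases p) auto
  qed
qed

lemma mass_Fubini:
  assumes \<phi>: "Cc_fun \<Omega> \<phi>" and \<eta>: "\<eta> \<in> borel_measurable borel" "\<And>t. \<bar>\<eta> t\<bar> \<le> B"
    and S: "{a..b} \<subseteq> tint T" "\<And>t. \<eta> t \<noteq> 0 \<Longrightarrow> t \<in> {a..b}"
  shows "(\<integral>p. uu p * (\<phi> (fst p) * \<eta> (snd p)) \<partial>lebesgue) = (\<integral>t. massi \<phi> t * \<eta> t \<partial>lborel)"
    and "integrable lborel (\<lambda>t. massi \<phi> t * \<eta> t)"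
proof -
  let ?F = "\<lambda>p. uu p * (\<phi> (fst p) * \<eta> (snd p))"
  have i: "integrable lebesgue ?F"
    by (rule separated_integrable[OF loc_int_uu \<phi> \<eta> S])
  have m: "(\<lambda>x. ?F (x, t)) \<in> borel_measurable lebesgue" for t
  proof (cases "\<eta> t = 0")
    case False
    then have "t \<in> tint T" using S by blast
    from integrable_mult_left[OF mass_integrable[OF \<phi> this], of "\<eta> t"]
    show ?thesis by (simp add: uu_def mult.assoc borel_measurable_integrable)
  qed simp
  have eq: "(\<integral>x. ?F (x, t) \<partial>lebesgue) = massi \<phi> t * \<eta> t" for t
  proof (cases "\<eta> t = 0")
    case False
    then have "t \<in> tint T" using S by blast
    then show ?thesis by (simp add: massi_def mass_def uu_def mult.assoc[symmetric])
  qed simp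
  have Ym: "(\<lambda>t. massi \<phi> t * \<eta> t) \<in> borel_measurable borel"
    using massi_measurable[OF \<phi>] \<eta>(1) by simp
  show "(\<integral>p. ?F p \<partial>lebesgue) = (\<integral>t. massi \<phi> t * \<eta> t \<partial>lborel)"
    "integrable lborel (\<lambda>t. massi \<phi> t * \<eta> t)"
    using lebesgue_Fubini[OF i m Ym eq] by blast+
qed

section \<open>Integrals over time slabs as limits of smooth time cutoffs\<close>

definition slab :: "real \<Rightarrow> real \<Rightarrow> ('a \<times> real \<Rightarrow> real) \<Rightarrow> ('a \<Rightarrow> real) \<Rightarrow> real" where
  "slab t1 t2 F \<phi> = (\<integral>p. F p * (\<phi> (fst p) * indicator {t1<..t2} (snd p)) \<partial>lebesgue)"

context
  fixes t1 t2 :: real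
  assumes t1: "0 < t1" and t12: "t1 \<le> t2" and t2: "t2 \<in> tint T"
begin

lemma slab_integrable:
  assumes F: "loc_int F" and \<phi>: "Cc_fun \<Omega> \<phi>"
  shows "integrable lebesgue (\<lambda>p. F p * (\<phi> (fst p) * indicator {t1<..t2} (snd p)))"
  by (rule separated_integrable[OF F \<phi>, where B=1, OF _ _ tint_interval[OF t1 t2]])
    (auto simp: indicator_def split: if_splits)

lemma t1_tint: "t1 \<in> tint T"
  using tint_interval[OF t1 t2] t12 by auto

lemma slab_mono:
  assumes F: "loc_int F" and \<phi>: "Cc_fun \<Omega> \<phi>" and \<psi>: "Cc_fun \<Omega> \<psi>"
    and le: "\<And>x. \<phi> x \<le> \<psi> x" and F0: "\<And>p. 0 \<le> F p"
  shows "slab t1 t2 F \<phi> \<le> slab t1 t2 F \<psi>"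
  unfolding slab_def
  by (intro integral_mono slab_integrable F \<phi> \<psi> mult_left_mono mult_right_mono le F0) auto

lemma slab_uu_abs:
  assumes \<phi>: "Cc_fun \<Omega> \<phi>"
  shows "slab t1 t2 (\<lambda>p. \<bar>uu p\<bar>) \<phi> = slab t1 t2 uu \<phi>"
proof -
  let ?C = "tsupport \<phi> \<times> {t1..t2}"
  have C: "compact ?C" "?C \<subseteq> cyl \<Omega> T"
    using \<phi> tint_interval[OF t1 t2] by (auto simp: Cc_fun_def cyl_def intro!: compact_Times)
  show ?thesis
    unfolding slab_def
  proof (rule integral_cong_AE)
    show "AE p in lebesgue. \<bar>uu p\<bar> * (\<phi> (fst p) * indicator {t1<..t2} (snd p)) = uu p * (\<phi> (fst p) * indicator {t1<..t2} (snd p))"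
      using uu_nonneg[OF C]
    proof eventually_elim
      case (elim p)
      show ?case
      proof (cases "p \<in> ?C")
        case False
        then have "\<phi> (fst p) * indicator {t1<..t2} (snd p) = 0"
          using in_tsupport[of \<phi> "fst p"] by (cases p) (auto simp: indicator_def)
        then show ?thesis by (metis mult_zero_right)
      qed (use elim in simp)
    qed
  qed (use slab_integrable[OF loc_int_uu \<phi>] slab_integrable[OF loc_int_abs[OF loc_int_uu] \<phi>] in auto)
qed

lemma slab_uu_eq:
  assumes \<phi>: "Cc_fun \<Omega> \<phi>"
  shows "slab t1 t2 uu \<phi> = (\<integral>t. massi \<phi> t * indicator {t1<..t2} t \<partial>lborel)"
    and "integrable lborel (\<lambda>t. massi \<phi> t * indicator {t1<..t2} t)"
  using mass_Fubini[OF \<phi>, of "indicator {t1<..t2}" 1 t1 t2] tint_interval[OF t1 t2]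
  unfolding slab_def by (auto simp: indicator_def split: if_splits)

context
  fixes N :: real
  assumes N: "0 < N" and t2N: "t2 + 1 / N \<in> tint T"
begin

text \<open>Starting at N instead of 0 keeps the supports of all cutoffs in one compact interval
  ending at t2 + 1/N, on which a common dominating function is available.\<close>

definition cutoff_rate :: "nat \<Rightarrow> real" where "cutoff_rate k = N + real k"

lemma cutoff_rate: "filterlim cutoff_rate at_top sequentially" "0 < cutoff_rate k" "N \<le> cutoff_rate k"
  unfolding cutoff_rate_def using N
  by (auto intro!: filterlim_tendsto_add_at_top[OF tendsto_const filterlim_real_sequentially])

lemma cutoff_support: "time_cutoff (cutoff_rate k) t1 t2 t \<noteq> 0 \<Longrightarrow> t \<in> {t1..t2 + 1 / N}"
  using time_cutoff_support[OF cutoff_rate(2) t12, of k t] frac_le[OF zero_le_one order_refl N cutoff_rate(3), of k] by auto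

lemma cutoff_interval: "{t1..t2 + 1 / N} \<subseteq> tint T" by (rule tint_interval[OF t1 t2N])

lemma cutoff_measurable: "time_cutoff (cutoff_rate k) t1 t2 \<in> borel_measurable borel"
  by (intro borel_measurable_continuous_onI smooth_fun_continuous time_cutoff_smooth)

lemma cutoff_abs_le: "\<bar>time_cutoff (cutoff_rate k) t1 t2 t\<bar> \<le> 1"
  using time_cutoff_bounds[OF cutoff_rate(2) t12, of k t] by simp

lemma slab_limit:
  assumes F: "loc_int F" and \<phi>: "Cc_fun \<Omega> \<phi>"
  shows "(\<lambda>k. \<integral>p. F p * (\<phi> (fst p) * time_cutoff (cutoff_rate k) t1 t2 (snd p)) \<partial>lebesgue) \<longlonglongrightarrow> slab t1 t2 F \<phi>"
  unfolding slab_def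
proof (rule integral_dominated_convergence)
  let ?w = "\<lambda>p. \<bar>F p\<bar> * (\<bar>\<phi> (fst p)\<bar> * indicator {t1..t2 + 1 / N} (snd p))"
  show "integrable lebesgue ?w"
    by (rule separated_integrable[OF loc_int_abs[OF F] Cc_fun_abs[OF \<phi>], where B=1, OF _ _ cutoff_interval])
      (auto simp: indicator_def split: if_splits)
  show "(\<lambda>p. F p * (\<phi> (fst p) * indicator {t1<..t2} (snd p))) \<in> borel_measurable lebesgue"
    by (rule borel_measurable_integrable[OF slab_integrable[OF F \<phi>]])
  show "(\<lambda>p. F p * (\<phi> (fst p) * time_cutoff (cutoff_rate k) t1 t2 (snd p))) \<in> borel_measurable lebesgue" for k
    by (rule borel_measurable_integrable[OF separated_integrable[OF F \<phi> cutoff_measurable cutoff_abs_le cutoff_interval cutoff_support]])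
  show "AE p in lebesgue. (\<lambda>k. F p * (\<phi> (fst p) * time_cutoff (cutoff_rate k) t1 t2 (snd p))) \<longlonglongrightarrow> F p * (\<phi> (fst p) * indicator {t1<..t2} (snd p))"
    by (intro AE_I2 tendsto_intros time_cutoff_tendsto cutoff_rate t12)
  show "AE p in lebesgue. norm (F p * (\<phi> (fst p) * time_cutoff (cutoff_rate k) t1 t2 (snd p))) \<le> ?w p" for k
  proof (rule AE_I2)
    fix p :: "'a \<times> real"
    have "\<bar>time_cutoff (cutoff_rate k) t1 t2 (snd p)\<bar> \<le> indicator {t1..t2 + 1 / N} (snd p)"
      using cutoff_support[of k "snd p"] cutoff_abs_le[of k "snd p"]
      by (cases "time_cutoff (cutoff_rate k) t1 t2 (snd p) = 0") (auto simp: indicator_def)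
    then show "norm (F p * (\<phi> (fst p) * time_cutoff (cutoff_rate k) t1 t2 (snd p))) \<le> ?w p"
      by (auto simp: abs_mult intro!: mult_left_mono)
  qed
qed

lemma kernel_facts:
  assumes \<tau>: "\<tau> \<in> {t1..t2}"
  shows "\<exists>B. \<forall>t. \<bar>time_kernel (cutoff_rate k) \<tau> t\<bar> \<le> B" "time_kernel (cutoff_rate k) \<tau> t \<noteq> 0 \<Longrightarrow> t \<in> {t1..t2 + 1 / N}"
    "time_kernel (cutoff_rate k) \<tau> \<in> borel_measurable borel"
proof -
  obtain C where "\<And>x. \<bar>step_deriv x\<bar> \<le> C" by (rule step_deriv_bounded) blast
  then show "\<exists>B. \<forall>t. \<bar>time_kernel (cutoff_rate k) \<tau> t\<bar> \<le> B"
    using cutoff_rate(2)[of k] by (intro exI[of _ "cutoff_rate k * C"]) (auto simp: time_kernel_def abs_mult)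
  have "1 / cutoff_rate k \<le> 1 / N" using cutoff_rate(3)[of k] N by (intro frac_le) auto
  then show "t \<in> {t1..t2 + 1 / N}" if "time_kernel (cutoff_rate k) \<tau> t \<noteq> 0"
    using time_kernel_support[OF cutoff_rate(2) that] \<tau> by auto
  show "time_kernel (cutoff_rate k) \<tau> \<in> borel_measurable borel"
    by (rule borel_measurable_continuous_onI[OF time_kernel_continuous])
qed

lemma kernel_integrable:
  assumes F: "loc_int F" and \<phi>: "Cc_fun \<Omega> \<phi>" and \<tau>: "\<tau> \<in> {t1..t2}"
  shows "integrable lebesgue (\<lambda>p. F p * (\<phi> (fst p) * time_kernel (cutoff_rate k) \<tau> (snd p)))"
proof -
  obtain B where B: "\<And>t. \<bar>time_kernel (cutoff_rate k) \<tau> t\<bar> \<le> B" using kernel_facts(1)[OF \<tau>] by blast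
  show ?thesis
    by (rule separated_integrable[OF F \<phi> kernel_facts(3)[OF \<tau>] B cutoff_interval kernel_facts(2)[OF \<tau>]])
qed

lemma kernel_limit:
  assumes \<phi>: "Cc_fun \<Omega> \<phi>" and \<tau>: "\<tau> \<in> {t1..t2}"
  shows "(\<lambda>k. \<integral>p. uu p * (\<phi> (fst p) * time_kernel (cutoff_rate k) \<tau> (snd p)) \<partial>lebesgue) \<longlonglongrightarrow> mass \<phi> \<tau>"
proof -
  have "(\<integral>p. uu p * (\<phi> (fst p) * time_kernel (cutoff_rate k) \<tau> (snd p)) \<partial>lebesgue) =
      (\<integral>t. massi \<phi> t * time_kernel (cutoff_rate k) \<tau> t \<partial>lborel)" for k
  proof -
    obtain B where B: "\<And>t. \<bar>time_kernel (cutoff_rate k) \<tau> t\<bar> \<le> B" using kernel_facts(1)[OF \<tau>] by blast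
    show ?thesis by (rule mass_Fubini(1)[OF \<phi> kernel_facts(3)[OF \<tau>] B cutoff_interval kernel_facts(2)[OF \<tau>]])
  qed
  moreover have "{\<tau>..\<tau> + 1 / N} \<subseteq> tint T" using cutoff_interval \<tau> by force
  then have "(\<lambda>k. \<integral>t. massi \<phi> t * time_kernel (cutoff_rate k) \<tau> t \<partial>lborel) \<longlonglongrightarrow> massi \<phi> \<tau>"
    by (intro time_kernel_tendsto[OF cutoff_rate N massi_measurable[OF \<phi>]] massi_continuous[OF \<phi>])
  moreover have "\<tau> \<in> tint T" by (rule subsetD[OF cutoff_interval]) (use \<tau> N in \<open>auto intro: add_increasing2\<close>)
  ultimately show ?thesis by (simp add: massi_def)
qed

lemma cutoff_test:
  assumes "test_fun \<Omega> \<phi>"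
  shows "test_fun (cyl \<Omega> T) (\<lambda>p. \<phi> (fst p) * time_cutoff (cutoff_rate k) t1 t2 (snd p))"
  by (rule separated_test_fun[OF assms time_cutoff_smooth cutoff_interval cutoff_support])

text \<open>The equation is tested with \<phi> times a time cutoff. As the cutoff sharpens, its two
  edges concentrate at t1 and t2 and produce the masses there.\<close>

lemma energy_identity_aux:
  assumes \<phi>: "test_fun \<Omega> \<phi>"
  shows "mass \<phi> t1 - mass \<phi> t2 + slab t1 t2 uu (lap \<phi>) = slab t1 t2 ff \<phi>"
proof -
  let ?w = "\<lambda>k p. \<phi> (fst p) * time_cutoff (cutoff_rate k) t1 t2 (snd p)"
  note s = test_fun_smooth[OF \<phi>]
  have \<phi>C: "Cc_fun \<Omega> \<phi>" by (rule test_fun_Cc[OF \<phi>])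
  have tt: "t1 \<in> {t1..t2}" "t2 \<in> {t1..t2}" using t12 by auto
  have 1: "(\<integral>p. uu p * dt (?w k) p \<partial>lebesgue) = (\<integral>p. uu p * (\<phi> (fst p) * time_kernel (cutoff_rate k) t1 (snd p)) \<partial>lebesgue)
      - (\<integral>p. uu p * (\<phi> (fst p) * time_kernel (cutoff_rate k) t2 (snd p)) \<partial>lebesgue)" for k
    unfolding dt_separated[OF s time_cutoff_smooth] time_cutoff_deriv right_diff_distrib
    using kernel_integrable[OF loc_int_uu \<phi>C tt(1)] kernel_integrable[OF loc_int_uu \<phi>C tt(2)] by simp
  have 2: "(\<integral>p. uu p * dt (?w k) p \<partial>lebesgue) + (\<integral>p. uu p * (lap \<phi> (fst p) * time_cutoff (cutoff_rate k) t1 t2 (snd p)) \<partial>lebesgue)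
      = (\<integral>p. ff p * ?w k p \<partial>lebesgue)" for k
    using equation_identity[OF cutoff_test[OF \<phi>]] unfolding lapx_separated[OF s time_cutoff_smooth] .
  have "(\<lambda>k. (\<integral>p. uu p * dt (?w k) p \<partial>lebesgue) + (\<integral>p. uu p * (lap \<phi> (fst p) * time_cutoff (cutoff_rate k) t1 t2 (snd p)) \<partial>lebesgue))
      \<longlonglongrightarrow> mass \<phi> t1 - mass \<phi> t2 + slab t1 t2 uu (lap \<phi>)"
    unfolding 1
    by (intro tendsto_intros kernel_limit[OF \<phi>C] tt slab_limit[OF loc_int_uu test_fun_Cc[OF lap_test_fun[OF \<phi>]]])
  then show ?thesis
    unfolding 2 using slab_limit[OF loc_int_ff \<phi>C] by (rule LIMSEQ_unique)
qed

text \<open>The time cutoff is sharpened in the space-time gradient estimate. The term with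
  \<open>dt\<close> stands under an absolute value, so both edges contribute with a plus sign; as u
  and \<phi> are nonnegative, they converge to the two end masses.\<close>

lemma gradient_slab_aux:
  assumes \<phi>: "test_fun \<Omega> \<phi>" and \<phi>0: "\<And>x. 0 \<le> \<phi> x" and b: "b \<in> Basis" and \<rho>: "0 < \<rho>" and c: "0 < c"
   and est: "\<And>\<zeta>. test_fun (cyl \<Omega> T) \<zeta> \<Longrightarrow>
    (\<integral>p. \<bar>gi b p\<bar> * \<bar>\<zeta> p\<bar> \<partial>lebesgue) \<le>
      (\<integral>p. \<bar>uu p\<bar> * \<bar>dxi b \<zeta> p\<bar> \<partial>lebesgue) + c / \<rho> * (\<integral>p. \<bar>uu p\<bar> * \<bar>\<zeta> p\<bar> \<partial>lebesgue)
      + c * \<rho> * ((\<integral>p. \<bar>ff p\<bar> * \<bar>\<zeta> p\<bar> \<partial>lebesgue) + (\<integral>p. \<bar>uu p\<bar> * \<bar>dt \<zeta> p\<bar> \<partial>lebesgue)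
        + (\<integral>p. \<bar>uu p\<bar> * \<bar>lapx \<zeta> p\<bar> \<partial>lebesgue)
        + 2 * (\<Sum>a\<in>Basis. \<integral>p. \<bar>gi a p\<bar> * \<bar>dxi a \<zeta> p\<bar> \<partial>lebesgue))"
  shows "slab t1 t2 (\<lambda>p. \<bar>gi b p\<bar>) \<phi> \<le> slab t1 t2 (\<lambda>p. \<bar>uu p\<bar>) (\<lambda>x. \<bar>dirderiv b \<phi> x\<bar>)
    + c / \<rho> * slab t1 t2 (\<lambda>p. \<bar>uu p\<bar>) \<phi>
    + c * \<rho> * (slab t1 t2 (\<lambda>p. \<bar>ff p\<bar>) \<phi> + (mass \<phi> t1 + mass \<phi> t2) + slab t1 t2 (\<lambda>p. \<bar>uu p\<bar>) (\<lambda>x. \<bar>lap \<phi> x\<bar>)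
      + 2 * (\<Sum>a\<in>Basis. slab t1 t2 (\<lambda>p. \<bar>gi a p\<bar>) (\<lambda>x. \<bar>dirderiv a \<phi> x\<bar>)))"
proof -
  let ?\<eta> = "\<lambda>k. time_cutoff (cutoff_rate k) t1 t2"
  let ?w = "\<lambda>k p. \<phi> (fst p) * ?\<eta> k (snd p)"
  note s = test_fun_smooth[OF \<phi>]
  have \<phi>C: "Cc_fun \<Omega> \<phi>" by (rule test_fun_Cc[OF \<phi>])
  have tt: "t1 \<in> {t1..t2}" "t2 \<in> {t1..t2}" using t12 by auto
  have \<eta>0: "\<bar>?\<eta> k t\<bar> = ?\<eta> k t" for k t using time_cutoff_bounds[OF cutoff_rate(2) t12, of k t] by simp
  let ?K = "\<lambda>k \<tau>. \<integral>p. uu p * (\<phi> (fst p) * time_kernel (cutoff_rate k) \<tau> (snd p)) \<partial>lebesgue"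
  have dtb: "(\<integral>p. \<bar>uu p\<bar> * \<bar>dt (?w k) p\<bar> \<partial>lebesgue) \<le> ?K k t1 + ?K k t2" for k
  proof -
    let ?C = "tsupport \<phi> \<times> {t1..t2 + 1 / N}"
    have C: "compact ?C" "?C \<subseteq> cyl \<Omega> T"
      using \<phi>C cutoff_interval by (auto simp: Cc_fun_def cyl_def intro!: compact_Times)
    have i: "integrable lebesgue (\<lambda>p. \<bar>uu p\<bar> * \<bar>dt (?w k) p\<bar>)"
      by (rule loc_int_abs_test[OF loc_int_uu test_fun_dt[OF cutoff_test[OF \<phi>]]])
    have j: "integrable lebesgue (\<lambda>p. uu p * (\<phi> (fst p) * time_kernel (cutoff_rate k) t1 (snd p)) + uu p * (\<phi> (fst p) * time_kernel (cutoff_rate k) t2 (snd p)))"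
      by (intro Bochner_Integration.integrable_add kernel_integrable loc_int_uu \<phi>C tt)
    have "(\<integral>p. \<bar>uu p\<bar> * \<bar>dt (?w k) p\<bar> \<partial>lebesgue) \<le>
        (\<integral>p. uu p * (\<phi> (fst p) * time_kernel (cutoff_rate k) t1 (snd p)) + uu p * (\<phi> (fst p) * time_kernel (cutoff_rate k) t2 (snd p)) \<partial>lebesgue)"
    proof (rule integral_mono_AE[OF i j])
      show "AE p in lebesgue. \<bar>uu p\<bar> * \<bar>dt (?w k) p\<bar> \<le>
          uu p * (\<phi> (fst p) * time_kernel (cutoff_rate k) t1 (snd p)) + uu p * (\<phi> (fst p) * time_kernel (cutoff_rate k) t2 (snd p))"
        using uu_nonneg[OF C]
      proof eventually_elim
        case (elim p)
        let ?k1 = "time_kernel (cutoff_rate k) t1 (snd p)" and ?k2 = "time_kernel (cutoff_rate k) t2 (snd p)"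
        have k0: "0 \<le> ?k1" "0 \<le> ?k2" using time_kernel_nonneg cutoff_rate(2)[of k] by (auto simp: less_imp_le)
        have d: "dt (?w k) p = \<phi> (fst p) * (?k1 - ?k2)"
          unfolding dt_separated[OF s time_cutoff_smooth] time_cutoff_deriv ..
        show ?case
        proof (cases "p \<in> ?C")
          case True
          then have "0 \<le> uu p" using elim by simp
          then have "\<bar>uu p\<bar> * \<bar>dt (?w k) p\<bar> = uu p * (\<phi> (fst p) * \<bar>?k1 - ?k2\<bar>)"
            unfolding d abs_mult using \<phi>0[of "fst p"] by simp
          also have "\<dots> \<le> uu p * (\<phi> (fst p) * (?k1 + ?k2))"
            using \<open>0 \<le> uu p\<close> \<phi>0[of "fst p"] k0 by (intro mult_left_mono) auto
          finally show ?thesis by (simp add: algebra_simps)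
        next
          case False
          then have "\<phi> (fst p) = 0 \<or> (?k1 = 0 \<and> ?k2 = 0)"
            using in_tsupport[of \<phi> "fst p"] kernel_facts(2)[OF tt(1), of k "snd p"] kernel_facts(2)[OF tt(2), of k "snd p"]
            by (cases p) auto
          then show ?thesis unfolding d by auto
        qed
      qed
    qed
    also have "\<dots> = ?K k t1 + ?K k t2"
      using kernel_integrable[OF loc_int_uu \<phi>C tt(1)] kernel_integrable[OF loc_int_uu \<phi>C tt(2)] by simp
    finally show ?thesis .
  qed
  have ineq: "(\<integral>p. \<bar>gi b p\<bar> * (\<phi> (fst p) * ?\<eta> k (snd p)) \<partial>lebesgue) \<le>
      (\<integral>p. \<bar>uu p\<bar> * (\<bar>dirderiv b \<phi> (fst p)\<bar> * ?\<eta> k (snd p)) \<partial>lebesgue)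
      + c / \<rho> * (\<integral>p. \<bar>uu p\<bar> * (\<phi> (fst p) * ?\<eta> k (snd p)) \<partial>lebesgue)
      + c * \<rho> * ((\<integral>p. \<bar>ff p\<bar> * (\<phi> (fst p) * ?\<eta> k (snd p)) \<partial>lebesgue) + (?K k t1 + ?K k t2)
        + (\<integral>p. \<bar>uu p\<bar> * (\<bar>lap \<phi> (fst p)\<bar> * ?\<eta> k (snd p)) \<partial>lebesgue)
        + 2 * (\<Sum>a\<in>Basis. \<integral>p. \<bar>gi a p\<bar> * (\<bar>dirderiv a \<phi> (fst p)\<bar> * ?\<eta> k (snd p)) \<partial>lebesgue))" for k
  proof -
    have "\<bar>?w k p\<bar> = \<phi> (fst p) * ?\<eta> k (snd p)" "\<bar>dxi a (?w k) p\<bar> = \<bar>dirderiv a \<phi> (fst p)\<bar> * ?\<eta> k (snd p)"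
      "\<bar>lapx (?w k) p\<bar> = \<bar>lap \<phi> (fst p)\<bar> * ?\<eta> k (snd p)" for p a
      unfolding dxi_separated[OF s time_cutoff_smooth] lapx_separated[OF s time_cutoff_smooth]
      by (auto simp: abs_mult \<eta>0 \<phi>0)
    note e = this
    have "c * \<rho> * (\<integral>p. \<bar>uu p\<bar> * \<bar>dt (?w k) p\<bar> \<partial>lebesgue) \<le> c * \<rho> * (?K k t1 + ?K k t2)"
      using c \<rho> by (intro mult_left_mono dtb) auto
    then show ?thesis using est[OF cutoff_test[OF \<phi>], of k] unfolding e distrib_left by linarith
  qed
  have dC: "Cc_fun \<Omega> (\<lambda>x. \<bar>dirderiv a \<phi> x\<bar>)" for a
    by (rule Cc_fun_abs[OF test_fun_Cc[OF test_fun_dirderiv[OF \<phi>]]])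
  have lC: "Cc_fun \<Omega> (\<lambda>x. \<bar>lap \<phi> x\<bar>)"
    by (rule Cc_fun_abs[OF test_fun_Cc[OF lap_test_fun[OF \<phi>]]])
  have L: "(\<lambda>k. \<integral>p. \<bar>gi a p\<bar> * (\<psi> (fst p) * ?\<eta> k (snd p)) \<partial>lebesgue) \<longlonglongrightarrow> slab t1 t2 (\<lambda>p. \<bar>gi a p\<bar>) \<psi>"
    "(\<lambda>k. \<integral>p. \<bar>uu p\<bar> * (\<psi> (fst p) * ?\<eta> k (snd p)) \<partial>lebesgue) \<longlonglongrightarrow> slab t1 t2 (\<lambda>p. \<bar>uu p\<bar>) \<psi>"
    "(\<lambda>k. \<integral>p. \<bar>ff p\<bar> * (\<psi> (fst p) * ?\<eta> k (snd p)) \<partial>lebesgue) \<longlonglongrightarrow> slab t1 t2 (\<lambda>p. \<bar>ff p\<bar>) \<psi>"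
    if "Cc_fun \<Omega> \<psi>" for \<psi> a
    by (intro slab_limit loc_int_abs loc_int_gi loc_int_uu loc_int_ff that)+
  show ?thesis
    by (rule LIMSEQ_le[OF L(1)[OF \<phi>C, of b]
      tendsto_add[OF tendsto_add[OF L(2)[OF dC[of b]] tendsto_mult_left[OF L(2)[OF \<phi>C]]]
        tendsto_mult_left[OF tendsto_add[OF tendsto_add[OF tendsto_add[OF L(3)[OF \<phi>C]
          tendsto_add[OF kernel_limit[OF \<phi>C tt(1)] kernel_limit[OF \<phi>C tt(2)]]] L(2)[OF lC]]
          tendsto_mult_left[OF tendsto_sum[OF L(1)[OF dC]]]]]]])
      (use ineq in blast)
qed

end

lemma energy_identity:
  assumes \<phi>: "test_fun \<Omega> \<phi>"
  shows "mass \<phi> t1 - mass \<phi> t2 + slab t1 t2 uu (lap \<phi>) = slab t1 t2 ff \<phi>"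
  by (rule tint_extend[OF t2]) (rule energy_identity_aux[OF _ _ \<phi>])

end

text \<open>The order of quantifiers matters: one c serves all slabs, test functions and scales, so
  that \<rho> may depend on the dyadic level and t1 may tend to 0.\<close>

lemma gradient_slab:
  "\<exists>c>0. \<forall>b\<in>Basis. \<forall>\<phi> \<rho> t1 t2. test_fun \<Omega> \<phi> \<longrightarrow> (\<forall>x. 0 \<le> \<phi> x) \<longrightarrow> 0 < \<rho> \<longrightarrow> 0 < t1 \<longrightarrow> t1 \<le> t2 \<longrightarrow> t2 \<in> tint T \<longrightarrow>
    slab t1 t2 (\<lambda>p. \<bar>gi b p\<bar>) \<phi> \<le> slab t1 t2 (\<lambda>p. \<bar>uu p\<bar>) (\<lambda>x. \<bar>dirderiv b \<phi> x\<bar>)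
    + c / \<rho> * slab t1 t2 (\<lambda>p. \<bar>uu p\<bar>) \<phi>
    + c * \<rho> * (slab t1 t2 (\<lambda>p. \<bar>ff p\<bar>) \<phi> + (mass \<phi> t1 + mass \<phi> t2) + slab t1 t2 (\<lambda>p. \<bar>uu p\<bar>) (\<lambda>x. \<bar>lap \<phi> x\<bar>)
      + 2 * (\<Sum>a\<in>Basis. slab t1 t2 (\<lambda>p. \<bar>gi a p\<bar>) (\<lambda>x. \<bar>dirderiv a \<phi> x\<bar>)))"
proof -
  obtain c where c: "0 < c" and est: "\<forall>b\<in>Basis. \<forall>\<zeta> \<rho>. test_fun (cyl \<Omega> T) \<zeta> \<longrightarrow> 0 < \<rho> \<longrightarrow>
    (\<integral>p. \<bar>gi b p\<bar> * \<bar>\<zeta> p\<bar> \<partial>lebesgue) \<le>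
      (\<integral>p. \<bar>uu p\<bar> * \<bar>dxi b \<zeta> p\<bar> \<partial>lebesgue) + c / \<rho> * (\<integral>p. \<bar>uu p\<bar> * \<bar>\<zeta> p\<bar> \<partial>lebesgue)
      + c * \<rho> * ((\<integral>p. \<bar>ff p\<bar> * \<bar>\<zeta> p\<bar> \<partial>lebesgue) + (\<integral>p. \<bar>uu p\<bar> * \<bar>dt \<zeta> p\<bar> \<partial>lebesgue)
        + (\<integral>p. \<bar>uu p\<bar> * \<bar>lapx \<zeta> p\<bar> \<partial>lebesgue)
        + 2 * (\<Sum>a\<in>Basis. \<integral>p. \<bar>gi a p\<bar> * \<bar>dxi a \<zeta> p\<bar> \<partial>lebesgue))"
    using gradient_estimate by blast
  show ?thesis
  proof (intro exI[of _ c] conjI c ballI allI impI)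
    fix b :: 'a and \<phi> :: "'a \<Rightarrow> real" and \<rho> t1 t2 :: real
    assume a: "b \<in> Basis" "test_fun \<Omega> \<phi>" "\<forall>x. 0 \<le> \<phi> x" "0 < \<rho>" "0 < t1" "t1 \<le> t2" "t2 \<in> tint T"
    obtain N where N: "0 < N" "t2 + 1 / N \<in> tint T" by (rule tint_extend[OF a(7)])
    show "slab t1 t2 (\<lambda>p. \<bar>gi b p\<bar>) \<phi> \<le> slab t1 t2 (\<lambda>p. \<bar>uu p\<bar>) (\<lambda>x. \<bar>dirderiv b \<phi> x\<bar>)
    + c / \<rho> * slab t1 t2 (\<lambda>p. \<bar>uu p\<bar>) \<phi>
    + c * \<rho> * (slab t1 t2 (\<lambda>p. \<bar>ff p\<bar>) \<phi> + (mass \<phi> t1 + mass \<phi> t2) + slab t1 t2 (\<lambda>p. \<bar>uu p\<bar>) (\<lambda>x. \<bar>lap \<phi> x\<bar>)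
      + 2 * (\<Sum>a\<in>Basis. slab t1 t2 (\<lambda>p. \<bar>gi a p\<bar>) (\<lambda>x. \<bar>dirderiv a \<phi> x\<bar>)))"
      by (rule gradient_slab_aux[OF a(5,6,7) N a(2) _ a(1,4) c]) (use a est in auto)
  qed
qed

end

section \<open>Dyadic shells of the weight\<close>

lemma sum_half_powers: "(\<Sum>i<M. (1/2::real) ^ i) = 2 - 2 * (1/2) ^ M"
  by (induction M) auto

lemma sum_half_powers_squares:
  "(\<Sum>i<M. (1/2::real) ^ i * (real i + 1)\<^sup>2) = 12 - (2 * (real M)\<^sup>2 + 8 * real M + 12) * (1/2) ^ M"
  by (induction M) (auto simp: power2_eq_square algebra_simps)

text \<open>The indicator of the superlevel set s \<ge> 2^-(k+1), which grows with k, and not of an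
  annulus. It dominates the cutoff at level k and, up to powers of k+1, its derivatives.\<close>

definition in_shell :: "nat \<Rightarrow> real \<Rightarrow> real" where
  "in_shell k s = (if 1 \<le> 2 ^ (k + 1) * s then 1 else 0)"

text \<open>j is the lowest level that contains s, so 2^-j is at most 2 s. Sums over the levels
  containing s with weights 2^-k are geometric from j on and hence comparable to s.\<close>

lemma shell_index:
  assumes "0 < s"
  obtains j where "1 \<le> 2 ^ (j + 1) * s" "\<And>k. k < j \<Longrightarrow> in_shell k s = 0" "j = 0 \<or> 2 ^ j * s < 1"
proof -
  obtain n where "1 / s < 2 ^ n" using real_arch_pow[of 2 "1 / s"] by auto
  then have "1 \<le> 2 ^ (n + 1) * s" using assms by (simp add: field_simps)
  then have ex: "\<exists>k. 1 \<le> 2 ^ (k + 1) * s" by blast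
  define j where "j = (LEAST k. 1 \<le> 2 ^ (k + 1) * s)"
  have 1: "1 \<le> 2 ^ (j + 1) * s" unfolding j_def by (rule LeastI_ex[OF ex])
  have 2: "\<not> 1 \<le> 2 ^ (k + 1) * s" if "k < j" for k using that unfolding j_def by (rule not_less_Least)
  have 3: "j = 0 \<or> 2 ^ j * s < 1"
  proof (cases j)
    case (Suc i) then show ?thesis using 2[of i] by simp
  qed simp
  show ?thesis by (rule that[OF 1 _ 3]) (use 2 in \<open>simp add: in_shell_def\<close>)
qed

text \<open>Terms before the first level vanish and later ones are compared with a fixed sequence w
  of bounded partial sums, so the bound does not depend on K.\<close>

lemma sum_split_shell:
  fixes f :: "nat \<Rightarrow> real"
  assumes "\<And>k. k < j \<Longrightarrow> f k = 0" "\<And>k. 0 \<le> f k" "\<And>i. f (j + i) \<le> B * w i" "\<And>M. (\<Sum>i<M. w i) \<le> W" "0 \<le> B"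
  shows "(\<Sum>k<K. f k) \<le> B * W"
proof -
  have "(\<Sum>k<K. f k) \<le> (\<Sum>k<j + K. f k)" by (rule sum_mono2) (auto simp: assms)
  also have "\<dots> = (\<Sum>k<j. f k) + (\<Sum>i<K. f (j + i))"
    by (induction K) (simp_all add: add.assoc)
  also have "\<dots> \<le> 0 + (\<Sum>i<K. B * w i)" by (intro add_mono sum_mono assms) (simp add: assms)
  also have "\<dots> = B * (\<Sum>i<K. w i)" by (simp add: sum_distrib_left)
  also have "\<dots> \<le> B * W" by (intro mult_left_mono assms)
  finally show ?thesis .
qed

lemma shell_sum:
  assumes "0 \<le> s"
  shows "(\<Sum>k<K. (1/2) ^ k * in_shell k s) \<le> 4 * s"
proof (cases "s = 0")
  case True then show ?thesis by (simp add: in_shell_def)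
next
  case False
  then have s: "0 < s" using assms by simp
  obtain j where j: "1 \<le> 2 ^ (j + 1) * s" "\<And>k. k < j \<Longrightarrow> in_shell k s = 0" "j = 0 \<or> 2 ^ j * s < 1"
    by (rule shell_index[OF s]) blast
  have "(\<Sum>k<K. (1/2) ^ k * in_shell k s) \<le> (1/2) ^ j * 2"
  proof (rule sum_split_shell[where w="\<lambda>i. (1/2)^i"])
    show "(1/2) ^ k * in_shell k s = 0" if "k < j" for k using j(2)[OF that] by simp
  qed (auto simp: in_shell_def power_add sum_half_powers)
  also have "(1/2) ^ j \<le> 2 * s" using j(1) by (simp add: field_simps power_one_over)
  finally show ?thesis by simp
qed

text \<open>For s = exp(-1/d) the first level satisfies j ln 2 < 1/d unless j = 0, which converts
  (j+1)^2 into 1 + 16/d^2. The constant 384 is 2 * 16 * 12, where 2 comes from 2^-j \<le> 2 s and 12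
  bounds the sum of (i+1)^2/2^i.\<close>

lemma shell_sum_squares:
  "(\<Sum>k<K. (1/2) ^ k * ((real k + 1)\<^sup>2 * in_shell k (flat_exp 0 d))) \<le> 384 * (flat_exp 0 d + flat_exp 2 d)"
proof (cases "0 < d")
  case False
  then show ?thesis by (simp add: flat_exp_def in_shell_def)
next
  case True
  define y where "y = 1 / d"
  define s where "s = exp (- y)"
  have y: "0 < y" using True by (simp add: y_def)
  have s: "0 < s" by (simp add: s_def)
  have f0: "flat_exp 0 d = s" using True by (simp add: flat_exp_def s_def y_def)
  have f2: "flat_exp 2 d = s * y\<^sup>2" using True by (simp add: flat_exp_def s_def y_def power_divide)
  obtain j where j: "1 \<le> 2 ^ (j + 1) * s" "\<And>k. k < j \<Longrightarrow> in_shell k s = 0" "j = 0 \<or> 2 ^ j * s < 1"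
    by (rule shell_index[OF s]) blast
  have "(\<Sum>k<K. (1/2) ^ k * ((real k + 1)\<^sup>2 * in_shell k s)) \<le> ((1/2) ^ j * (real j + 1)\<^sup>2) * 12"
  proof (rule sum_split_shell[where w="\<lambda>i. (1/2)^i * (real i + 1)\<^sup>2"])
    fix i
    have "real j + real i + 1 \<le> (real j + 1) * (real i + 1)" by (simp add: algebra_simps)
    then have "(real j + real i + 1)\<^sup>2 \<le> ((real j + 1) * (real i + 1))\<^sup>2" by (intro power_mono) auto
    then have "(1/2) ^ (j + i) * ((real (j + i) + 1)\<^sup>2 * in_shell (j + i) s) \<le> (1/2) ^ (j + i) * (((real j + 1) * (real i + 1))\<^sup>2 * 1)"
      by (intro mult_left_mono mult_mono) (auto simp: in_shell_def)
    then show "(1/2) ^ (j + i) * ((real (j + i) + 1)\<^sup>2 * in_shell (j + i) s) \<le>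
        (1/2) ^ j * (real j + 1)\<^sup>2 * ((1/2) ^ i * (real i + 1)\<^sup>2)"
      by (simp add: power_add power_mult_distrib mult_ac)
  next
    show "(\<Sum>i<M. (1/2::real) ^ i * (real i + 1)\<^sup>2) \<le> 12" for M
      unfolding sum_half_powers_squares by simp
    show "(1/2) ^ k * ((real k + 1)\<^sup>2 * in_shell k s) = 0" if "k < j" for k using j(2)[OF that] by simp
  qed (auto simp: in_shell_def)
  also have "(real j + 1)\<^sup>2 \<le> 1 + 16 * y\<^sup>2"
  proof (cases "j = 0")
    case False
    then have "2 ^ j * s < 1" using j(3) by simp
    then have "ln (2 ^ j * s) < ln 1" using s by (subst ln_less_cancel_iff) auto
    then have "real j * ln 2 < y" using s by (simp add: ln_mult ln_realpow s_def)
    moreover have "real j * (1/2) \<le> real j * ln 2" using ln2_ge_two_thirds by (intro mult_left_mono) auto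
    moreover have "1 \<le> real j" using False by simp
    ultimately have "real j + 1 \<le> 4 * y" by linarith
    then have "(real j + 1)\<^sup>2 \<le> (4 * y)\<^sup>2" by (intro power_mono) auto
    then show ?thesis by (simp add: power_mult_distrib)
  qed simp
  also have "(1/2) ^ j \<le> 2 * s" using j(1) by (simp add: field_simps power_one_over)
  finally have "(\<Sum>k<K. (1/2) ^ k * ((real k + 1)\<^sup>2 * in_shell k s)) \<le> 2 * s * (1 + 16 * y\<^sup>2) * 12"
    by (simp add: mult_left_mono mult_right_mono)
  also have "\<dots> \<le> 384 * (s + s * y\<^sup>2)" using s by (simp add: algebra_simps)
  finally show ?thesis by (simp add: f0 f2)
qed

text \<open>One term suffices: at level j+1 the smooth step equals 1, and 2^-(j+1) is at least s/2.
  The hypothesis s < 1 settles the case j = 0. The remainder covers values of s so small that level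
  j+1 may not occur in the sum.\<close>

lemma shell_sum_lower:
  assumes s: "0 \<le> s" "s < 1"
  shows "s \<le> 2 * (\<Sum>k<K. (1/2) ^ k * smooth_step (2 ^ k * s)) + 2 * (1/2) ^ K"
proof (cases "s < 2 * (1/2) ^ K")
  case True
  have "0 \<le> (\<Sum>k<K. (1/2) ^ k * smooth_step (2 ^ k * s))"
    by (intro sum_nonneg mult_nonneg_nonneg smooth_step_bounds) auto
  then show ?thesis using True by simp
next
  case False
  then have sK: "2 * (1/2) ^ K \<le> s" by simp
  then have s0: "0 < s" by (rule less_le_trans[rotated]) simp
  obtain j where j: "1 \<le> 2 ^ (j + 1) * s" "\<And>k. k < j \<Longrightarrow> in_shell k s = 0" "j = 0 \<or> 2 ^ j * s < 1"
    by (rule shell_index[OF s0]) blast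
  have js: "2 ^ j * s < 1" using j(3) s by auto
  have jK: "j + 1 < K"
  proof (rule ccontr)
    assume "\<not> j + 1 < K"
    then have "(2::real) ^ K \<le> 2 ^ (j + 1)" by (intro power_increasing) auto
    moreover have "2 \<le> 2 ^ K * s" using sK by (simp add: field_simps power_one_over)
    ultimately have "2 \<le> 2 ^ (j + 1) * s" using s0 by (meson mult_right_mono order_trans less_imp_le)
    then show False using js by simp
  qed
  have "(1/2) ^ (j + 1) * smooth_step (2 ^ (j + 1) * s) \<le> (\<Sum>k<K. (1/2) ^ k * smooth_step (2 ^ k * s))"
    by (rule member_le_sum[of "j + 1" "{..<K}" "\<lambda>k. (1/2) ^ k * smooth_step (2 ^ k * s)"])
      (use jK in \<open>auto intro!: mult_nonneg_nonneg smooth_step_bounds\<close>)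
  moreover have "s / 2 \<le> (1/2) ^ (j + 1)" using js by (simp add: field_simps power_one_over)
  ultimately have "s / 2 \<le> (\<Sum>k<K. (1/2) ^ k * smooth_step (2 ^ k * s))"
    using smooth_step_eq_1[OF j(1)] by simp
  moreover have "0 \<le> (1/2::real) ^ K" by simp
  ultimately show ?thesis by linarith
qed

section \<open>Derivatives of the weight and of its cutoffs\<close>

definition dep :: "'a::euclidean_space \<Rightarrow> real \<Rightarrow> 'a \<Rightarrow> real" where
  "dep a R x = R\<^sup>2 - (x - a) \<bullet> (x - a)"

lemma dep_has_derivative: "(dep a R has_derivative (\<lambda>v. - 2 * ((x - a) \<bullet> v))) (at x)"
  unfolding dep_def[abs_def]
  by (rule derivative_eq_intros refl)+ (auto simp: inner_commute algebra_simps)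

lemma dirderiv_dep: "dirderiv b (dep a R) x = - 2 * ((x - a) \<bullet> b)"
  by (rule dirderiv_eq[OF dep_has_derivative])

lemma smooth_dep: "smooth_fun (dep a R)"
  unfolding dep_def[abs_def] by (intro smooth_fun_diff smooth_intros(1) smooth_fun_norm_sq)

lemma ball_bump_dep: "ball_bump a R = (\<lambda>x. flat_exp 0 (dep a R x))"
  by (simp add: ball_bump_def[abs_def] dep_def)

lemma dirderiv_flat_dep:
  "dirderiv b (\<lambda>x. flat_exp n (dep a R x)) = (\<lambda>x. (flat_exp (n + 2) (dep a R x) - n * flat_exp (n + 1) (dep a R x)) * (- 2 * ((x - a) \<bullet> b)))"
  using dirderiv_compose_real[where f="dep a R" and g="flat_exp n"
      and g'="\<lambda>y. flat_exp (n + 2) y - n * flat_exp (n + 1) y" and v=b,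
      OF smooth_fun_differentiable[OF smooth_dep] flat_exp_has_derivative]
  by (simp only: dirderiv_dep)

lemma dirderiv_ball_bump:
  "dirderiv b (ball_bump a R) = (\<lambda>x. flat_exp 2 (dep a R x) * (- 2 * ((x - a) \<bullet> b)))"
  unfolding ball_bump_dep dirderiv_flat_dep by (simp add: numeral_2_eq_2)

lemma dirderiv2_ball_bump:
  assumes b: "b \<in> Basis"
  shows "dirderiv b (dirderiv b (ball_bump a R)) x =
    4 * ((x - a) \<bullet> b)\<^sup>2 * (flat_exp 4 (dep a R x) - 2 * flat_exp 3 (dep a R x)) - 2 * flat_exp 2 (dep a R x)"
proof -
  have s2: "smooth_fun (\<lambda>x. flat_exp 2 (dep a R x))" by (rule smooth_intros(5)[OF smooth_dep])
  have D: "((\<lambda>x. - 2 * ((x - a) \<bullet> b)) has_derivative (\<lambda>v. - 2 * (v \<bullet> b))) (at x)" for x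
    by (auto intro!: derivative_eq_intros)
  have diff: "(\<lambda>x. - 2 * ((x - a) \<bullet> b)) differentiable (at x)" for x using D by (auto simp: differentiable_def)
  have d2: "dirderiv b (\<lambda>x. flat_exp 2 (dep a R x)) =
      (\<lambda>x. (flat_exp 4 (dep a R x) - 2 * flat_exp 3 (dep a R x)) * (- 2 * ((x - a) \<bullet> b)))"
    using dirderiv_flat_dep[of b 2 a R] by (simp add: numeral_eq_Suc)
  have "dirderiv b (\<lambda>x. flat_exp 2 (dep a R x) * (- 2 * ((x - a) \<bullet> b))) x =
     flat_exp 2 (dep a R x) * (- 2 * (b \<bullet> b)) +
     ((flat_exp 4 (dep a R x) - 2 * flat_exp 3 (dep a R x)) * (- 2 * ((x - a) \<bullet> b))) * (- 2 * ((x - a) \<bullet> b))"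
    unfolding dirderiv_mult[OF smooth_fun_differentiable[OF s2] diff] dirderiv_eq[OF D] d2 ..
  then show ?thesis
    unfolding dirderiv_ball_bump by (rule trans) (use b in \<open>simp add: power2_eq_square algebra_simps\<close>)
qed

lemma inner_eq_sum_squares: "(x::'a::euclidean_space) \<bullet> x = (\<Sum>b\<in>Basis. (x \<bullet> b)\<^sup>2)"
  by (subst euclidean_inner) (simp add: power2_eq_square)

lemma lap_ball_bump:
  fixes a :: "'a::euclidean_space"
  shows "lap (ball_bump a R) x = 4 * ((x - a) \<bullet> (x - a)) * (flat_exp 4 (dep a R x) - 2 * flat_exp 3 (dep a R x))
    - 2 * real DIM('a) * flat_exp 2 (dep a R x)"
proof -
  show ?thesis
    unfolding lap_def inner_eq_sum_squares[of "x - a"]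
    by (simp add: dirderiv2_ball_bump sum_subtractf sum_distrib_left[symmetric] sum_distrib_right[symmetric])
qed

definition shell_fun :: "'a::euclidean_space \<Rightarrow> real \<Rightarrow> nat \<Rightarrow> 'a \<Rightarrow> real" where
  "shell_fun a R k x = smooth_step (2 ^ k * ball_bump a R x)"

lemma smooth_shell: "smooth_fun (shell_fun a R k)"
  unfolding shell_fun_def[abs_def]
  by (intro smooth_fun_smooth_step smooth_intros(4) smooth_intros(1) ball_bump_smooth)

lemma shell_fun_test:
  assumes "test_fun U (ball_bump a R)"
  shows "test_fun U (shell_fun a R k)"
proof (rule test_fun_subset[OF assms smooth_shell])
  fix x assume "shell_fun a R k x \<noteq> 0"
  then have "ball_bump a R x \<noteq> 0"
    using smooth_step_eq_0[of 0] by (cases "ball_bump a R x = 0") (auto simp: shell_fun_def)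
  then show "x \<in> tsupport (ball_bump a R)" by (rule in_tsupport)
qed

lemma shell_fun_bounds: "0 \<le> shell_fun a R k x" "shell_fun a R k x \<le> in_shell k (ball_bump a R x)"
proof -
  show "0 \<le> shell_fun a R k x" by (simp add: shell_fun_def smooth_step_bounds)
  show "shell_fun a R k x \<le> in_shell k (ball_bump a R x)"
  proof (cases "1 \<le> 2 ^ (k + 1) * ball_bump a R x")
    case True then show ?thesis by (simp add: in_shell_def shell_fun_def smooth_step_bounds)
  next
    case False
    then have "2 ^ k * ball_bump a R x \<le> 1 / 2" by simp
    then show ?thesis by (simp add: in_shell_def shell_fun_def smooth_step_eq_0)
  qed
qed

lemma dirderiv_shell:
  "dirderiv b (shell_fun a R k) = (\<lambda>x. step_deriv (2 ^ k * ball_bump a R x) * (2 ^ k * dirderiv b (ball_bump a R) x))"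
proof -
  have s: "smooth_fun (\<lambda>x. 2 ^ k * ball_bump a R x)" by (intro smooth_intros(4) smooth_intros(1) ball_bump_smooth)
  have e: "dirderiv b (\<lambda>x. 2 ^ k * ball_bump a R x) = (\<lambda>x. 2 ^ k * dirderiv b (ball_bump a R) x)"
    by (rule ext) (simp add: dirderiv_product[OF smooth_intros(1) ball_bump_smooth] dirderiv_const)
  show ?thesis
    unfolding shell_fun_def[abs_def]
    using dirderiv_compose_real[where g=smooth_step and g'=step_deriv and v=b,
        OF smooth_fun_differentiable[OF s] step_deriv_derivative] unfolding e .
qed

lemma dirderiv2_shell:
  "dirderiv b (dirderiv b (shell_fun a R k)) x =
    step_deriv2 (2 ^ k * ball_bump a R x) * (2 ^ k * dirderiv b (ball_bump a R) x)\<^sup>2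
    + step_deriv (2 ^ k * ball_bump a R x) * (2 ^ k * dirderiv b (dirderiv b (ball_bump a R)) x)"
proof -
  have s: "smooth_fun (\<lambda>x. 2 ^ k * ball_bump a R x)" by (intro smooth_intros(4) smooth_intros(1) ball_bump_smooth)
  have e: "dirderiv b (\<lambda>x. 2 ^ k * f x) = (\<lambda>x. 2 ^ k * dirderiv b f x)" if "smooth_fun f" for f :: "'a \<Rightarrow> real"
    by (rule ext) (simp add: dirderiv_product[OF smooth_intros(1) that] dirderiv_const)
  have sd: "smooth_fun (dirderiv b (ball_bump a R))" by (rule smooth_fun_dirderiv[OF ball_bump_smooth])
  have d1: "dirderiv b (\<lambda>x. step_deriv (2 ^ k * ball_bump a R x)) =
      (\<lambda>x. step_deriv2 (2 ^ k * ball_bump a R x) * (2 ^ k * dirderiv b (ball_bump a R) x))"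
    using dirderiv_compose_real[where g=step_deriv and g'=step_deriv2 and v=b,
        OF smooth_fun_differentiable[OF s] step_deriv2_derivative] unfolding e[OF ball_bump_smooth] .
  have df: "(\<lambda>x. step_deriv (2 ^ k * ball_bump a R x)) differentiable (at x)" for x
    using has_derivative_compose_real[OF smooth_fun_differentiable[OF s] step_deriv2_derivative]
    unfolding differentiable_def by blast
  have dg: "(\<lambda>x. 2 ^ k * dirderiv b (ball_bump a R) x) differentiable (at x)" for x
    by (rule smooth_fun_differentiable) (intro smooth_intros(4) smooth_intros(1) sd)
  show ?thesis
    unfolding dirderiv_shell dirderiv_mult[OF df dg] d1 e[OF sd] by (simp add: power2_eq_square algebra_simps)
qed

text \<open>Derivatives of the cutoff live where 1/2 \<le> 2^k s \<le> 1 for s = exp(-1/d). There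
  1/d = -ln s is at most k+1, so 2^k s/d^m is at most (k+1)^m. Each derivative costs two powers of
  1/d, hence two powers of k+1.\<close>

lemma shell_estimates:
  fixes a :: "'a::euclidean_space"
  assumes R: "0 < R"
  obtains D where "1 \<le> D"
    "\<And>k x b. b \<in> Basis \<Longrightarrow> \<bar>dirderiv b (shell_fun a R k) x\<bar> \<le> D * ((real k + 1)\<^sup>2 * in_shell k (ball_bump a R x))"
    "\<And>k x. \<bar>lap (shell_fun a R k) x\<bar> \<le> D * ((real k + 1) ^ 4 * in_shell k (ball_bump a R x))"
proof -
  obtain C where C: "0 < C" "\<And>x. \<bar>step_deriv x\<bar> \<le> C" "\<And>x. \<bar>step_deriv2 x\<bar> \<le> C"
    by (rule step_deriv_bounded) blast
  define n where "n = real DIM('a)"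
  \<comment> \<open>2 R bounds the factor 2 |x - a| in the gradient of the weight. In 16 R^2, the
    share 4 R^2 comes from the square of the gradient and 12 R^2 from the Laplacian of the weight,
    whose bracket is at most 3 (k+1)^4 after scaling by 2^k.\<close>
  define D where "D = C * (2 * R + 16 * R\<^sup>2 + 2 * n) + 1"
  have n: "0 \<le> n" by (simp add: n_def)
  have D1: "C * (2 * R) \<le> D" "C * (16 * R\<^sup>2 + 2 * n) \<le> D" "1 \<le> D"
    unfolding D_def using C(1) R n by (auto simp: distrib_left intro!: add_increasing2 add_increasing)
  have key: "2 ^ k * flat_exp 2 (dep a R x) \<le> (real k + 1)\<^sup>2"
    "2 ^ k * \<bar>flat_exp 4 (dep a R x) - 2 * flat_exp 3 (dep a R x)\<bar> \<le> 3 * (real k + 1) ^ 4"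
    "norm (x - a) \<le> R" "in_shell k (ball_bump a R x) = 1"
    if "1 / 2 \<le> 2 ^ k * ball_bump a R x" "2 ^ k * ball_bump a R x \<le> 1" for k x
  proof -
    define s where "s = ball_bump a R x"
    have s: "0 < s" using that(1) unfolding s_def by (smt (verit) zero_less_mult_iff zero_less_power zero_less_divide_iff)
    then have d: "0 < dep a R x" unfolding s_def ball_bump_dep by (simp add: flat_exp_pos_iff)
    define y where "y = 1 / dep a R x"
    have y: "0 < y" using d by (simp add: y_def)
    have sy: "s = exp (- y)" using d by (simp add: s_def ball_bump_dep flat_exp_def y_def)
    have f: "flat_exp m (dep a R x) = s * y ^ m" for m
      using d by (simp add: flat_exp_def sy y_def power_divide)
    have "1 \<le> 2 ^ (k + 1) * s" using that(1) by (simp add: s_def)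
    then show "in_shell k (ball_bump a R x) = 1" by (simp add: in_shell_def s_def)
    have "ln 1 \<le> ln (2 ^ (k + 1) * s)" using \<open>1 \<le> 2 ^ (k + 1) * s\<close> s by (subst ln_le_cancel_iff) auto
    then have "y \<le> real (k + 1) * ln 2" using s by (simp add: ln_mult ln_realpow sy algebra_simps)
    also have "\<dots> \<le> real (k + 1) * 1" using ln_2_less_1 by (intro mult_left_mono) auto
    finally have yk: "y \<le> real k + 1" by simp
    have 2: "2 ^ k * s \<le> 1" using that(2) by (simp add: s_def)
    have pw: "2 ^ k * (s * y ^ m) \<le> (real k + 1) ^ m" for m
    proof -
      have "(2 ^ k * s) * y ^ m \<le> 1 * (real k + 1) ^ m"
        using 2 y yk s by (intro mult_mono power_mono) auto
      then show ?thesis by (simp add: mult.assoc)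
    qed
    show "2 ^ k * flat_exp 2 (dep a R x) \<le> (real k + 1)\<^sup>2" unfolding f by (rule pw)
    have "2 ^ k * \<bar>s * y ^ 4 - 2 * (s * y ^ 3)\<bar> \<le> 2 ^ k * (s * y ^ 4) + 2 * (2 ^ k * (s * y ^ 3))"
    proof -
      have "\<bar>s * y ^ 4 - 2 * (s * y ^ 3)\<bar> \<le> s * y ^ 4 + 2 * (s * y ^ 3)"
        using s y by (intro abs_leI) auto
      then have "2 ^ k * \<bar>s * y ^ 4 - 2 * (s * y ^ 3)\<bar> \<le> 2 ^ k * (s * y ^ 4 + 2 * (s * y ^ 3))"
        by (intro mult_left_mono) auto
      then show ?thesis by (simp add: algebra_simps)
    qed
    also have "\<dots> \<le> (real k + 1) ^ 4 + 2 * (real k + 1) ^ 3" using pw[of 4] pw[of 3] by linarith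
    also have "(real k + 1) ^ 3 \<le> (real k + 1) ^ 4" by (intro power_increasing) auto
    finally show "2 ^ k * \<bar>flat_exp 4 (dep a R x) - 2 * flat_exp 3 (dep a R x)\<bar> \<le> 3 * (real k + 1) ^ 4"
      unfolding f by simp
    have "(norm (x - a))\<^sup>2 \<le> R\<^sup>2" using d by (simp add: dep_def power2_norm_eq_inner)
    then show "norm (x - a) \<le> R" using R by (simp add: power2_le_iff_abs_le)
  qed
  have zero: "step_deriv (2 ^ k * ball_bump a R x) = 0 \<and> step_deriv2 (2 ^ k * ball_bump a R x) = 0"
    if "\<not> (1 / 2 \<le> 2 ^ k * ball_bump a R x \<and> 2 ^ k * ball_bump a R x \<le> 1)" for k x
    by (rule step_deriv_eq_0) (use that in auto)
  have in0: "0 \<le> in_shell k s" for k s by (simp add: in_shell_def)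
  have grad: "2 ^ k * \<bar>dirderiv b (ball_bump a R) x\<bar> \<le> (real k + 1)\<^sup>2 * (2 * \<bar>(x - a) \<bullet> b\<bar>)"
    if "1 / 2 \<le> 2 ^ k * ball_bump a R x" "2 ^ k * ball_bump a R x \<le> 1" for k x b
  proof -
    have "2 ^ k * \<bar>dirderiv b (ball_bump a R) x\<bar> = (2 ^ k * flat_exp 2 (dep a R x)) * (2 * \<bar>(x - a) \<bullet> b\<bar>)"
      unfolding dirderiv_ball_bump by (simp add: abs_mult flat_exp_nonneg)
    also have "\<dots> \<le> (real k + 1)\<^sup>2 * (2 * \<bar>(x - a) \<bullet> b\<bar>)"
      by (intro mult_right_mono key(1)[OF that]) auto
    finally show ?thesis .
  qed
  show ?thesis
  proof (rule that[of D])
    show "1 \<le> D" by (rule D1)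
    fix k x
    show "\<bar>dirderiv b (shell_fun a R k) x\<bar> \<le> D * ((real k + 1)\<^sup>2 * in_shell k (ball_bump a R x))"
      if b: "b \<in> Basis" for b
    proof (cases "1 / 2 \<le> 2 ^ k * ball_bump a R x \<and> 2 ^ k * ball_bump a R x \<le> 1")
      case True
      then have h: "1 / 2 \<le> 2 ^ k * ball_bump a R x" "2 ^ k * ball_bump a R x \<le> 1" by auto
      have "\<bar>(x - a) \<bullet> b\<bar> \<le> R" using Basis_le_norm[OF b, of "x - a"] key(3)[OF h] by simp
      then have "2 ^ k * \<bar>dirderiv b (ball_bump a R) x\<bar> \<le> (real k + 1)\<^sup>2 * (2 * R)"
        by (intro order_trans[OF grad[OF h]] mult_left_mono) auto
      then have "\<bar>step_deriv (2 ^ k * ball_bump a R x)\<bar> * (2 ^ k * \<bar>dirderiv b (ball_bump a R) x\<bar>) \<le> C * ((real k + 1)\<^sup>2 * (2 * R))"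
        using C(1) by (intro mult_mono[OF C(2)]) auto
      then have "\<bar>dirderiv b (shell_fun a R k) x\<bar> \<le> C * ((real k + 1)\<^sup>2 * (2 * R))"
        unfolding dirderiv_shell by (simp add: abs_mult)
      also have "\<dots> = (C * (2 * R)) * (real k + 1)\<^sup>2" by (simp only: mult_ac)
      also have "\<dots> \<le> D * (real k + 1)\<^sup>2" by (intro mult_right_mono D1) auto
      finally show ?thesis using key(4)[OF h] by simp
    next
      case False
      then show ?thesis unfolding dirderiv_shell using zero[OF False] D1(3) in0 by simp
    qed
    show "\<bar>lap (shell_fun a R k) x\<bar> \<le> D * ((real k + 1) ^ 4 * in_shell k (ball_bump a R x))"
    proof (cases "1 / 2 \<le> 2 ^ k * ball_bump a R x \<and> 2 ^ k * ball_bump a R x \<le> 1")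
      case True
      then have h: "1 / 2 \<le> 2 ^ k * ball_bump a R x" "2 ^ k * ball_bump a R x \<le> 1" by auto
      define L where "L = (real k + 1) ^ 4"
      have nR: "(x - a) \<bullet> (x - a) \<le> R\<^sup>2"
        using power_mono[OF key(3)[OF h] norm_ge_zero, of 2] by (simp add: power2_norm_eq_inner)
      have e: "lap (shell_fun a R k) x = step_deriv2 (2 ^ k * ball_bump a R x) * (\<Sum>b\<in>Basis. (2 ^ k * dirderiv b (ball_bump a R) x)\<^sup>2)
          + step_deriv (2 ^ k * ball_bump a R x) * (2 ^ k * lap (ball_bump a R) x)"
        unfolding lap_def dirderiv2_shell sum.distrib sum_distrib_left ..
      have "(\<Sum>b\<in>Basis. (2 ^ k * dirderiv b (ball_bump a R) x)\<^sup>2) \<le> (\<Sum>b\<in>Basis. L * 4 * ((x - a) \<bullet> b)\<^sup>2)"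
      proof (rule sum_mono)
        fix b :: 'a
        have "\<bar>2 ^ k * dirderiv b (ball_bump a R) x\<bar>\<^sup>2 \<le> ((real k + 1)\<^sup>2 * (2 * \<bar>(x - a) \<bullet> b\<bar>))\<^sup>2"
          by (intro power_mono) (use grad[OF h, of b] in \<open>simp_all add: abs_mult\<close>)
        then show "(2 ^ k * dirderiv b (ball_bump a R) x)\<^sup>2 \<le> L * 4 * ((x - a) \<bullet> b)\<^sup>2"
          by (simp add: L_def power_mult_distrib power_mult[symmetric])
      qed
      also have "\<dots> = L * 4 * ((x - a) \<bullet> (x - a))"
        unfolding inner_eq_sum_squares sum_distrib_left ..
      also have "\<dots> \<le> L * 4 * R\<^sup>2" using nR by (intro mult_left_mono) (auto simp: L_def)
      finally have q: "(\<Sum>b\<in>Basis. (2 ^ k * dirderiv b (ball_bump a R) x)\<^sup>2) \<le> L * (4 * R\<^sup>2)" by simp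
      have k2: "2 ^ k * flat_exp 2 (dep a R x) \<le> L"
      proof -
        have "(real k + 1)\<^sup>2 \<le> (real k + 1) ^ 4" by (intro power_increasing) auto
        then show ?thesis using key(1)[OF h] by (simp add: L_def)
      qed
      have "2 ^ k * \<bar>lap (ball_bump a R) x\<bar> \<le> 4 * ((x - a) \<bullet> (x - a)) * (2 ^ k * \<bar>flat_exp 4 (dep a R x) - 2 * flat_exp 3 (dep a R x)\<bar>)
          + 2 * n * (2 ^ k * flat_exp 2 (dep a R x))"
      proof -
        have "\<bar>lap (ball_bump a R) x\<bar> \<le> \<bar>4 * ((x - a) \<bullet> (x - a)) * (flat_exp 4 (dep a R x) - 2 * flat_exp 3 (dep a R x))\<bar>
            + \<bar>2 * n * flat_exp 2 (dep a R x)\<bar>"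
          unfolding lap_ball_bump n_def by (rule abs_triangle_ineq4)
        also have "\<dots> = 4 * ((x - a) \<bullet> (x - a)) * \<bar>flat_exp 4 (dep a R x) - 2 * flat_exp 3 (dep a R x)\<bar> + 2 * n * flat_exp 2 (dep a R x)"
          using n by (simp add: abs_mult flat_exp_nonneg)
        finally have "2 ^ k * \<bar>lap (ball_bump a R) x\<bar> \<le> 2 ^ k * \<dots>" by (intro mult_left_mono) auto
        then show ?thesis by (simp add: algebra_simps)
      qed
      also have "\<dots> \<le> 4 * R\<^sup>2 * (3 * L) + 2 * n * L"
      proof (rule add_mono)
        show "4 * ((x - a) \<bullet> (x - a)) * (2 ^ k * \<bar>flat_exp 4 (dep a R x) - 2 * flat_exp 3 (dep a R x)\<bar>) \<le> 4 * R\<^sup>2 * (3 * L)"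
          by (rule mult_mono) (use nR key(2)[OF h] in \<open>auto simp: L_def\<close>)
        show "2 * n * (2 ^ k * flat_exp 2 (dep a R x)) \<le> 2 * n * L"
          by (rule mult_left_mono[OF k2]) (use n in simp)
      qed
      finally have l: "2 ^ k * \<bar>lap (ball_bump a R) x\<bar> \<le> L * (12 * R\<^sup>2 + 2 * n)" by (simp add: algebra_simps)
      have "\<bar>lap (shell_fun a R k) x\<bar> \<le> C * (L * (4 * R\<^sup>2)) + C * (L * (12 * R\<^sup>2 + 2 * n))"
        unfolding e
      proof (rule order_trans[OF abs_triangle_ineq add_mono])
        show "\<bar>step_deriv2 (2 ^ k * ball_bump a R x) * (\<Sum>b\<in>Basis. (2 ^ k * dirderiv b (ball_bump a R) x)\<^sup>2)\<bar> \<le> C * (L * (4 * R\<^sup>2))"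
          unfolding abs_mult by (rule mult_mono[OF C(3)]) (use q C(1) in \<open>auto simp: sum_nonneg\<close>)
        show "\<bar>step_deriv (2 ^ k * ball_bump a R x) * (2 ^ k * lap (ball_bump a R) x)\<bar> \<le> C * (L * (12 * R\<^sup>2 + 2 * n))"
          unfolding abs_mult[of "step_deriv _"] by (rule mult_mono[OF C(2)]) (use l C(1) in \<open>auto simp: abs_mult\<close>)
      qed
      also have "\<dots> = (C * (16 * R\<^sup>2 + 2 * n)) * L" by (simp add: algebra_simps)
      also have "\<dots> \<le> D * L" by (intro mult_right_mono D1) (simp add: L_def)
      finally show ?thesis using key(4)[OF h] by (simp add: L_def)
    next
      case False
      then show ?thesis unfolding lap_def dirderiv2_shell using zero[OF False] D1(3) in0 by simp
    qed
  qed
qed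

text \<open>Near the boundary of the ball the weight is strongly convex in the radial direction, so its
  Laplacian absorbs all lower-order terms.\<close>

lemma weight_absorption:
  fixes a :: "'a::euclidean_space"
  assumes R: "0 < R" and C: "0 \<le> C"
  obtains B where "0 \<le> B"
    "\<And>x. C * (flat_exp 0 (dep a R x) + flat_exp 2 (dep a R x)) - lap (ball_bump a R) x \<le> B * ball_bump a R x"
proof -
  define n where "n = real DIM('a)"
  \<comment> \<open>Inserting |x - a|^2 = R^2 - 1/y, with y = 1/d, into minus the Laplacian divided
    by the weight leaves exactly this coefficient in front of y^3.\<close>
  define A where "A = 8 * R\<^sup>2 + 4"
  define E where "E = C + 2 * n + A\<^sup>2 / (8 * R\<^sup>2)"
  define B where "B = C + E\<^sup>2 / (8 * R\<^sup>2)"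
  have n: "0 \<le> n" by (simp add: n_def)
  show ?thesis
  proof (rule that[of B])
    show "0 \<le> B" unfolding B_def using C R by (intro add_nonneg_nonneg) auto
    fix x
    show "C * (flat_exp 0 (dep a R x) + flat_exp 2 (dep a R x)) - lap (ball_bump a R) x \<le> B * ball_bump a R x"
    proof (cases "0 < dep a R x")
      case False
      then show ?thesis unfolding lap_ball_bump by (simp add: ball_bump_dep flat_exp_def)
    next
      case True
      define y where "y = 1 / dep a R x"
      define s where "s = exp (- y)"
      have y: "0 < y" using True by (simp add: y_def)
      have f: "flat_exp m (dep a R x) = s * y ^ m" for m
        using True by (simp add: flat_exp_def s_def y_def power_divide)
      have r: "(x - a) \<bullet> (x - a) = R\<^sup>2 - 1 / y" using True by (simp add: y_def dep_def)
      \<comment> \<open>Two completed squares each spend half of the negative term -4 R^2 y^4: this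
        one trades y^3 for y^2, the next one trades y^2 for a constant.\<close>
      have sq: "A * y ^ 3 \<le> 2 * R\<^sup>2 * y ^ 4 + A\<^sup>2 / (8 * R\<^sup>2) * y\<^sup>2"
      proof -
        have "0 \<le> (y\<^sup>2 * R * 2 - A * y / (2 * R))\<^sup>2 / 2" by simp
        also have "\<dots> = 2 * R\<^sup>2 * y ^ 4 + A\<^sup>2 / (8 * R\<^sup>2) * y\<^sup>2 - A * y ^ 3"
          using R by (simp add: power2_eq_square power3_eq_cube power4_eq_xxxx field_simps)
        finally show ?thesis by simp
      qed
      have sq2: "E * y\<^sup>2 \<le> 2 * R\<^sup>2 * y ^ 4 + E\<^sup>2 / (8 * R\<^sup>2)"
      proof -
        have "0 \<le> (y\<^sup>2 * R * 2 - E / (2 * R))\<^sup>2 / 2" by simp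
        also have "\<dots> = 2 * R\<^sup>2 * y ^ 4 + E\<^sup>2 / (8 * R\<^sup>2) - E * y\<^sup>2"
          using R by (simp add: power2_eq_square power4_eq_xxxx field_simps)
        finally show ?thesis by simp
      qed
      have "C * (1 + y\<^sup>2) - 4 * (R\<^sup>2 - 1 / y) * (y ^ 4 - 2 * y ^ 3) + 2 * n * y\<^sup>2
          = C + (C + 2 * n - 8) * y\<^sup>2 - 4 * R\<^sup>2 * y ^ 4 + A * y ^ 3"
        using y by (simp add: A_def power2_eq_square power3_eq_cube power4_eq_xxxx field_simps)
      also have "\<dots> \<le> C + E * y\<^sup>2 - 2 * R\<^sup>2 * y ^ 4"
        using sq by (simp add: E_def algebra_simps add_increasing)
      also have "\<dots> \<le> B" using sq2 by (simp add: B_def)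
      finally have "s * (C * (1 + y\<^sup>2) - 4 * (R\<^sup>2 - 1 / y) * (y ^ 4 - 2 * y ^ 3) + 2 * n * y\<^sup>2) \<le> s * B"
        by (intro mult_left_mono) (simp_all add: s_def)
      then show ?thesis
        unfolding lap_ball_bump unfolding ball_bump_dep f r n_def[symmetric] by (simp add: algebra_simps)
    qed
  qed
qed

section \<open>Local bounds of the mass near time zero\<close>

context hj_solution
begin

lemma ff_nonneg: "0 \<le> ff p"
  by (simp add: ff_def)

lemma loc_int_const: "loc_int (\<lambda>p. c)"
  unfolding loc_int_def set_integrable_def
proof (intro allI impI)
  fix C :: "('a \<times> real) set" assume "compact C"
  then have "C \<in> lmeasurable" by (rule lmeasurable_compact)
  then have "integrable lebesgue (indicator C :: _ \<Rightarrow> real)"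
    by (intro integrable_real_indicator) (auto simp: fmeasurable_def)
  then show "integrable lebesgue (\<lambda>x. indicat_real C x *\<^sub>R c)" by simp
qed

lemma loc_int_add: "loc_int F \<Longrightarrow> loc_int G \<Longrightarrow> loc_int (\<lambda>p. F p + G p)"
  unfolding loc_int_def by (auto intro: set_integral_add)

lemma loc_int_sum: "(\<And>i. i \<in> I \<Longrightarrow> loc_int (F i)) \<Longrightarrow> loc_int (\<lambda>p. \<Sum>i\<in>I. F i p)"
  by (induction I rule: infinite_finite_induct) (auto simp: loc_int_const loc_int_add)

lemma mass_add:
  assumes "Cc_fun \<Omega> \<phi>" "Cc_fun \<Omega> \<psi>" "t \<in> tint T"
  shows "mass (\<lambda>x. \<phi> x + \<psi> x) t = mass \<phi> t + mass \<psi> t"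
  unfolding mass_def using mass_integrable[OF assms(1,3)] mass_integrable[OF assms(2,3)]
  by (simp add: distrib_left)

lemma mass_cmult: "mass (\<lambda>x. c * \<phi> x) t = c * mass \<phi> t"
  unfolding mass_def by (simp add: mult.left_commute)

lemma mass_zero: "mass (\<lambda>x. 0) t = 0"
  by (simp add: mass_def)

lemma mass_sum:
  assumes "\<And>i. i \<in> I \<Longrightarrow> Cc_fun \<Omega> (\<psi> i)" "t \<in> tint T"
  shows "mass (\<lambda>x. \<Sum>i\<in>I. w i * \<psi> i x) t = (\<Sum>i\<in>I. w i * mass (\<psi> i) t)"
  using assms(1)
  by (induction I rule: infinite_finite_induct)
    (auto simp: mass_zero mass_add mass_cmult Cc_fun_sum Cc_fun_cmult assms(2))

lemma mass_mono:
  assumes "Cc_fun \<Omega> \<phi>" "Cc_fun \<Omega> \<psi>" "t \<in> tint T" "\<And>x. \<phi> x \<le> \<psi> x"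
  shows "mass \<phi> t \<le> mass \<psi> t"
proof -
  have "0 \<le> mass (\<lambda>x. \<psi> x + (-1) * \<phi> x) t"
    by (rule mass_nonneg[OF Cc_fun_add[OF assms(2) Cc_fun_cmult[OF assms(1)]]]) (use assms in auto)
  then show ?thesis
    unfolding mass_add[OF assms(2) Cc_fun_cmult[OF assms(1)] assms(3)] mass_cmult by simp
qed

lemma mass_sum_le:
  assumes "\<And>k. Cc_fun \<Omega> (\<psi> k)" "Cc_fun \<Omega> \<Psi>" "t \<in> tint T" "\<And>x. (\<Sum>k<K. w k * \<psi> k x) \<le> \<Psi> x"
  shows "(\<Sum>k<K. w k * mass (\<psi> k) t) \<le> mass \<Psi> t"
  using mass_mono[OF Cc_fun_sum[OF Cc_fun_cmult[OF assms(1)]] assms(2,3,4)]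
  by (simp add: mass_sum[OF assms(1) assms(3)])

context
  fixes t1 t2 :: real
  assumes t1: "0 < t1" and t12: "t1 \<le> t2" and t2: "t2 \<in> tint T"
begin

lemma slab_add:
  assumes F: "loc_int F" and \<phi>: "Cc_fun \<Omega> \<phi>" and \<psi>: "Cc_fun \<Omega> \<psi>"
  shows "slab t1 t2 F (\<lambda>x. \<phi> x + \<psi> x) = slab t1 t2 F \<phi> + slab t1 t2 F \<psi>"
  unfolding slab_def using slab_integrable[OF t1 t12 t2 F \<phi>] slab_integrable[OF t1 t12 t2 F \<psi>]
  by (simp add: distrib_left distrib_right)

lemma slab_cmult: "slab t1 t2 F (\<lambda>x. c * \<phi> x) = c * slab t1 t2 F \<phi>"
  unfolding slab_def by (simp add: mult.left_commute mult.assoc)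

lemma slab_zero: "slab t1 t2 F (\<lambda>x. 0) = 0"
  by (simp add: slab_def)

lemma slab_fun_add:
  assumes F: "loc_int F" and G: "loc_int G" and \<phi>: "Cc_fun \<Omega> \<phi>"
  shows "slab t1 t2 (\<lambda>p. F p + G p) \<phi> = slab t1 t2 F \<phi> + slab t1 t2 G \<phi>"
  unfolding slab_def using slab_integrable[OF t1 t12 t2 F \<phi>] slab_integrable[OF t1 t12 t2 G \<phi>]
  by (simp add: distrib_right)

lemma slab_fun_sum:
  assumes F: "\<And>i. i \<in> I \<Longrightarrow> loc_int (F i)" and \<phi>: "Cc_fun \<Omega> \<phi>"
  shows "slab t1 t2 (\<lambda>p. \<Sum>i\<in>I. F i p) \<phi> = (\<Sum>i\<in>I. slab t1 t2 (F i) \<phi>)"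
  using F
proof (induction I rule: infinite_finite_induct)
  case (insert i I)
  then show ?case using slab_fun_add[OF _ loc_int_sum \<phi>, of "F i" I F] by simp
qed (simp_all add: slab_def)

lemma slab_fun_mono:
  assumes F: "loc_int F" and G: "loc_int G" and \<phi>: "Cc_fun \<Omega> \<phi>" and "\<And>p. F p \<le> G p" "\<And>x. 0 \<le> \<phi> x"
  shows "slab t1 t2 F \<phi> \<le> slab t1 t2 G \<phi>"
  unfolding slab_def
  by (intro integral_mono slab_integrable[OF t1 t12 t2] F G \<phi> mult_right_mono assms(4) mult_nonneg_nonneg assms(5)) auto

lemma slab_nonneg:
  assumes "\<And>p. 0 \<le> F p" "\<And>x. 0 \<le> \<phi> x"
  shows "0 \<le> slab t1 t2 F \<phi>"
  unfolding slab_def by (intro integral_nonneg_AE AE_I2 mult_nonneg_nonneg assms) auto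

lemma slab_sum:
  assumes F: "loc_int F" and \<psi>: "\<And>i. i \<in> I \<Longrightarrow> Cc_fun \<Omega> (\<psi> i)"
  shows "slab t1 t2 F (\<lambda>x. \<Sum>i\<in>I. w i * \<psi> i x) = (\<Sum>i\<in>I. w i * slab t1 t2 F (\<psi> i))"
  using \<psi>
  by (induction I rule: infinite_finite_induct)
    (auto simp: slab_zero slab_add[OF F] slab_cmult Cc_fun_sum Cc_fun_cmult)

lemma slab_sum_le:
  assumes F: "loc_int F" "\<And>p. 0 \<le> F p" and \<psi>: "\<And>k. Cc_fun \<Omega> (\<psi> k)" and \<Psi>: "Cc_fun \<Omega> \<Psi>"
    and le: "\<And>x. (\<Sum>k<K. w k * \<psi> k x) \<le> \<Psi> x"
  shows "(\<Sum>k<K. w k * slab t1 t2 F (\<psi> k)) \<le> slab t1 t2 F \<Psi>"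
  using slab_mono[OF t1 t12 t2 F(1) Cc_fun_sum[OF Cc_fun_cmult[OF \<psi>]] \<Psi> le F(2)]
  by (simp add: slab_sum[OF F(1) \<psi>])

end

context
  fixes a :: 'a and R :: real
  assumes R: "0 < R" and ball: "cball a R \<subseteq> \<Omega>"
begin

section \<open>The weight on one ball and the bound on its mass\<close>

definition h0 :: "'a \<Rightarrow> real" where "h0 = ball_bump a R"
text \<open>The weight times 1 + 1/d^2: the density in which all lower-order terms containing u are
  collected before the Laplacian absorbs them.\<close>

definition h02 :: "'a \<Rightarrow> real" where "h02 x = flat_exp 0 (dep a R x) + flat_exp 2 (dep a R x)"

lemma h0_test: "test_fun \<Omega> h0"
  unfolding h0_def by (rule ball_bump_test[OF R ball])

lemma h0_nonneg: "0 \<le> h0 x" and h02_nonneg: "0 \<le> h02 x"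
  by (auto simp: h0_def h02_def ball_bump_nonneg flat_exp_nonneg)

lemma h0_less_1: "h0 x < 1"
  unfolding h0_def ball_bump_dep by (rule flat_exp_0_less_1)

lemma h0_Cc: "Cc_fun \<Omega> h0" by (rule test_fun_Cc[OF h0_test])

lemma h02_Cc: "Cc_fun \<Omega> h02"
proof (rule Cc_fun_dominated[OF h0_Cc])
  show "continuous_on UNIV h02"
    unfolding h02_def[abs_def]
    by (intro smooth_fun_continuous smooth_intros(3) smooth_intros(5) smooth_dep)
  show "h02 x = 0" if "h0 x = 0" for x
    using that unfolding h02_def h0_def ball_bump_dep by (auto simp: flat_exp_def split: if_splits)
qed

lemma shell_test: "test_fun \<Omega> (shell_fun a R k)"
  by (rule shell_fun_test[OF h0_test[unfolded h0_def]])

text \<open>At level k the slab estimate is used at scale \<kappa>/(k+1)^2 and weighted by 2^-k. All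
  terms with u turn into sums of 2^-k (k+1)^2, bounded by \<open>h02\<close>. Those with f, the
  masses and the gradient turn into sums of 2^-k, bounded by \<open>h0\<close>, and carry the factor
  c \<kappa>. The coefficient 1/2 of the masses is what allows the energy identity to absorb the
  mass at t1.\<close>

lemma weighted_gradient:
  "\<exists>C\<ge>0. \<forall>t1 t2. 0 < t1 \<longrightarrow> t1 \<le> t2 \<longrightarrow> t2 \<in> tint T \<longrightarrow>
    slab t1 t2 ff h0 \<le> C * slab t1 t2 (\<lambda>p. \<bar>uu p\<bar>) h02 + 2 * slab t1 t2 (\<lambda>p. 1) h0 + (mass h0 t1 + mass h0 t2) / 2"
proof -
  obtain c where c: "0 < c" and est: "\<And>b \<phi> \<rho> t1 t2. b \<in> Basis \<Longrightarrow> test_fun \<Omega> \<phi> \<Longrightarrow> (\<forall>x. 0 \<le> \<phi> x) \<Longrightarrow> 0 < \<rho> \<Longrightarrow> 0 < t1 \<Longrightarrow> t1 \<le> t2 \<Longrightarrow> t2 \<in> tint T \<Longrightarrow>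
    slab t1 t2 (\<lambda>p. \<bar>gi b p\<bar>) \<phi> \<le> slab t1 t2 (\<lambda>p. \<bar>uu p\<bar>) (\<lambda>x. \<bar>dirderiv b \<phi> x\<bar>)
    + c / \<rho> * slab t1 t2 (\<lambda>p. \<bar>uu p\<bar>) \<phi>
    + c * \<rho> * (slab t1 t2 (\<lambda>p. \<bar>ff p\<bar>) \<phi> + (mass \<phi> t1 + mass \<phi> t2) + slab t1 t2 (\<lambda>p. \<bar>uu p\<bar>) (\<lambda>x. \<bar>lap \<phi> x\<bar>)
      + 2 * (\<Sum>a\<in>Basis. slab t1 t2 (\<lambda>p. \<bar>gi a p\<bar>) (\<lambda>x. \<bar>dirderiv a \<phi> x\<bar>)))"
    using gradient_slab by blast
  obtain D where D: "1 \<le> D"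
    "\<And>k x b. b \<in> Basis \<Longrightarrow> \<bar>dirderiv b (shell_fun a R k) x\<bar> \<le> D * ((real k + 1)\<^sup>2 * in_shell k (ball_bump a R x))"
    "\<And>k x. \<bar>lap (shell_fun a R k) x\<bar> \<le> D * ((real k + 1) ^ 4 * in_shell k (ball_bump a R x))"
    by (rule shell_estimates[OF R, of a]) blast
  define n where "n = real DIM('a)"
  have n: "1 \<le> n" unfolding n_def using DIM_positive[where 'a='a] by linarith
  \<comment> \<open>With 128 the gradient sum that returns on the right has coefficient 16 n c
    \<kappa> D = 1/8, and the terms with f and the masses have coefficient 8 n c \<kappa>, at most
    1/16.\<close>
  define \<kappa> where "\<kappa> = 1 / (128 * n * c * D)"
  have \<kappa>: "0 < \<kappa>" unfolding \<kappa>_def using n c D(1) by simp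
  \<comment> \<open>Twice the coefficient of the u term in 2 n Q. The factor 2 pays for the division
    by what is left of \<Gamma> after absorption.\<close>
  define C where "C = 4 * n * (384 * D + c / \<kappa> * 384 + c * \<kappa> * (384 * D))"
  have C: "0 \<le> C" unfolding C_def using n c D(1) \<kappa> by (intro mult_nonneg_nonneg add_nonneg_nonneg) auto
  show ?thesis
  proof (intro exI[of _ C] conjI C allI impI)
    fix t1 t2 :: real assume t: "0 < t1" "t1 \<le> t2" "t2 \<in> tint T"
    have t1T: "t1 \<in> tint T" by (rule t1_tint[OF t])
    let ?w = "\<lambda>k. (1/2) ^ k :: real"
    let ?l = "\<lambda>k. (real k + 1)\<^sup>2"
    let ?f = "\<lambda>k. shell_fun a R k"
    let ?S = "slab t1 t2 (\<lambda>p. \<bar>uu p\<bar>) h02"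
    let ?F = "slab t1 t2 (\<lambda>p. \<bar>ff p\<bar>) h0"
    let ?G = "\<lambda>b. slab t1 t2 (\<lambda>p. \<bar>gi b p\<bar>) h0"
    have fC: "Cc_fun \<Omega> (?f k)" for k by (rule test_fun_Cc[OF shell_test])
    have dC: "Cc_fun \<Omega> (\<lambda>x. \<bar>dirderiv b (?f k) x\<bar>)" for b k
      by (rule Cc_fun_abs[OF test_fun_Cc[OF test_fun_dirderiv[OF shell_test]]])
    have lC: "Cc_fun \<Omega> (\<lambda>x. \<bar>lap (?f k) x\<bar>)" for k
      by (rule Cc_fun_abs[OF test_fun_Cc[OF lap_test_fun[OF shell_test]]])
    have l1: "1 \<le> ?l k" for k by (rule one_le_power) simp
    have in0: "0 \<le> in_shell k s" for k s by (simp add: in_shell_def)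
    have cancel: "(v / l) * (D * (l * l * i)) = D * (v * (l * i))" if "l \<noteq> 0" for v l i :: real
      using that by simp
    have S0: "(\<Sum>k<K. ?w k * in_shell k (h0 x)) \<le> 4 * h0 x" for K x
      by (rule shell_sum[OF h0_nonneg])
    have S2: "(\<Sum>k<K. ?w k * (?l k * in_shell k (h0 x))) \<le> 384 * h02 x" for K x
      using shell_sum_squares[where d="dep a R x"] unfolding h02_def h0_def ball_bump_dep .
    have sum_le: "(\<Sum>k<K. v k * y k) \<le> A * B" if "\<And>k. v k * y k \<le> A * z k" "(\<Sum>k<K. z k) \<le> B" "0 \<le> A" for v y z :: "nat \<Rightarrow> real" and A B K
    proof -
      have "(\<Sum>k<K. v k * y k) \<le> (\<Sum>k<K. A * z k)" by (intro sum_mono that)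
      also have "\<dots> = A * (\<Sum>k<K. z k)" by (simp add: sum_distrib_left)
      also have "\<dots> \<le> A * B" by (intro mult_left_mono that)
      finally show ?thesis .
    qed
    \<comment> \<open>The six bounds \<open>a1\<close> to \<open>a6\<close> share one pattern: the
      sum over levels is moved inside the integral by linearity, and its integrand is bounded
      pointwise by a multiple of \<open>h02\<close> or \<open>h0\<close>.\<close>
    have a1: "(\<Sum>k<K. ?w k * slab t1 t2 (\<lambda>p. \<bar>uu p\<bar>) (\<lambda>x. \<bar>dirderiv b (?f k) x\<bar>)) \<le> (D * 384) * ?S" if b: "b \<in> Basis" for K b
    proof -
      have "(\<Sum>k<K. ?w k * slab t1 t2 (\<lambda>p. \<bar>uu p\<bar>) (\<lambda>x. \<bar>dirderiv b (?f k) x\<bar>)) \<le> slab t1 t2 (\<lambda>p. \<bar>uu p\<bar>) (\<lambda>x. (D * 384) * h02 x)"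
      proof (rule slab_sum_le[OF t loc_int_abs[OF loc_int_uu] _ dC Cc_fun_cmult[OF h02_Cc]])
        fix x
        show "(\<Sum>k<K. ?w k * \<bar>dirderiv b (?f k) x\<bar>) \<le> (D * 384) * h02 x"
          unfolding mult.assoc
        proof (rule sum_le[OF _ S2])
          show "?w k * \<bar>dirderiv b (?f k) x\<bar> \<le> D * (?w k * (?l k * in_shell k (h0 x)))" for k
            using mult_left_mono[OF D(2)[OF b, of k x], of "?w k"] by (simp add: h0_def mult_ac)
        qed (use D in simp)
      qed simp
      then show ?thesis by (simp only: slab_cmult[OF t])
    qed
    have a2: "(\<Sum>k<K. (?w k * ?l k) * slab t1 t2 (\<lambda>p. \<bar>uu p\<bar>) (?f k)) \<le> 384 * ?S" for K
    proof -
      have "(\<Sum>k<K. (?w k * ?l k) * slab t1 t2 (\<lambda>p. \<bar>uu p\<bar>) (?f k)) \<le> slab t1 t2 (\<lambda>p. \<bar>uu p\<bar>) (\<lambda>x. 384 * h02 x)"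
      proof (rule slab_sum_le[OF t loc_int_abs[OF loc_int_uu] _ fC Cc_fun_cmult[OF h02_Cc]])
        fix x
        have "(\<Sum>k<K. (?w k * ?l k) * ?f k x) \<le> 1 * (384 * h02 x)"
        proof (rule sum_le[OF _ S2])
          show "?w k * ?l k * ?f k x \<le> 1 * (?w k * (?l k * in_shell k (h0 x)))" for k
            using mult_left_mono[OF shell_fun_bounds(2)[of a R k x], of "?w k * ?l k"] by (simp add: h0_def mult_ac)
        qed simp
        then show "(\<Sum>k<K. (?w k * ?l k) * ?f k x) \<le> 384 * h02 x" by simp
      qed simp
      then show ?thesis by (simp only: slab_cmult[OF t])
    qed
    have a3: "(\<Sum>k<K. (?w k / ?l k) * slab t1 t2 (\<lambda>p. \<bar>uu p\<bar>) (\<lambda>x. \<bar>lap (?f k) x\<bar>)) \<le> (D * 384) * ?S" for K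
    proof -
      have "(\<Sum>k<K. (?w k / ?l k) * slab t1 t2 (\<lambda>p. \<bar>uu p\<bar>) (\<lambda>x. \<bar>lap (?f k) x\<bar>)) \<le> slab t1 t2 (\<lambda>p. \<bar>uu p\<bar>) (\<lambda>x. (D * 384) * h02 x)"
      proof (rule slab_sum_le[OF t loc_int_abs[OF loc_int_uu] _ lC Cc_fun_cmult[OF h02_Cc]])
        fix x
        show "(\<Sum>k<K. (?w k / ?l k) * \<bar>lap (?f k) x\<bar>) \<le> (D * 384) * h02 x"
          unfolding mult.assoc
        proof (rule sum_le[OF _ S2])
          fix k
          have "(?w k / ?l k) * \<bar>lap (?f k) x\<bar> \<le> (?w k / ?l k) * (D * ((real k + 1) ^ 4 * in_shell k (ball_bump a R x)))"
            by (intro mult_left_mono D(3)) auto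
          also have "(real k + 1) ^ 4 = ?l k * ?l k" by (simp add: power2_eq_square power4_eq_xxxx)
          also have "(?w k / ?l k) * (D * (?l k * ?l k * in_shell k (ball_bump a R x))) = D * (?w k * (?l k * in_shell k (h0 x)))"
            unfolding h0_def by (rule cancel) (use l1[of k] in linarith)
          finally show "(?w k / ?l k) * \<bar>lap (?f k) x\<bar> \<le> D * (?w k * (?l k * in_shell k (h0 x)))" .
        qed (use D in simp)
      qed simp
      then show ?thesis by (simp only: slab_cmult[OF t])
    qed
    have fb: "(\<Sum>k<K. (?w k / ?l k) * ?f k x) \<le> 4 * h0 x" for K x
    proof -
      have "(\<Sum>k<K. (?w k / ?l k) * ?f k x) \<le> 1 * (4 * h0 x)"
      proof (rule sum_le[OF _ S0])
        fix k
        have "?w k / ?l k \<le> ?w k" using l1[of k] by (simp add: divide_le_eq mult_le_cancel_left1)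
        then show "(?w k / ?l k) * ?f k x \<le> 1 * (?w k * in_shell k (h0 x))"
          unfolding h0_def mult_1 using in0 by (intro mult_mono shell_fun_bounds) auto
      qed simp
      then show ?thesis by simp
    qed
    have a4: "(\<Sum>k<K. (?w k / ?l k) * slab t1 t2 (\<lambda>p. \<bar>ff p\<bar>) (?f k)) \<le> 4 * ?F" for K
      using slab_sum_le[OF t loc_int_abs[OF loc_int_ff] _ fC Cc_fun_cmult[OF h0_Cc] fb, of K] by (simp only: slab_cmult[OF t] abs_ge_zero)
    have a5: "(\<Sum>k<K. (?w k / ?l k) * mass (?f k) s) \<le> 4 * mass h0 s" if "s \<in> tint T" for K s
      using mass_sum_le[OF fC Cc_fun_cmult[OF h0_Cc] that fb, of K] by (simp only: mass_cmult)
    have a6: "(\<Sum>k<K. (?w k / ?l k) * slab t1 t2 (\<lambda>p. \<bar>gi b p\<bar>) (\<lambda>x. \<bar>dirderiv b (?f k) x\<bar>)) \<le> (D * 4) * ?G b" if b: "b \<in> Basis" for K b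
    proof -
      have "(\<Sum>k<K. (?w k / ?l k) * slab t1 t2 (\<lambda>p. \<bar>gi b p\<bar>) (\<lambda>x. \<bar>dirderiv b (?f k) x\<bar>)) \<le> slab t1 t2 (\<lambda>p. \<bar>gi b p\<bar>) (\<lambda>x. (D * 4) * h0 x)"
      proof (rule slab_sum_le[OF t loc_int_abs[OF loc_int_gi] _ dC Cc_fun_cmult[OF h0_Cc]])
        fix x
        show "(\<Sum>k<K. (?w k / ?l k) * \<bar>dirderiv b (?f k) x\<bar>) \<le> (D * 4) * h0 x"
          unfolding mult.assoc
        proof (rule sum_le[OF _ S0])
          fix k
          have "(?w k / ?l k) * \<bar>dirderiv b (?f k) x\<bar> \<le> (?w k / ?l k) * (D * (?l k * in_shell k (ball_bump a R x)))"
            by (intro mult_left_mono D(2) b) auto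
          also have "\<dots> = D * (?w k * in_shell k (h0 x))" using l1[of k] by (simp add: h0_def)
          finally show "(?w k / ?l k) * \<bar>dirderiv b (?f k) x\<bar> \<le> D * (?w k * in_shell k (h0 x))" .
        qed (use D in simp)
      qed simp
      then show ?thesis by (simp only: slab_cmult[OF t])
    qed
    define \<Gamma> where "\<Gamma> = (\<Sum>b\<in>Basis. ?G b)"
    define Q where "Q = (384 * D + c / \<kappa> * 384 + c * \<kappa> * (384 * D)) * ?S + c * \<kappa> * (4 * ?F + 4 * mass h0 t1 + 4 * mass h0 t2 + 8 * D * \<Gamma>)"
    have main: "(\<Sum>k<K. ?w k * slab t1 t2 (\<lambda>p. \<bar>gi b p\<bar>) (?f k)) \<le> Q" if b: "b \<in> Basis" for K b
    proof -
      let ?X1 = "\<lambda>k. slab t1 t2 (\<lambda>p. \<bar>uu p\<bar>) (\<lambda>x. \<bar>dirderiv b (?f k) x\<bar>)"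
      let ?X2 = "\<lambda>k. slab t1 t2 (\<lambda>p. \<bar>uu p\<bar>) (?f k)"
      let ?X3 = "\<lambda>k. slab t1 t2 (\<lambda>p. \<bar>uu p\<bar>) (\<lambda>x. \<bar>lap (?f k) x\<bar>)"
      let ?X4 = "\<lambda>k. slab t1 t2 (\<lambda>p. \<bar>ff p\<bar>) (?f k)"
      let ?X6 = "\<lambda>b k. slab t1 t2 (\<lambda>p. \<bar>gi b p\<bar>) (\<lambda>x. \<bar>dirderiv b (?f k) x\<bar>)"
      have k: "?w k * slab t1 t2 (\<lambda>p. \<bar>gi b p\<bar>) (?f k) \<le> ?w k * ?X1 k + c / \<kappa> * ((?w k * ?l k) * ?X2 k)
          + c * \<kappa> * ((?w k / ?l k) * ?X4 k + (?w k / ?l k) * mass (?f k) t1 + (?w k / ?l k) * mass (?f k) t2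
             + (?w k / ?l k) * ?X3 k + 2 * (\<Sum>a\<in>Basis. (?w k / ?l k) * ?X6 a k))" for k
      proof -
        have \<rho>: "0 < \<kappa> / ?l k" using \<kappa> l1[of k] by simp
        have "?w k * slab t1 t2 (\<lambda>p. \<bar>gi b p\<bar>) (?f k) \<le> ?w k * (?X1 k + c / (\<kappa> / ?l k) * ?X2 k
           + c * (\<kappa> / ?l k) * (?X4 k + (mass (?f k) t1 + mass (?f k) t2) + ?X3 k + 2 * (\<Sum>a\<in>Basis. ?X6 a k)))"
          by (intro mult_left_mono est[OF b shell_test _ \<rho> t]) (auto simp: shell_fun_bounds)
        also have "\<dots> = ?w k * ?X1 k + c / \<kappa> * ((?w k * ?l k) * ?X2 k)
          + c * \<kappa> * ((?w k / ?l k) * ?X4 k + (?w k / ?l k) * mass (?f k) t1 + (?w k / ?l k) * mass (?f k) t2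
             + (?w k / ?l k) * ?X3 k + 2 * (\<Sum>a\<in>Basis. (?w k / ?l k) * ?X6 a k))"
          unfolding sum_distrib_left[symmetric] by (simp add: distrib_left mult_ac)
        finally show ?thesis .
      qed
      have "(\<Sum>k<K. ?w k * slab t1 t2 (\<lambda>p. \<bar>gi b p\<bar>) (?f k)) \<le> (\<Sum>k<K. ?w k * ?X1 k) + c / \<kappa> * (\<Sum>k<K. (?w k * ?l k) * ?X2 k)
          + c * \<kappa> * ((\<Sum>k<K. (?w k / ?l k) * ?X4 k) + (\<Sum>k<K. (?w k / ?l k) * mass (?f k) t1) + (\<Sum>k<K. (?w k / ?l k) * mass (?f k) t2)
             + (\<Sum>k<K. (?w k / ?l k) * ?X3 k) + 2 * (\<Sum>a\<in>Basis. (\<Sum>k<K. (?w k / ?l k) * ?X6 a k)))"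
      proof -
        have "(\<Sum>k<K. ?w k * slab t1 t2 (\<lambda>p. \<bar>gi b p\<bar>) (?f k)) \<le> (\<Sum>k<K. ?w k * ?X1 k + c / \<kappa> * ((?w k * ?l k) * ?X2 k)
          + c * \<kappa> * ((?w k / ?l k) * ?X4 k + (?w k / ?l k) * mass (?f k) t1 + (?w k / ?l k) * mass (?f k) t2
             + (?w k / ?l k) * ?X3 k + 2 * (\<Sum>a\<in>Basis. (?w k / ?l k) * ?X6 a k)))"
          by (rule sum_mono) (rule k)
        then show ?thesis
          unfolding sum.swap[of _ "{..<K}" Basis]
          by (simp only: sum.distrib sum_distrib_left[symmetric])
      qed
      also have "\<dots> \<le> (D * 384) * ?S + c / \<kappa> * (384 * ?S)
          + c * \<kappa> * (4 * ?F + 4 * mass h0 t1 + 4 * mass h0 t2 + (D * 384) * ?S + 2 * (\<Sum>b\<in>Basis. (D * 4) * ?G b))"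
        using c \<kappa> by (intro add_mono mult_left_mono sum_mono a1 a2 a3 a4 a5 a6 b t1T t(3)) auto
      also have "\<dots> = Q" unfolding Q_def \<Gamma>_def sum_distrib_left[symmetric] by (simp add: algebra_simps)
      finally show ?thesis .
    qed
    \<comment> \<open>Finitely many levels recover \<open>h0\<close> only up to 2 * 2^-K times a
      function that exceeds 1 on the support. The integral of the gradient against that function is
      finite but not controlled, so it is removed by letting K tend to infinity.\<close>
    have G2: "?G b \<le> 2 * Q" if b: "b \<in> Basis" for b
    proof -
      obtain \<chi>' where \<chi>: "test_fun \<Omega> \<chi>'" "\<And>x. 0 \<le> \<chi>' x" "\<And>x. x \<in> tsupport h0 \<Longrightarrow> 1 < \<chi>' x"
        by (rule Cc_fun_ge_1_on_compact[of "tsupport h0" \<Omega>]) (use h0_Cc open_domain in \<open>auto simp: Cc_fun_def\<close>)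
      let ?H = "slab t1 t2 (\<lambda>p. \<bar>gi b p\<bar>) \<chi>'"
      have gK: "?G b \<le> 2 * Q + ?w K * (2 * ?H)" for K
      proof -
        let ?P = "\<lambda>x. (\<Sum>k<K. (2 * ?w k) * ?f k x)"
        have PC: "Cc_fun \<Omega> ?P" by (rule Cc_fun_sum[OF Cc_fun_cmult[OF fC]])
        have \<chi>C: "Cc_fun \<Omega> (\<lambda>x. (2 * ?w K) * \<chi>' x)" by (rule Cc_fun_cmult[OF test_fun_Cc[OF \<chi>(1)]])
        have "?G b \<le> slab t1 t2 (\<lambda>p. \<bar>gi b p\<bar>) (\<lambda>x. ?P x + (2 * ?w K) * \<chi>' x)"
        proof (rule slab_mono[OF t loc_int_abs[OF loc_int_gi] h0_Cc Cc_fun_add[OF PC \<chi>C]])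
          fix x
          show "h0 x \<le> ?P x + (2 * ?w K) * \<chi>' x"
          proof (cases "h0 x = 0")
            case True
            have "0 \<le> ?P x" by (intro sum_nonneg mult_nonneg_nonneg shell_fun_bounds) auto
            then show ?thesis using True \<chi>(2)[of x] by simp
          next
            case False
            then have "1 < \<chi>' x" by (intro \<chi>(3) in_tsupport)
            then have "2 * ?w K * 1 \<le> 2 * ?w K * \<chi>' x" by (intro mult_left_mono) auto
            moreover have "h0 x \<le> 2 * (\<Sum>k<K. ?w k * ?f k x) + 2 * ?w K"
              using shell_sum_lower[OF h0_nonneg h0_less_1, of x K] by (simp add: h0_def shell_fun_def)
            moreover have "?P x = 2 * (\<Sum>k<K. ?w k * ?f k x)" by (simp add: sum_distrib_left mult.assoc)
            ultimately show ?thesis by linarith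
          qed
        qed simp
        also have "\<dots> = 2 * (\<Sum>k<K. ?w k * slab t1 t2 (\<lambda>p. \<bar>gi b p\<bar>) (?f k)) + ?w K * (2 * ?H)"
          unfolding slab_add[OF t loc_int_abs[OF loc_int_gi] PC \<chi>C] slab_sum[OF t loc_int_abs[OF loc_int_gi] fC] slab_cmult[OF t]
          by (simp add: sum_distrib_left mult.assoc)
        also have "\<dots> \<le> 2 * Q + ?w K * (2 * ?H)" using main[OF b, of K] by simp
        finally show ?thesis .
      qed
      have "(\<lambda>K. 2 * Q + ?w K * (2 * ?H)) \<longlonglongrightarrow> 2 * Q + 0 * (2 * ?H)"
        by (intro tendsto_intros LIMSEQ_power_zero) auto
      then have "?G b \<le> 2 * Q + 0 * (2 * ?H)" by (rule LIMSEQ_le_const) (use gK in blast)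
      then show ?thesis by simp
    qed
    let ?O = "slab t1 t2 (\<lambda>p. 1) h0"
    have pos: "0 \<le> ?S" "0 \<le> ?O" "0 \<le> \<Gamma>" "0 \<le> mass h0 t1" "0 \<le> mass h0 t2"
      unfolding \<Gamma>_def
      by (auto intro!: slab_nonneg[OF t] sum_nonneg mass_nonneg[OF h0_Cc] h0_nonneg h02_nonneg t1T t(3))
    \<comment> \<open>Here q \<le> 1 enters: |grad u|^q is at most 1 + |grad u|, a bound linear in
      the gradient and hence closed by the linear estimate.\<close>
    have F\<Gamma>: "?F \<le> ?O + \<Gamma>"
    proof -
      have li: "loc_int (\<lambda>p. \<Sum>b\<in>Basis. \<bar>gi b p\<bar>)" by (intro loc_int_sum loc_int_abs loc_int_gi)
      have "?F \<le> slab t1 t2 (\<lambda>p. 1 + (\<Sum>b\<in>Basis. \<bar>gi b p\<bar>)) h0"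
      proof (rule slab_fun_mono[OF t loc_int_abs[OF loc_int_ff] loc_int_add[OF loc_int_const li] h0_Cc _ h0_nonneg])
        fix p
        let ?N = "norm (g (fst p) (snd p))"
        have "?N powr q \<le> 1 + ?N"
        proof (cases "?N \<le> 1")
          case True
          then have "?N powr q \<le> 1 powr q" using q by (intro powr_mono2) auto
          then have "?N powr q \<le> 1" by simp
          then show ?thesis using norm_ge_zero[of "g (fst p) (snd p)"] by linarith
        next
          case False
          then have "?N powr q \<le> ?N powr 1" using q by (intro powr_mono) auto
          then show ?thesis using False by simp
        qed
        also have "?N \<le> (\<Sum>b\<in>Basis. \<bar>gi b p\<bar>)" unfolding gi_def by (rule norm_le_l1)
        finally show "\<bar>ff p\<bar> \<le> 1 + (\<Sum>b\<in>Basis. \<bar>gi b p\<bar>)" by (simp add: ff_def)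
      qed
      also have "\<dots> = ?O + \<Gamma>"
        unfolding slab_fun_add[OF t loc_int_const li h0_Cc] \<Gamma>_def
        by (subst slab_fun_sum[OF t]) (auto intro: loc_int_abs loc_int_gi h0_Cc)
      finally show ?thesis .
    qed
    have "\<Gamma> \<le> (\<Sum>b\<in>(Basis::'a set). 2 * Q)" unfolding \<Gamma>_def by (intro sum_mono G2)
    also have "\<dots> = n * (2 * Q)" by (simp add: n_def)
    also have "\<dots> = C / 2 * ?S + 8 * (n * c * \<kappa>) * (?F + mass h0 t1 + mass h0 t2) + 16 * (n * c * \<kappa> * D) * \<Gamma>"
      unfolding Q_def C_def by (simp add: algebra_simps)
    also have "n * c * \<kappa> * D = 1 / 128" unfolding \<kappa>_def using n c D(1) by simp
    finally have 1: "\<Gamma> \<le> C / 2 * ?S + 8 * (n * c * \<kappa>) * (?F + mass h0 t1 + mass h0 t2) + \<Gamma> / 8" by simp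
    have "n * c * \<kappa> = 1 / (128 * D)" unfolding \<kappa>_def using n c D(1) by simp
    also have "\<dots> \<le> 1 / 128" using D(1) by (intro frac_le) auto
    finally have nck: "8 * (n * c * \<kappa>) \<le> 1 / 16" by simp
    have "0 \<le> ?F" by (rule slab_nonneg[OF t]) (auto simp: h0_nonneg)
    then have "8 * (n * c * \<kappa>) * (?F + mass h0 t1 + mass h0 t2) \<le> 1 / 16 * (?F + mass h0 t1 + mass h0 t2)"
      using pos by (intro mult_right_mono nck) auto
    \<comment> \<open>The arithmetic of the absorption: after moving G/8 and the G/16 hidden in Z to
      the left, 13/16 of G remains there.\<close>
    moreover have "G \<le> 2 * X + W + (m1 + m2) / 2"
      if "Z \<le> 1 / 16 * (Y + m1 + m2)" "G \<le> X + Z + G / 8" "Y \<le> W + G" "0 \<le> X" "0 \<le> W" "0 \<le> G" "0 \<le> m1" "0 \<le> m2"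
      for G X W Y Z m1 m2 :: real
      using that by argo
    ultimately have "\<Gamma> \<le> 2 * (C / 2 * ?S) + ?O + (mass h0 t1 + mass h0 t2) / 2"
      using 1 F\<Gamma> pos C by (meson divide_nonneg_pos mult_nonneg_nonneg zero_less_numeral)
    then have "\<Gamma> \<le> C * ?S + ?O + (mass h0 t1 + mass h0 t2) / 2" by simp
    then have "?F \<le> C * ?S + 2 * ?O + (mass h0 t1 + mass h0 t2) / 2" using F\<Gamma> by linarith
    then show "slab t1 t2 ff h0 \<le> C * ?S + 2 * ?O + (mass h0 t1 + mass h0 t2) / 2"
      using ff_nonneg by simp
  qed
qed

text \<open>In the energy identity for \<open>h0\<close> the term with f contributes half of the
  mass at t1, which moves to the left; doubling what remains gives the factors 3, 4 and twice the
  absorption constant. The terms C u \<open>h02\<close> and -u \<open>lap h0\<close> together are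
  bounded by a multiple of u \<open>h0\<close>.\<close>

lemma mass_step:
  "\<exists>B\<ge>0. \<forall>t1 t2. 0 < t1 \<longrightarrow> t1 \<le> t2 \<longrightarrow> t2 \<in> tint T \<longrightarrow>
    mass h0 t1 \<le> 3 * mass h0 t2 + 4 * slab t1 t2 (\<lambda>p. 1) h0 + B * slab t1 t2 uu h0"
proof -
  obtain C where C: "0 \<le> C" and est: "\<And>t1 t2. 0 < t1 \<Longrightarrow> t1 \<le> t2 \<Longrightarrow> t2 \<in> tint T \<Longrightarrow>
    slab t1 t2 ff h0 \<le> C * slab t1 t2 (\<lambda>p. \<bar>uu p\<bar>) h02 + 2 * slab t1 t2 (\<lambda>p. 1) h0 + (mass h0 t1 + mass h0 t2) / 2"
    using weighted_gradient by blast
  obtain B where B: "0 \<le> B"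
    "\<And>x. C * (flat_exp 0 (dep a R x) + flat_exp 2 (dep a R x)) - lap (ball_bump a R) x \<le> B * ball_bump a R x"
    by (rule weight_absorption[OF R C, of a]) blast
  show ?thesis
  proof (intro exI[of _ "2 * B"] conjI allI impI)
    show "0 \<le> 2 * B" using B by simp
    fix t1 t2 :: real assume t: "0 < t1" "t1 \<le> t2" "t2 \<in> tint T"
    let ?u = "\<lambda>p. \<bar>uu p\<bar>"
    have lC: "Cc_fun \<Omega> (lap h0)" by (rule test_fun_Cc[OF lap_test_fun[OF h0_test]])
    have li: "loc_int ?u" by (rule loc_int_abs[OF loc_int_uu])
    have c1: "Cc_fun \<Omega> (\<lambda>x. C * h02 x)" and c2: "Cc_fun \<Omega> (\<lambda>x. (-1) * lap h0 x)" and c3: "Cc_fun \<Omega> (\<lambda>x. B * h0 x)"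
      by (rule Cc_fun_cmult[OF h02_Cc], rule Cc_fun_cmult[OF lC], rule Cc_fun_cmult[OF h0_Cc])
    have "slab t1 t2 ?u (\<lambda>x. C * h02 x + (-1) * lap h0 x) \<le> slab t1 t2 ?u (\<lambda>x. B * h0 x)"
    proof (rule slab_mono[OF t li Cc_fun_add[OF c1 c2] c3])
      show "C * h02 x + (-1) * lap h0 x \<le> B * h0 x" for x using B(2)[of x] by (simp add: h0_def h02_def)
    qed simp
    then have 1: "C * slab t1 t2 ?u h02 - slab t1 t2 uu (lap h0) \<le> B * slab t1 t2 uu h0"
      unfolding slab_add[OF t li c1 c2] slab_cmult[OF t] using slab_uu_abs[OF t lC] slab_uu_abs[OF t h0_Cc] by simp
    show "mass h0 t1 \<le> 3 * mass h0 t2 + 4 * slab t1 t2 (\<lambda>p. 1) h0 + 2 * B * slab t1 t2 uu h0"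
      using energy_identity[OF t h0_test] est[OF t] 1 by (simp add: field_simps)
  qed
qed

text \<open>In place of a differential inequality, the estimate is applied from the time s in
  [t, t0] at which the mass is largest. The integral term is then at most B t0 times this maximum
  and is absorbed since B t0 \<le> 1/2. The resulting bound 2 A does not depend on t.\<close>

lemma mass_bound_ball: "\<exists>t0 M. 0 < t0 \<and> t0 \<in> tint T \<and> (\<forall>t\<in>{0<..t0}. mass h0 t \<le> M)"
proof -
  obtain B where B: "0 \<le> B" and step: "\<And>t1 t2. 0 < t1 \<Longrightarrow> t1 \<le> t2 \<Longrightarrow> t2 \<in> tint T \<Longrightarrow>
    mass h0 t1 \<le> 3 * mass h0 t2 + 4 * slab t1 t2 (\<lambda>p. 1) h0 + B * slab t1 t2 uu h0"
    using mass_step by blast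
  obtain s0 where s0: "0 < s0" "s0 \<in> tint T"
    using ereal_dense2[OF T_pos] by (auto simp: tint_def zero_ereal_def)
  \<comment> \<open>The last entry ensures B t0 \<le> 1/2, also when B = 0. Because t0 \<le> 1,
    every slab ending at t0 lies within times [0, 1], so the volume V bounds all the constant
    terms.\<close>
  define t0 where "t0 = min s0 (min 1 (1 / (2 * (B + 1))))"
  have t0: "0 < t0" "t0 \<le> 1" "t0 \<le> s0" "B * t0 \<le> 1 / 2"
  proof -
    have "0 < 1 / (2 * (B + 1))" "1 / (2 * (B + 1)) \<le> 1" using B by auto
    then show "0 < t0" "t0 \<le> 1" "t0 \<le> s0" using s0(1) unfolding t0_def by linarith+
    have "B * t0 \<le> B * (1 / (2 * (B + 1)))" using B by (intro mult_left_mono) (auto simp: t0_def)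
    also have "\<dots> \<le> 1 / 2" using B by (simp add: field_simps)
    finally show "B * t0 \<le> 1 / 2" .
  qed
  have t0T: "t0 \<in> tint T" using tint_interval[OF t0(1) s0(2)] t0(3) by auto
  let ?C = "cball a R \<times> {0..1::real}"
  define V where "V = measure lebesgue ?C"
  have Cm: "?C \<in> lmeasurable" by (intro lmeasurable_compact compact_Times) auto
  then have iC: "integrable lebesgue (indicator ?C :: _ \<Rightarrow> real)"
    by (intro integrable_real_indicator) (auto simp: fmeasurable_def)
  have one: "slab t1 t0 (\<lambda>p. 1) h0 \<le> V" if "0 < t1" "t1 \<le> t0" for t1
  proof -
    have "slab t1 t0 (\<lambda>p. 1) h0 \<le> (\<integral>p. indicator ?C p \<partial>lebesgue)"
      unfolding slab_def
    proof (rule integral_mono[OF slab_integrable[OF that t0T loc_int_const h0_Cc] iC])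
      fix p :: "'a \<times> real"
      have "h0 (fst p) = 0" if "fst p \<notin> cball a R"
        using that ball_bump_pos_iff[OF R, of a "fst p"] h0_nonneg[of "fst p"] by (auto simp: h0_def)
      then show "1 * (h0 (fst p) * indicator {t1<..t0} (snd p)) \<le> indicator ?C p"
        using h0_less_1[of "fst p"] t0(2) that by (cases p) (auto simp: indicator_def)
    qed
    then show ?thesis using Cm by (simp add: V_def fmeasurableD)
  qed
  have uub: "slab s t0 uu h0 \<le> t0 * m" if "0 < s" "s \<le> t0" "\<And>r. r \<in> {s..t0} \<Longrightarrow> mass h0 r \<le> m" for s m
  proof -
    have m0: "0 \<le> m" using that(3)[of t0] that(2) mass_nonneg[OF h0_Cc h0_nonneg t0T] by auto
    have "slab s t0 uu h0 = (\<integral>r. massi h0 r * indicator {s<..t0} r \<partial>lborel)" by (rule slab_uu_eq[OF that(1,2) t0T h0_Cc])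
    also have "\<dots> \<le> (\<integral>r. m * indicator {s<..t0} r \<partial>lborel)"
    proof (rule integral_mono[OF slab_uu_eq(2)[OF that(1,2) t0T h0_Cc]])
      show "integrable lborel (\<lambda>r. m * indicator {s<..t0} r)"
        using that(2) by (intro integrable_mult_right integrable_real_indicator) auto
      show "massi h0 r * indicator {s<..t0} r \<le> m * indicator {s<..t0} r" for r
        using that(3)[of r] m0 by (auto simp: indicator_def massi_def)
    qed
    also have "\<dots> = m * (t0 - s)" using that(2) by simp
    also have "\<dots> \<le> m * t0" using that(1) m0 by (intro mult_left_mono) auto
    finally show ?thesis by (simp add: mult.commute)
  qed
  define A where "A = 3 * mass h0 t0 + 4 * V"
  have "mass h0 t \<le> 2 * A" if t: "t \<in> {0<..t0}" for t
  proof -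
    have sub: "{t..t0} \<subseteq> tint T" by (rule tint_interval) (use t t0T in auto)
    have "continuous_on {t..t0} (mass h0)" by (rule continuous_on_subset[OF mass_continuous[OF h0_Cc] sub])
    then obtain s where s: "s \<in> {t..t0}" "\<And>r. r \<in> {t..t0} \<Longrightarrow> mass h0 r \<le> mass h0 s"
      using continuous_attains_sup[of "{t..t0}" "mass h0"] t by auto
    have s0': "0 < s" "s \<le> t0" using s(1) t by auto
    have ms: "0 \<le> mass h0 s" using mass_nonneg[OF h0_Cc h0_nonneg] sub s(1) by blast
    have "mass h0 s \<le> 3 * mass h0 t0 + 4 * slab s t0 (\<lambda>p. 1) h0 + B * slab s t0 uu h0" by (rule step[OF s0' t0T])
    also have "\<dots> \<le> 3 * mass h0 t0 + 4 * V + B * (t0 * mass h0 s)"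
    proof -
      have "slab s t0 uu h0 \<le> t0 * mass h0 s" by (rule uub[OF s0']) (use s in auto)
      then have "B * slab s t0 uu h0 \<le> B * (t0 * mass h0 s)" by (rule mult_left_mono[OF _ B])
      then show ?thesis using one[OF s0'] by linarith
    qed
    also have "B * (t0 * mass h0 s) \<le> 1 / 2 * mass h0 s"
      unfolding mult.assoc[symmetric] by (rule mult_right_mono[OF t0(4) ms])
    finally have "mass h0 s \<le> 2 * A" by (simp add: A_def)
    then show ?thesis using s(2)[of t] t by auto
  qed
  then show ?thesis using t0(1) t0T by blast
qed

end

end

section \<open>Existence of the trace\<close>

text \<open>The limits of the approximants with errors 1/(n+1) form a Cauchy sequence, because along
  F two approximants differ eventually by at most the sum of their errors. A three-term estimate
  shows that f tends to its limit.\<close>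

lemma tendsto_of_uniform_approximation:
  fixes f :: "'b \<Rightarrow> real"
  assumes F: "F \<noteq> bot"
    and approx: "\<And>e. 0 < e \<Longrightarrow> \<exists>h L. (h \<longlongrightarrow> L) F \<and> (\<forall>\<^sub>F t in F. \<bar>f t - h t\<bar> \<le> e)"
  shows "\<exists>L. (f \<longlongrightarrow> L) F"
proof -
  define e where "e n = 1 / (real n + 1)" for n
  have e0: "0 < e n" for n by (simp add: e_def)
  have elim: "e \<longlonglongrightarrow> 0"
    using LIMSEQ_inverse_real_of_nat by (simp add: e_def[abs_def] inverse_eq_divide add.commute)
  have "\<forall>n. \<exists>h L. (h \<longlongrightarrow> L) F \<and> (\<forall>\<^sub>F t in F. \<bar>f t - h t\<bar> \<le> e n)" using approx[OF e0] by blast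
  then obtain h L where h: "\<And>n. (h n \<longlongrightarrow> L n) F" "\<And>n. \<forall>\<^sub>F t in F. \<bar>f t - h n t\<bar> \<le> e n" by metis
  have LL: "\<bar>L n - L m\<bar> \<le> e n + e m" for n m
  proof (rule tendsto_upperbound[OF _ _ F])
    show "((\<lambda>t. \<bar>h n t - h m t\<bar>) \<longlongrightarrow> \<bar>L n - L m\<bar>) F" by (intro tendsto_intros h)
    show "\<forall>\<^sub>F t in F. \<bar>h n t - h m t\<bar> \<le> e n + e m" using h(2)[of n] h(2)[of m] by eventually_elim linarith
  qed
  have "Cauchy L"
  proof (rule metric_CauchyI)
    fix r :: real assume "0 < r"
    then have "\<forall>\<^sub>F n in sequentially. e n < r / 2" using elim by (intro order_tendstoD) auto
    then obtain N where N: "\<And>n. N \<le> n \<Longrightarrow> e n < r / 2" by (auto simp: eventually_sequentially)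
    show "\<exists>M. \<forall>m\<ge>M. \<forall>n\<ge>M. dist (L m) (L n) < r"
    proof (intro exI[of _ N] allI impI)
      fix m n assume "N \<le> m" "N \<le> n"
      then show "dist (L m) (L n) < r" using LL[of m n] N[of m] N[of n] by (simp add: dist_real_def)
    qed
  qed
  then obtain L0 where L0: "L \<longlonglongrightarrow> L0" using Cauchy_convergent convergent_def by blast
  have L0b: "\<bar>L n - L0\<bar> \<le> e n" for n
  proof (rule LIMSEQ_le)
    show "(\<lambda>m. \<bar>L n - L m\<bar>) \<longlonglongrightarrow> \<bar>L n - L0\<bar>" by (intro tendsto_intros L0)
    show "(\<lambda>m. e n + e m) \<longlonglongrightarrow> e n" using tendsto_add[OF tendsto_const elim, of "e n"] by simp
    show "\<exists>N. \<forall>m\<ge>N. \<bar>L n - L m\<bar> \<le> e n + e m" using LL by blast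
  qed
  have "(f \<longlongrightarrow> L0) F"
  proof (rule tendstoI)
    fix r :: real assume r: "0 < r"
    then have "\<forall>\<^sub>F n in sequentially. e n < r / 4" using elim by (intro order_tendstoD) auto
    then obtain n where n: "e n < r / 4" by (auto simp: eventually_sequentially)
    have "\<forall>\<^sub>F t in F. dist (h n t) (L n) < r / 4" using h(1)[of n] r by (intro tendstoD) auto
    with h(2)[of n] show "\<forall>\<^sub>F t in F. dist (f t) L0 < r"
    proof eventually_elim
      case (elim t)
      then show ?case using L0b[of n] n unfolding dist_real_def by linarith
    qed
  qed
  then show ?thesis by blast
qed

context hj_solution
begin

lemma eventually_tint: "\<forall>\<^sub>F t in at_right 0. t \<in> tint T"
proof -
  obtain s where s: "0 < s" "s \<in> tint T"
    using ereal_dense2[OF T_pos] by (auto simp: tint_def zero_ereal_def)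
  have "t \<in> tint T" if "0 < t" "t < s" for t using tint_interval[OF that(1) s(2)] that by auto
  then show ?thesis using s(1) by (auto simp: eventually_at_right_field)
qed

lemma mass_bounded_sum:
  assumes "finite D" "\<And>a. a \<in> D \<Longrightarrow> 0 < r a \<and> cball a (r a) \<subseteq> \<Omega>"
  shows "\<exists>M. \<forall>\<^sub>F t in at_right 0. mass (\<lambda>x. \<Sum>a\<in>D. ball_bump a (r a) x) t \<le> M"
  using assms
proof (induction D rule: finite_induct)
  case empty
  show ?case by (intro exI[of _ 0]) (simp add: mass_zero)
next
  case (insert a D)
  obtain M where M: "\<forall>\<^sub>F t in at_right 0. mass (\<lambda>x. \<Sum>a\<in>D. ball_bump a (r a) x) t \<le> M"
    using insert by blast
  have ra: "0 < r a" "cball a (r a) \<subseteq> \<Omega>" using insert.prems[of a] by auto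
  obtain t0 M' where t0: "0 < t0" "\<forall>t\<in>{0<..t0}. mass (ball_bump a (r a)) t \<le> M'"
    using mass_bound_ball[OF ra] unfolding h0_def[OF ra] by blast
  have "\<forall>\<^sub>F t in at_right 0. mass (ball_bump a (r a)) t \<le> M'"
    using t0 by (auto simp: eventually_at_right_field)
  with M eventually_tint
  have "\<forall>\<^sub>F t in at_right 0. mass (\<lambda>x. \<Sum>a\<in>insert a D. ball_bump a (r a) x) t \<le> M' + M"
  proof eventually_elim
    case (elim t)
    have "Cc_fun \<Omega> (ball_bump a (r a))" "Cc_fun \<Omega> (\<lambda>x. \<Sum>a\<in>D. ball_bump a (r a) x)"
      using insert.prems by (auto intro!: test_fun_Cc test_fun_sum ball_bump_test)
    from mass_add[OF this elim(2)] show ?case using elim insert.hyps by simp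
  qed
  then show ?case by blast
qed

text \<open>Finitely many balls cover the support. The sum of their weights is bounded below there,
  so a multiple of it dominates |\<phi>|.\<close>

lemma mass_bounded:
  assumes \<phi>: "Cc_fun \<Omega> \<phi>"
  shows "\<exists>M\<ge>0. \<forall>\<^sub>F t in at_right 0. mass (\<lambda>x. \<bar>\<phi> x\<bar>) t \<le> M"
proof -
  let ?K = "tsupport \<phi>"
  have K: "compact ?K" "?K \<subseteq> \<Omega>" using \<phi> by (auto simp: Cc_fun_def)
  have "\<forall>x\<in>?K. \<exists>r>0. cball x r \<subseteq> \<Omega>" using K open_domain open_contains_cball by blast
  then obtain r where r: "\<And>x. x \<in> ?K \<Longrightarrow> 0 < r x \<and> cball x (r x) \<subseteq> \<Omega>" by metis
  obtain D where D: "D \<subseteq> ?K" "finite D" "?K \<subseteq> (\<Union>x\<in>D. ball x (r x))"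
    by (rule compactE_image[OF K(1), of ?K "\<lambda>x. ball x (r x)"]) (use r in force)+
  define \<psi> where "\<psi> x = (\<Sum>a\<in>D. ball_bump a (r a) x)" for x
  have \<psi>C: "Cc_fun \<Omega> \<psi>"
    unfolding \<psi>_def using r D by (intro test_fun_Cc test_fun_sum ball_bump_test) auto
  have \<psi>0: "0 \<le> \<psi> x" for x unfolding \<psi>_def by (intro sum_nonneg ball_bump_nonneg)
  have \<psi>pos: "0 < \<psi> x" if xK: "x \<in> ?K" for x
  proof -
    obtain a where "a \<in> D" "dist a x < r a" using D(3) xK by auto
    then show ?thesis
      unfolding \<psi>_def using D r by (intro sum_pos2[of D a] ball_bump_nonneg) (auto simp: ball_bump_pos_iff)
  qed
  obtain m where m: "0 < m" "\<And>x. x \<in> ?K \<Longrightarrow> m \<le> \<psi> x"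
  proof (cases "?K = {}")
    case True then show ?thesis using that[of 1] by auto
  next
    case False
    obtain x0 where "x0 \<in> ?K" "\<And>x. x \<in> ?K \<Longrightarrow> \<psi> x0 \<le> \<psi> x"
      using continuous_attains_inf[OF K(1) False Cc_fun_continuous[OF \<psi>C]] by blast
    then show ?thesis using that[of "\<psi> x0"] \<psi>pos by blast
  qed
  obtain B where B: "0 < B" "\<And>x. \<bar>\<phi> x\<bar> \<le> B" by (rule Cc_fun_bounded[OF \<phi>]) blast
  have le: "\<bar>\<phi> x\<bar> \<le> B / m * \<psi> x" for x
  proof (cases "x \<in> ?K")
    case True
    have "\<bar>\<phi> x\<bar> \<le> B / m * m" using B(2)[of x] m(1) by simp
    also have "\<dots> \<le> B / m * \<psi> x" using m B(1) True by (intro mult_left_mono) auto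
    finally show ?thesis .
  next
    case False
    then show ?thesis using not_in_tsupport[of x \<phi>] \<psi>0[of x] B m by simp
  qed
  obtain M where M: "\<forall>\<^sub>F t in at_right 0. mass \<psi> t \<le> M"
    using mass_bounded_sum[OF D(2), of r] D r unfolding \<psi>_def[abs_def] by blast
  have "\<forall>\<^sub>F t in at_right 0. mass (\<lambda>x. \<bar>\<phi> x\<bar>) t \<le> B / m * \<bar>M\<bar>"
    using M eventually_tint
  proof eventually_elim
    case (elim t)
    have "mass (\<lambda>x. \<bar>\<phi> x\<bar>) t \<le> mass (\<lambda>x. B / m * \<psi> x) t"
      by (rule mass_mono[OF Cc_fun_abs[OF \<phi>] Cc_fun_cmult[OF \<psi>C] elim(2) le])
    also have "\<dots> = B / m * mass \<psi> t" by (rule mass_cmult)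
    also have "\<dots> \<le> B / m * \<bar>M\<bar>" using elim(1) B m by (intro mult_left_mono) auto
    finally show ?case .
  qed
  moreover have "0 \<le> B / m * \<bar>M\<bar>" using B m by simp
  ultimately show ?thesis by blast
qed

text \<open>If M bounds the mass of |\<open>lap\<close> \<phi>|, then X(t) - M t is nonincreasing in
  t, because f \<phi> \<ge> 0 can only lower X. Being bounded above, it converges to its supremum as
  t decreases to 0. Only the sign of f is used at this stage.\<close>

lemma mass_limit_nonneg:
  assumes \<phi>: "test_fun \<Omega> \<phi>" and \<phi>0: "\<And>x. 0 \<le> \<phi> x"
  shows "\<exists>L. (mass \<phi> \<longlongrightarrow> L) (at_right 0)"
proof -
  have \<phi>C: "Cc_fun \<Omega> \<phi>" and lC: "Cc_fun \<Omega> (lap \<phi>)"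
    using \<phi> lap_test_fun[OF \<phi>] by (auto intro: test_fun_Cc)
  obtain M where M: "0 \<le> M" "\<forall>\<^sub>F t in at_right 0. mass (\<lambda>x. \<bar>lap \<phi> x\<bar>) t \<le> M" using mass_bounded[OF lC] by blast
  obtain M' where M': "\<forall>\<^sub>F t in at_right 0. mass \<phi> t \<le> M'" using mass_bounded[OF \<phi>C] \<phi>0 by auto
  have "\<forall>\<^sub>F t in at_right 0. t \<in> tint T \<and> mass (\<lambda>x. \<bar>lap \<phi> x\<bar>) t \<le> M \<and> mass \<phi> t \<le> M'"
    using M(2) M' eventually_tint by eventually_elim auto
  then obtain t0 where t0: "0 < t0" "\<And>t. 0 < t \<Longrightarrow> t < t0 \<Longrightarrow> t \<in> tint T \<and> mass (\<lambda>x. \<bar>lap \<phi> x\<bar>) t \<le> M \<and> mass \<phi> t \<le> M'"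
    unfolding eventually_at_right_field by blast
  define Y where "Y t = mass \<phi> t - M * t" for t
  have Ymono: "Y t2 \<le> Y t1" if t: "0 < t1" "t1 \<le> t2" "t2 < t0" for t1 t2
  proof -
    have t2T: "t2 \<in> tint T" using t0(2)[of t2] t by auto
    note tt = t(1,2) t2T
    let ?a = "\<lambda>x. \<bar>lap \<phi> x\<bar>"
    have aC: "Cc_fun \<Omega> ?a" by (rule Cc_fun_abs[OF lC])
    have "slab t1 t2 uu (lap \<phi>) = slab t1 t2 (\<lambda>p. \<bar>uu p\<bar>) (lap \<phi>)" by (rule slab_uu_abs[OF tt lC, symmetric])
    also have "\<dots> \<le> slab t1 t2 (\<lambda>p. \<bar>uu p\<bar>) ?a"
      by (rule slab_mono[OF tt loc_int_abs[OF loc_int_uu] lC aC]) auto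
    also have "\<dots> = slab t1 t2 uu ?a" by (rule slab_uu_abs[OF tt aC])
    also have "\<dots> = (\<integral>r. massi ?a r * indicator {t1<..t2} r \<partial>lborel)" by (rule slab_uu_eq[OF tt aC])
    also have "\<dots> \<le> (\<integral>r. M * indicator {t1<..t2} r \<partial>lborel)"
    proof (rule integral_mono[OF slab_uu_eq(2)[OF tt aC]])
      show "integrable lborel (\<lambda>r. M * indicator {t1<..t2} r)"
        using t(2) by (intro integrable_mult_right integrable_real_indicator) auto
      show "massi ?a r * indicator {t1<..t2} r \<le> M * indicator {t1<..t2} r" for r
        using t0(2)[of r] t M(1) by (auto simp: indicator_def massi_def)
    qed
    also have "\<dots> = M * (t2 - t1)" using t(2) by simp
    finally have "slab t1 t2 uu (lap \<phi>) \<le> M * t2 - M * t1" by (simp add: right_diff_distrib)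
    moreover have "0 \<le> slab t1 t2 ff \<phi>" by (rule slab_nonneg[OF tt]) (auto simp: ff_nonneg \<phi>0)
    ultimately show ?thesis using energy_identity[OF tt \<phi>] by (simp add: Y_def)
  qed
  have Yb: "Y t \<le> M'" if "0 < t" "t < t0" for t
    using t0(2)[OF that] mult_nonneg_nonneg[OF M(1), of t] that by (simp add: Y_def)
  define L where "L = Sup (Y ` {0<..<t0})"
  have bdd: "bdd_above (Y ` {0<..<t0})" using Yb by (intro bdd_aboveI[of _ M']) auto
  have ne: "Y ` {0<..<t0} \<noteq> {}" using t0(1) by (auto simp: greaterThanLessThan_empty_iff)
  have "(Y \<longlongrightarrow> L) (at_right 0)"
  proof (rule order_tendstoI)
    fix b assume "b < L"
    then obtain s where s: "s \<in> {0<..<t0}" "b < Y s" unfolding L_def using less_cSup_iff[OF ne bdd] by auto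
    have "b < Y t" if "0 < t" "t < s" for t using Ymono[of t s] s that by auto
    then show "\<forall>\<^sub>F t in at_right 0. b < Y t" using s(1) by (auto simp: eventually_at_right_field)
  next
    fix b assume b: "L < b"
    have "Y t < b" if "0 < t" "t < t0" for t
      using cSup_upper[OF _ bdd, of "Y t"] that b by (auto simp: L_def)
    then show "\<forall>\<^sub>F t in at_right 0. Y t < b" using t0(1) by (auto simp: eventually_at_right_field)
  qed
  then have "((\<lambda>t. Y t + M * t) \<longlongrightarrow> L + M * 0) (at_right 0)" by (intro tendsto_intros)
  then show ?thesis by (auto simp: Y_def)
qed

text \<open>\<phi> is the difference of the nonnegative test functions \<phi> + B h and B h. The
  positive and negative parts of \<phi> would not be smooth.\<close>

lemma mass_limit_test:
  assumes \<phi>: "test_fun \<Omega> \<phi>"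
  shows "\<exists>L. (mass \<phi> \<longlongrightarrow> L) (at_right 0)"
proof -
  obtain h where h: "test_fun \<Omega> h" "\<And>x. 0 \<le> h x" "\<And>x. x \<in> tsupport \<phi> \<Longrightarrow> 1 < h x"
    by (rule Cc_fun_ge_1_on_compact[of "tsupport \<phi>" \<Omega>]) (use \<phi> open_domain in \<open>auto simp: test_fun_def\<close>)
  obtain B where B: "0 < B" "\<And>x. \<bar>\<phi> x\<bar> \<le> B" by (rule test_fun_bounded[OF \<phi>]) blast
  have tB: "test_fun \<Omega> (\<lambda>x. B * h x)" by (rule test_fun_cmult[OF h(1)])
  have ts: "test_fun \<Omega> (\<lambda>x. \<phi> x + B * h x)" by (rule test_fun_add[OF \<phi> tB])
  have "0 \<le> \<phi> x + B * h x" for x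
  proof (cases "x \<in> tsupport \<phi>")
    case True
    have "B * 1 \<le> B * h x" using h(3)[OF True] B by (intro mult_left_mono) auto
    then show ?thesis using B(2)[of x] by linarith
  next
    case False then show ?thesis using not_in_tsupport[of x \<phi>] h(2)[of x] B by simp
  qed
  then obtain L1 where L1: "(mass (\<lambda>x. \<phi> x + B * h x) \<longlongrightarrow> L1) (at_right 0)"
    using mass_limit_nonneg[OF ts] by blast
  obtain L2 where L2: "(mass (\<lambda>x. B * h x) \<longlongrightarrow> L2) (at_right 0)"
    using mass_limit_nonneg[OF tB] h(2) B by auto
  have "((\<lambda>t. mass (\<lambda>x. \<phi> x + B * h x) t - mass (\<lambda>x. B * h x) t) \<longlongrightarrow> L1 - L2) (at_right 0)"
    by (intro tendsto_intros L1 L2)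
  moreover have "\<forall>\<^sub>F t in at_right 0. mass (\<lambda>x. \<phi> x + B * h x) t - mass (\<lambda>x. B * h x) t = mass \<phi> t"
    using eventually_tint
    by eventually_elim (simp add: mass_add[OF test_fun_Cc[OF \<phi>] test_fun_Cc[OF tB]])
  ultimately have "(mass \<phi> \<longlongrightarrow> L1 - L2) (at_right 0)" by (rule Lim_transform_eventually)
  then show ?thesis by blast
qed

text \<open>A uniform error controls masses only if it is dominated by a function of bounded mass.
  The approximation is therefore carried out inside V, where h exceeds 1, so that the error is at
  most e/(M+1) times h, and the mass of h stays below M near time 0.\<close>

lemma mass_limit:
  assumes \<psi>: "Cc_fun \<Omega> \<psi>"
  shows "\<exists>L. (mass \<psi> \<longlongrightarrow> L) (at_right 0)"
proof (rule tendsto_of_uniform_approximation)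
  show "at_right (0::real) \<noteq> bot" by simp
  fix e :: real assume e: "0 < e"
  obtain h where h: "test_fun \<Omega> h" "\<And>x. 0 \<le> h x" "\<And>x. x \<in> tsupport \<psi> \<Longrightarrow> 1 < h x"
    by (rule Cc_fun_ge_1_on_compact[of "tsupport \<psi>" \<Omega>]) (use \<psi> open_domain in \<open>auto simp: Cc_fun_def\<close>)
  have hC: "Cc_fun \<Omega> h" by (rule test_fun_Cc[OF h(1)])
  obtain M where M: "0 \<le> M" "\<forall>\<^sub>F t in at_right 0. mass h t \<le> M" using mass_bounded[OF hC] h(2) by auto
  define V where "V = {x. 1 < h x}"
  have V: "open V" unfolding V_def by (intro open_Collect_less continuous_intros Cc_fun_continuous[OF hC])
  have V\<Omega>: "V \<subseteq> \<Omega>"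
  proof
    fix x assume "x \<in> V"
    then have "h x \<noteq> 0" by (auto simp: V_def)
    then show "x \<in> \<Omega>" using in_tsupport[of h x] h(1) by (auto simp: test_fun_def)
  qed
  have "Cc_fun V \<psi>" using \<psi> h(3) by (auto simp: Cc_fun_def V_def)
  then obtain \<theta> where \<theta>: "test_fun V \<theta>" "\<And>x. \<bar>\<theta> x - \<psi> x\<bar> \<le> e / (M + 1)"
    by (rule test_fun_dense[OF _ V, of \<psi> "e / (M + 1)"]) (use e M in auto)
  have \<theta>\<Omega>: "test_fun \<Omega> \<theta>" by (rule test_fun_mono[OF \<theta>(1) V\<Omega>])
  have \<theta>C: "Cc_fun \<Omega> \<theta>" by (rule test_fun_Cc[OF \<theta>\<Omega>])
  have le: "\<bar>\<psi> x - \<theta> x\<bar> \<le> e / (M + 1) * h x" for x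
  proof (cases "x \<in> V")
    case True
    have "e / (M + 1) * 1 \<le> e / (M + 1) * h x" using True e M by (intro mult_left_mono) (auto simp: V_def)
    then show ?thesis using \<theta>(2)[of x] by linarith
  next
    case False
    then have "\<theta> x = 0" "\<psi> x = 0"
      using \<theta>(1) h(3)[of x] not_in_tsupport[of x \<theta>] not_in_tsupport[of x \<psi>] by (auto simp: test_fun_def V_def)
    then show ?thesis using h(2)[of x] e M by simp
  qed
  obtain L where L: "(mass \<theta> \<longlongrightarrow> L) (at_right 0)" using mass_limit_test[OF \<theta>\<Omega>] by blast
  have "\<forall>\<^sub>F t in at_right 0. \<bar>mass \<psi> t - mass \<theta> t\<bar> \<le> e"
    using M(2) eventually_tint
  proof eventually_elim
    case (elim t)
    have hc: "Cc_fun \<Omega> (\<lambda>x. e / (M + 1) * h x)" by (rule Cc_fun_cmult[OF hC])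
    have 1: "mass \<psi> t \<le> mass (\<lambda>x. \<theta> x + e / (M + 1) * h x) t"
      by (rule mass_mono[OF \<psi> Cc_fun_add[OF \<theta>C hc] elim(2)]) (use le in \<open>simp add: abs_le_iff algebra_simps\<close>)
    have 2: "mass \<theta> t \<le> mass (\<lambda>x. \<psi> x + e / (M + 1) * h x) t"
      by (rule mass_mono[OF \<theta>C Cc_fun_add[OF \<psi> hc] elim(2)]) (use le in \<open>simp add: abs_le_iff algebra_simps\<close>)
    have "e / (M + 1) * mass h t \<le> e / (M + 1) * M" using elim(1) e M by (intro mult_left_mono) auto
    also have "\<dots> \<le> e" using e M by (simp add: field_simps)
    finally show ?case
      using 1 2 mass_add[OF \<theta>C hc elim(2)] mass_add[OF \<psi> hc elim(2)] mass_cmult[of "e / (M + 1)" h t] by simp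
  qed
  with L show "\<exists>h L. (h \<longlongrightarrow> L) (at_right 0) \<and> (\<forall>\<^sub>F t in at_right 0. \<bar>mass \<psi> t - h t\<bar> \<le> e)" by blast
qed

text \<open>Linearity and positivity of the limit functional are inherited from the masses;
  additivity and positivity are available for times in \<open>tint T\<close>, that is, eventually as
  t decreases to 0.\<close>

theorem trace_exists:
  "\<exists>u0. radon_on \<Omega> u0 \<and> (\<forall>\<psi>. Cc_fun \<Omega> \<psi> \<longrightarrow> (mass \<psi> \<longlongrightarrow> (\<integral>x. \<psi> x \<partial>u0)) (at_right 0))"
proof -
  define \<Lambda> where "\<Lambda> \<psi> = Lim (at_right 0) (mass \<psi>)" for \<psi>
  have lim: "(mass \<psi> \<longlongrightarrow> \<Lambda> \<psi>) (at_right 0)" if "Cc_fun \<Omega> \<psi>" for \<psi>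
    using mass_limit[OF that] tendsto_Lim[of "at_right (0::real)" "mass \<psi>"] by (auto simp: \<Lambda>_def)
  have uniq: "\<Lambda> \<psi> = L" if "Cc_fun \<Omega> \<psi>" "(mass \<psi> \<longlongrightarrow> L) (at_right 0)" for \<psi> L
    using tendsto_unique[OF _ lim[OF that(1)] that(2)] by simp
  interpret positive_functional \<Omega> \<Lambda>
  proof
    show "open \<Omega>" by (rule open_domain)
    fix f h :: "'a \<Rightarrow> real" and c :: real
    assume f: "Cc_fun \<Omega> f"
    have "mass (\<lambda>x. c * f x) = (\<lambda>t. c * mass f t)" by (rule ext) (rule mass_cmult)
    then have "(mass (\<lambda>x. c * f x) \<longlongrightarrow> c * \<Lambda> f) (at_right 0)"
      using tendsto_mult_left[OF lim[OF f], of c] by simp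
    then show "\<Lambda> (\<lambda>x. c * f x) = c * \<Lambda> f" by (rule uniq[OF Cc_fun_cmult[OF f]])
    show "0 \<le> \<Lambda> f" if f0: "\<And>x. 0 \<le> f x"
    proof (rule tendsto_lowerbound[OF lim[OF f]])
      show "\<forall>\<^sub>F t in at_right 0. 0 \<le> mass f t"
        using eventually_tint by eventually_elim (rule mass_nonneg[OF f f0])
    qed simp
    assume h: "Cc_fun \<Omega> h"
    have "((\<lambda>t. mass f t + mass h t) \<longlongrightarrow> \<Lambda> f + \<Lambda> h) (at_right 0)" by (intro tendsto_intros lim f h)
    moreover have "\<forall>\<^sub>F t in at_right 0. mass f t + mass h t = mass (\<lambda>x. f x + h x) t"
      using eventually_tint by eventually_elim (simp add: mass_add[OF f h])
    ultimately have "(mass (\<lambda>x. f x + h x) \<longlongrightarrow> \<Lambda> f + \<Lambda> h) (at_right 0)" by (rule Lim_transform_eventually)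
    then show "\<Lambda> (\<lambda>x. f x + h x) = \<Lambda> f + \<Lambda> h" by (rule uniq[OF Cc_fun_add[OF f h]])
  qed
  obtain \<mu> where "radon_on \<Omega> \<mu>" "\<And>f. Cc_fun \<Omega> f \<Longrightarrow> (\<integral>x. f x \<partial>\<mu>) = \<Lambda> f" using riesz_representation by blast
  then show ?thesis using lim by (intro exI[of _ \<mu>]) auto
qed

end

theorem theorem1p7:
  fixes q :: real and \<Omega> :: "'a::euclidean_space set" and T :: ereal
    and u :: "'a \<Rightarrow> real \<Rightarrow> real"
  assumes "0 < q" "q \<le> 1"
    and "open \<Omega>" "connected \<Omega>" "\<Omega> \<noteq> {}"
    and "0 < T"
    and "weak_solution q \<Omega> T u"
    and "\<forall>t\<in>tint T. AE x in lebesgue. x \<in> \<Omega> \<longrightarrow> 0 \<le> u x t"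
  shows "\<exists>u0 :: 'a measure. radon_on \<Omega> u0 \<and>
           (\<forall>\<psi>. Cc_fun \<Omega> \<psi> \<longrightarrow>
              ((\<lambda>t. LINT x:\<Omega>|lebesgue. u x t * \<psi> x) \<longlongrightarrow> (LINT x|u0. \<psi> x)) (at_right 0))"
proof -
  have slices: "\<forall>K. compact K \<and> K \<subseteq> \<Omega> \<longrightarrow>
        (\<forall>t\<in>tint T. set_integrable lebesgue K (\<lambda>x. u x t)) \<and>
        (\<forall>t\<in>tint T. ((\<lambda>s. LINT x:K|lebesgue. \<bar>u x s - u x t\<bar>) \<longlongrightarrow> 0) (at t within tint T))"
    using assms(7) unfolding weak_solution_def by (rule conjunct1)
  obtain g where g: "(\<forall>C. compact C \<and> C \<subseteq> cyl \<Omega> T \<longrightarrow>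
            set_integrable lebesgue C (\<lambda>(x,t). u x t)
          \<and> set_integrable lebesgue C (\<lambda>(x,t). g x t)
          \<and> set_integrable lebesgue C (\<lambda>(x,t). norm (g x t) powr q))
      \<and> (\<forall>\<phi>. test_fun (cyl \<Omega> T) \<phi> \<longrightarrow>
            (\<forall>b\<in>Basis. (LINT p:cyl \<Omega> T|lebesgue. u (fst p) (snd p) * dxi b \<phi> p)
                       = - (LINT p:cyl \<Omega> T|lebesgue. (g (fst p) (snd p) \<bullet> b) * \<phi> p))
          \<and> (LINT p:cyl \<Omega> T|lebesgue.
                 - u (fst p) (snd p) * dt \<phi> p - u (fst p) (snd p) * lapx \<phi> p
                 + norm (g (fst p) (snd p)) powr q * \<phi> p) = 0)"
    using conjunct2[OF assms(7)[unfolded weak_solution_def]] by (rule exE)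
  interpret hj_solution q \<Omega> T u g
  proof
    show "0 < q" "q \<le> 1" "open \<Omega>" "0 < T" by fact+
    fix K :: "'a set" and t :: real assume K: "compact K" "K \<subseteq> \<Omega>" "t \<in> tint T"
    show "set_integrable lebesgue K (\<lambda>x. u x t)" using slices K by blast
    show "((\<lambda>s. LINT x:K|lebesgue. \<bar>u x s - u x t\<bar>) \<longlongrightarrow> 0) (at t within tint T)" using slices K by blast
  next
    fix C :: "('a \<times> real) set" assume C: "compact C" "C \<subseteq> cyl \<Omega> T"
    show "set_integrable lebesgue C (\<lambda>p. u (fst p) (snd p))"
      "set_integrable lebesgue C (\<lambda>p. g (fst p) (snd p))"
      "set_integrable lebesgue C (\<lambda>p. norm (g (fst p) (snd p)) powr q)"
      using conjunct1[OF g, rule_format, OF conjI[OF C]] by (simp_all only: split_beta')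
  next
    fix \<phi> :: "'a \<times> real \<Rightarrow> real" and b :: 'a assume \<phi>: "test_fun (cyl \<Omega> T) \<phi>"
    show "(LINT p:cyl \<Omega> T|lebesgue. - u (fst p) (snd p) * dt \<phi> p - u (fst p) (snd p) * lapx \<phi> p
                 + norm (g (fst p) (snd p)) powr q * \<phi> p) = 0"
      by (rule conjunct2[OF conjunct2[OF g, rule_format, OF \<phi>]])
    show "(LINT p:cyl \<Omega> T|lebesgue. u (fst p) (snd p) * dxi b \<phi> p)
                       = - (LINT p:cyl \<Omega> T|lebesgue. (g (fst p) (snd p) \<bullet> b) * \<phi> p)" if "b \<in> Basis"
      by (rule bspec[OF conjunct1[OF conjunct2[OF g, THEN spec, THEN mp, OF \<phi>]] that])
  next
    fix t assume "t \<in> tint T"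
    then show "AE x in lebesgue. x \<in> \<Omega> \<longrightarrow> 0 \<le> u x t" by (rule bspec[OF assms(8)])
  qed
  have eq: "(LINT x:\<Omega>|lebesgue. u x t * \<psi> x) = mass \<psi> t" if "Cc_fun \<Omega> \<psi>" for \<psi> t
    unfolding mass_def
    by (rule set_integral_eq_integral) (use that not_in_tsupport[of _ \<psi>] in \<open>auto simp: Cc_fun_def\<close>)
  obtain u0 where "radon_on \<Omega> u0"
    and lim: "\<forall>\<psi>. Cc_fun \<Omega> \<psi> \<longrightarrow> (mass \<psi> \<longlongrightarrow> (LINT x|u0. \<psi> x)) (at_right 0)"
    using trace_exists by blast
  moreover have "((\<lambda>t. LINT x:\<Omega>|lebesgue. u x t * \<psi> x) \<longlongrightarrow> (LINT x|u0. \<psi> x)) (at_right 0)"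
    if "Cc_fun \<Omega> \<psi>" for \<psi>
    unfolding eq[OF that] using lim that by blast
  ultimately show ?thesis by blast
qed

end
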